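(* Let $\rho:\Gamma\to GL_4(\mathbb{C})$ be a $T$-determined, $T$-unitarizable representation, $\upsilon$ a multiplier system with cusp parameter $m$, and let $k_0$, $k_1=k_0+1$, $F_1$ and $\rho_1$ be as in the context. Let $G$ be a nonzero element of $\mathcal{H}(k_1,\rho_1,\upsilon)$. Then: (i) $\mathcal{H}(\rho_1,\upsilon)$ is a free $\mathcal{M}$-module of rank four with basis $\{G,DG,F_1,D^2G\}$; (ii) for all integers $k\ge0$, $\dim\mathcal{H}(k_1+2k,\rho_1,\upsilon)=\left[\frac{2k+1}{3}\right]+1$.
   Context: $\Gamma=SL(2,\mathbb{Z})$ acts on the upper half-plane $\mathbb{H}$ by Möbius transformations; $T=\begin{pmatrix}1&1\\0&1\end{pmatrix}$; $q=e^{2\pi iz}$, $\mathbf{e}(r)=e^{2\pi ir}$; $[x]$ is the greatest integer $\le x$; $\delta_{i,j}$ is the Kronecker delta. Complex powers use the principal branch of $\log$. For $k\in\mathbb{R}$, a multiplier system of weight $k$ is a map $\upsilon:\Gamma\to\{|w|=1\}$ such that $\nu(\gamma,z)=\upsilon(\gamma)(cz+d)^k$ satisfies $\nu(\gamma\sigma,z)=\nu(\gamma,\sigma z)\nu(\sigma,z)$; it is also one of weight $k+n$, $n\in\mathbb{Z}$. Cusp parameter: the $m\in[0,12)$ with $\upsilon(T)=\mathbf{e}(m/12)$. Slash: $(f|_k^\upsilon\gamma)(z)=\upsilon(\gamma)^{-1}(cz+d)^{-k}f(\gamma z)$. Moderate growth: $|f(x+iy)|\le y^N$ for $y>c$. $\mathcal{H}(k,\rho,\upsilon)$: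 column vectors $F$ of holomorphic moderate-growth functions on $\mathbb{H}$ with $F|_k^\upsilon\gamma=\rho(\gamma)F$ for all $\gamma$; $\mathcal{H}(\rho,\upsilon)=\bigoplus_{n\in\mathbb{Z}}\mathcal{H}(k+n,\rho,\upsilon)$. $\mathcal{M}=\mathbb{C}[E_4,E_6]$ is the graded ring of holomorphic integral-weight modular forms for $\Gamma$ with trivial multiplier, acting by multiplication. $T$-unitarizable: $\rho(T)$ conjugate to a unitary matrix. An irreducible $\rho$ of dimension $d$ is $T$-determined if every indecomposable $\rho':\Gamma\to GL_d(\mathbb{C})$ with $\rho'(T)$ having the same eigenvalues as $\rho(T)$ is irreducible. $\eta=q^{1/24}\prod_{n\ge1}(1-q^n)$, $P=\frac{i}{\pi}\frac{\eta'}{\eta}$, $D_kf=\frac{1}{2\pi i}\frac{df}{dz}+kPf$; $D$ acts on $\mathcal{H}(k,\rho,\upsilon)$ componentwise as $D_k$, $D^n=D_{k+2(n-1)}\circ\cdots\circ D_k$. An MLDE of order $n$ in weight $k$ is $D_k^nf+M_4D_k^{n-2}f+\cdots+M_{2n}f=0$, $M_{2j}\in\mathcal{M}_{2j}$; rewriting it as $q^n\frac{d^nf}{dq^n}+\sum_{j<n}q^jg_j(q)\frac{d^jf}{dq^j}=0$ with $g_j$ holomorphic at $0$, its indicial roots are the roots of $r(r-1)\cdots(r-n+1)+\sum_{j<n}g_j(0)r(r-1)\cdots(r-j+1)$. Setting: write the (distinct) eigenvalues of $\rho(T)$ as $\mathbf{e}(r_1),\dots,\mathbf{e}(r_4)$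 with $0\le r_1<\dots<r_4<1$; let $\lambda_j\in[0,1)$ with $\lambda_j\equiv r_j+\frac{m}{12}\pmod{\mathbb{Z}}$, $\lambda_0=\sum_j\lambda_j$, $k_0=3\lambda_0-3$, $k_1=k_0+1$. Fix $i\in\{1,2,3,4\}$ with $\lambda_i\neq\frac{k_1}{12}$. Let $L[f]=0$ be the unique fourth order MLDE (in weight $k_0+3$) with indicial roots $\lambda_j+\delta_{i,j}$, $j=1,\dots,4$; it has a fundamental system $f_j=q^{\lambda_j+\delta_{i,j}}(1+\sum_{n\ge1}b_j(n)q^n)$. Put $F_1=(f_1,\dots,f_4)^t$ and let $\rho_1:\Gamma\to GL_4(\mathbb{C})$ be the representation with $F_1|_{k_0+3}^\upsilon\gamma=\rho_1(\gamma)F_1$ for all $\gamma$. *)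

theory Defs
  imports "HOL-Complex_Analysis.Complex_Analysis" "HOL-Library.Function_Algebras"
begin

text \<open>Elements of SL(2,Z) are quadruples (a,b,c,d) standing for the matrix [[a,b],[c,d]].\<close>
type_synonym sl2 = "int \<times> int \<times> int \<times> int"

definition SL2Z :: "sl2 set" where
  "SL2Z = {(a,b,c,d). a*d - b*c = 1}"

fun sl_mult :: "sl2 \<Rightarrow> sl2 \<Rightarrow> sl2" where
  "sl_mult (a,b,c,d) (a',b',c',d') = (a*a'+b*c', a*b'+b*d', c*a'+d*c', c*b'+d*d')"

definition Tmat :: sl2 where "Tmat = (1,1,0,1)"

definition Hp :: "complex set" where "Hp = {z. 0 < Im z}"

fun moeb :: "sl2 \<Rightarrow> complex \<Rightarrow> complex" where
  "moeb (a,b,c,d) z = (of_int a * z + of_int b) / (of_int c * z + of_int d)"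

fun jfac :: "sl2 \<Rightarrow> complex \<Rightarrow> complex" where
  "jfac (a,b,c,d) z = of_int c * z + of_int d"

definition ee :: "real \<Rightarrow> complex" where
  "ee r = exp (2 * of_real pi * \<i> * of_real r)"

definition qpow :: "complex \<Rightarrow> complex \<Rightarrow> complex" where
  "qpow s z = exp (2 * of_real pi * \<i> * s * z)"

text \<open>Multiplier system of (real) weight k; complex powers are principal (powr uses Ln).\<close>
definition mult_sys :: "real \<Rightarrow> (sl2 \<Rightarrow> complex) \<Rightarrow> bool" where
  "mult_sys k \<upsilon> \<longleftrightarrow>
     (\<forall>\<gamma>\<in>SL2Z. norm (\<upsilon> \<gamma>) = 1) \<and>
     (\<forall>\<gamma>\<in>SL2Z. \<forall>\<sigma>\<in>SL2Z. \<forall>z\<in>Hp.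
        \<upsilon> (sl_mult \<gamma> \<sigma>) * jfac (sl_mult \<gamma> \<sigma>) z powr of_real k
        = (\<upsilon> \<gamma> * jfac \<gamma> (moeb \<sigma> z) powr of_real k) * (\<upsilon> \<sigma> * jfac \<sigma> z powr of_real k))"

definition cusp_param :: "(sl2 \<Rightarrow> complex) \<Rightarrow> real \<Rightarrow> bool" where
  "cusp_param \<upsilon> m \<longleftrightarrow> 0 \<le> m \<and> m < 12 \<and> \<upsilon> Tmat = ee (m / 12)"

definition slashV :: "real \<Rightarrow> (sl2 \<Rightarrow> complex) \<Rightarrow> sl2 \<Rightarrow> (complex \<Rightarrow> complex^'n) \<Rightarrow> complex \<Rightarrow> complex^'n" where
  "slashV k \<upsilon> \<gamma> F z = (inverse (\<upsilon> \<gamma>) * jfac \<gamma> z powr (- of_real k)) *s F (moeb \<gamma> z)"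

definition rep :: "(sl2 \<Rightarrow> complex^'n^'n) \<Rightarrow> bool" where
  "rep \<rho> \<longleftrightarrow> (\<forall>\<gamma>\<in>SL2Z. invertible (\<rho> \<gamma>)) \<and>
     (\<forall>\<gamma>\<in>SL2Z. \<forall>\<sigma>\<in>SL2Z. \<rho> (sl_mult \<gamma> \<sigma>) = \<rho> \<gamma> ** \<rho> \<sigma>)"

definition invariant_subspace :: "(sl2 \<Rightarrow> complex^'n^'n) \<Rightarrow> (complex^'n) set \<Rightarrow> bool" where
  "invariant_subspace \<rho> W \<longleftrightarrow> vec.subspace W \<and> (\<forall>\<gamma>\<in>SL2Z. \<forall>v\<in>W. \<rho> \<gamma> *v v \<in> W)"

definition irreducible_rep :: "(sl2 \<Rightarrow> complex^'n^'n) \<Rightarrow> bool" where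
  "irreducible_rep \<rho> \<longleftrightarrow> (\<forall>W. invariant_subspace \<rho> W \<longrightarrow> W = {0} \<or> W = UNIV)"

definition indecomposable_rep :: "(sl2 \<Rightarrow> complex^'n^'n) \<Rightarrow> bool" where
  "indecomposable_rep \<rho> \<longleftrightarrow> \<not> (\<exists>W1 W2. invariant_subspace \<rho> W1 \<and> invariant_subspace \<rho> W2 \<and>
      W1 \<noteq> {0} \<and> W2 \<noteq> {0} \<and> W1 \<inter> W2 = {0} \<and> (\<forall>v. \<exists>x\<in>W1. \<exists>y\<in>W2. v = x + y))"

definition eigvals :: "complex^'n^'n \<Rightarrow> complex set" where
  "eigvals A = {\<mu>. \<exists>v. v \<noteq> 0 \<and> A *v v = \<mu> *s v}"

definition T_determined :: "(sl2 \<Rightarrow> complex^'n^'n) \<Rightarrow> bool" where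
  "T_determined \<rho> \<longleftrightarrow> irreducible_rep \<rho> \<and>
     (\<forall>\<rho>'::sl2 \<Rightarrow> complex^'n^'n. rep \<rho>' \<and> indecomposable_rep \<rho>' \<and>
        eigvals (\<rho>' Tmat) = eigvals (\<rho> Tmat) \<longrightarrow> irreducible_rep \<rho>')"

definition conj_transpose :: "complex^'n^'n \<Rightarrow> complex^'n^'n" where
  "conj_transpose U = (\<chi> i j. cnj (U $ j $ i))"

definition unitary_mat :: "complex^'n^'n \<Rightarrow> bool" where
  "unitary_mat U \<longleftrightarrow> U ** conj_transpose U = mat 1"

definition T_unitarizable :: "(sl2 \<Rightarrow> complex^'n^'n) \<Rightarrow> bool" where
  "T_unitarizable \<rho> \<longleftrightarrow>
     (\<exists>P::complex^'n^'n. invertible P \<and> unitary_mat (matrix_inv P ** \<rho> Tmat ** P))"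

text \<open>Convention: functions on the upper half-plane are represented as functions on C
  that vanish outside Hp.\<close>

definition moderate_growth :: "(complex \<Rightarrow> complex) \<Rightarrow> bool" where
  "moderate_growth f \<longleftrightarrow> (\<exists>N::nat. \<exists>c. \<forall>x y. c < y \<longrightarrow> norm (f (Complex x y)) \<le> y ^ N)"

definition Hspace :: "real \<Rightarrow> (sl2 \<Rightarrow> complex^'n^'n) \<Rightarrow> (sl2 \<Rightarrow> complex) \<Rightarrow> (complex \<Rightarrow> complex^'n) set" where
  "Hspace k \<rho> \<upsilon> = {F. (\<forall>j. (\<lambda>z. F z $ j) holomorphic_on Hp) \<and> (\<forall>z. z \<notin> Hp \<longrightarrow> F z = 0) \<and>
      (\<forall>j. moderate_growth (\<lambda>z. F z $ j)) \<and>
      (\<forall>\<gamma>\<in>SL2Z. \<forall>z\<in>Hp. slashV k \<upsilon> \<gamma> F z = \<rho> \<gamma> *v F z)}"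

definition Mk :: "int \<Rightarrow> (complex \<Rightarrow> complex) set" where
  "Mk k = {f. f holomorphic_on Hp \<and> (\<forall>z. z \<notin> Hp \<longrightarrow> f z = 0) \<and> moderate_growth f \<and>
      (\<forall>\<gamma>\<in>SL2Z. \<forall>z\<in>Hp. f (moeb \<gamma> z) = jfac \<gamma> z powi k * f z)}"

definition Hgr :: "real \<Rightarrow> (sl2 \<Rightarrow> complex^'n^'n) \<Rightarrow> (sl2 \<Rightarrow> complex) \<Rightarrow> (int \<Rightarrow> complex \<Rightarrow> complex^'n) set" where
  "Hgr k \<rho> \<upsilon> = {h. finite {n. h n \<noteq> 0} \<and> (\<forall>n. h n \<in> Hspace (k + of_int n) \<rho> \<upsilon>)}"

definition Mgr :: "(int \<Rightarrow> complex \<Rightarrow> complex) set" where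
  "Mgr = {a. finite {j. a j \<noteq> 0} \<and> (\<forall>j. a j \<in> Mk j)}"

definition gmult :: "(int \<Rightarrow> complex \<Rightarrow> complex) \<Rightarrow> (int \<Rightarrow> complex \<Rightarrow> complex^'n) \<Rightarrow> int \<Rightarrow> complex \<Rightarrow> complex^'n" where
  "gmult a h = (\<lambda>n z. \<Sum>j\<in>{j. a j \<noteq> 0}. a j z *s h (n - j) z)"

definition homog :: "int \<Rightarrow> (complex \<Rightarrow> complex^'n) \<Rightarrow> int \<Rightarrow> complex \<Rightarrow> complex^'n" where
  "homog d F = (\<lambda>n. if n = d then F else 0)"

definition is_M_basis :: "real \<Rightarrow> (sl2 \<Rightarrow> complex^'n^'n) \<Rightarrow> (sl2 \<Rightarrow> complex) \<Rightarrow> (int \<Rightarrow> complex \<Rightarrow> complex^'n) list \<Rightarrow> bool" where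
  "is_M_basis k \<rho> \<upsilon> bs \<longleftrightarrow>
     (\<forall>b\<in>set bs. b \<in> Hgr k \<rho> \<upsilon>) \<and>
     (\<forall>h\<in>Hgr k \<rho> \<upsilon>. \<exists>a. (\<forall>i<length bs. a i \<in> Mgr) \<and> h = (\<Sum>i<length bs. gmult (a i) (bs ! i))) \<and>
     (\<forall>a. (\<forall>i<length bs. a i \<in> Mgr) \<and> (\<Sum>i<length bs. gmult (a i) (bs ! i)) = 0 \<longrightarrow> (\<forall>i<length bs. a i = 0))"

definition cdim :: "(complex \<Rightarrow> complex^'n) set \<Rightarrow> nat" where
  "cdim V = vector_space.dim (\<lambda>(c::complex) F z. c *s F z) V"

definition eta :: "complex \<Rightarrow> complex" where
  "eta z = exp (2 * of_real pi * \<i> * z / 24) * prodinf (\<lambda>n. 1 - exp (2 * of_real pi * \<i> * z) ^ Suc n)"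

definition Pfun :: "complex \<Rightarrow> complex" where
  "Pfun z = (\<i> / of_real pi) * (deriv eta z / eta z)"

definition Dop :: "real \<Rightarrow> (complex \<Rightarrow> complex) \<Rightarrow> complex \<Rightarrow> complex" where
  "Dop k f = (\<lambda>z. if z \<in> Hp then deriv f z / (2 * of_real pi * \<i>) + of_real k * Pfun z * f z else 0)"

fun Dpow :: "nat \<Rightarrow> real \<Rightarrow> (complex \<Rightarrow> complex) \<Rightarrow> complex \<Rightarrow> complex" where
  "Dpow 0 k f = f"
| "Dpow (Suc n) k f = Dop (k + 2 * real n) (Dpow n k f)"

definition DopV :: "real \<Rightarrow> (complex \<Rightarrow> complex^'n) \<Rightarrow> complex \<Rightarrow> complex^'n" where
  "DopV k F = (\<lambda>z. \<chi> j. Dop k (\<lambda>w. F w $ j) z)"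

fun DpowV :: "nat \<Rightarrow> real \<Rightarrow> (complex \<Rightarrow> complex^'n) \<Rightarrow> complex \<Rightarrow> complex^'n" where
  "DpowV 0 k F = F"
| "DpowV (Suc n) k F = DopV (k + 2 * real n) (DpowV n k F)"

definition L4 :: "real \<Rightarrow> (complex \<Rightarrow> complex) \<Rightarrow> (complex \<Rightarrow> complex) \<Rightarrow> (complex \<Rightarrow> complex)
    \<Rightarrow> (complex \<Rightarrow> complex) \<Rightarrow> complex \<Rightarrow> complex" where
  "L4 k M4 M6 M8 f = (\<lambda>z. Dpow 4 k f z + M4 z * Dpow 2 k f z + M6 z * Dpow 1 k f z + M8 z * f z)"

text \<open>Indicial polynomial of the MLDE: writing it in the variable q with coefficients g_j
  holomorphic at q = 0, one has q^(-s) L[q^s] = sum_j g_j(q) s(s-1)...(s-j+1), whose value at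
  q = 0 (i.e. the limit as Im z tends to infinity) is the indicial polynomial evaluated at s.
  has_indicial_roots k M4 M6 M8 mu: the indicial polynomial is prod_j (s - mu_j), j = 1..4.\<close>
definition has_indicial_roots :: "real \<Rightarrow> (complex \<Rightarrow> complex) \<Rightarrow> (complex \<Rightarrow> complex) \<Rightarrow> (complex \<Rightarrow> complex)
    \<Rightarrow> (nat \<Rightarrow> real) \<Rightarrow> bool" where
  "has_indicial_roots k M4 M6 M8 \<mu> \<longleftrightarrow>
     (\<forall>s::complex. ((\<lambda>y::real. L4 k M4 M6 M8 (qpow s) (\<i> * of_real y) / qpow s (\<i> * of_real y))
        \<longlongrightarrow> (\<Prod>j\<in>{1..4::nat}. s - of_real (\<mu> j))) at_top)"

end

theory Submission
  imports Defs "HOL-Real_Asymp.Real_Asymp"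
begin

text \<open>
  Every determinant of four vector-valued forms for \<open>\<rho>\<^sub>1\<close> is, up to a character, a scalar form whose order
  at the cusp is bounded below by the sum of the exponents; a maximum principle for the quotient by a
  power of \<open>\<eta>\<close> shows that it vanishes if 12 times this order exceeds its weight, and is a multiple of
  a power of \<open>\<eta>\<close> if there is equality. The MLDE has no third order term, so the Wronskian of \<open>F\<^sub>1\<close> is a
  power of \<open>\<eta>\<close>, and its transformation law yields that of \<open>\<eta>\<close> and of \<open>P\<close>. Applied to the two blocks of a
  decomposition of \<open>\<rho>\<^sub>1\<close>, the bound shows indecomposability, hence irreducibility since \<open>\<rho>\<close> is
  T-determined. Applied to the Wronskian of \<open>G\<close>, it shows that the exponents of \<open>G\<close> are exactly the \<open>\<lambda>\<^sub>j\<close>.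
  If \<open>det(G, DG, F\<^sub>1, D\<^sup>2G)\<close> vanished, Cramer's rule with the Wronskian of \<open>G\<close> would express \<open>E\<^sub>4 F\<^sub>1\<close>
  through \<open>E\<^sub>6 G\<close> and \<open>E\<^sub>4 DG\<close>; evaluation at the zero of \<open>E\<^sub>4\<close> removes the first term, and
  \<open>\<lambda>\<^sub>i \<noteq> k\<^sub>1/12\<close> then forces \<open>F\<^sub>1 = 0\<close>. So the determinant vanishes nowhere, and Cramer's rule
  gives the basis.
\<close>

text \<open>All constants come from one count. Write \<Lambda> for the sum of the \<lambda>'s. A
  determinant of four forms has the sum of their weights as its weight; its order is at least
  \<Lambda>, and at least \<Lambda> + 1 if all four share the raised exponents of F1. As F1 has
  weight 3 \<Lambda>, its Wronskian has weight 12 \<Lambda> + 12, the equality case. G has weight 3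
  \<Lambda> - 2, so its Wronskian has weight 12 \<Lambda> + 4; the excess over 12 \<Lambda> is a
  scalar form of weight 4, a multiple of E_4. Finally det(G, DG, F1, D^2 G) has weight 12 \<Lambda>,
  which leaves only a constant. The delicate point is an apparent circle: derivatives of forms are
  forms only if P is quasi-modular, and this is deduced from a Wronskian built of such derivatives.
  The way out is a derivation with an arbitrary function p in place of P: the Wronskian does not
  depend on p. T-determinacy applies because \<rho>(T) and \<rho>_1(T) have the same
  eigenvalues.\<close>

no_notation fps_nth (infixl "$" 75)

section \<open>q-expansions\<close>

lemma open_Hp: "open Hp"
  unfolding Hp_def by (rule open_halfspace_Im_gt)

lemma connected_Hp: "connected Hp"
  unfolding Hp_def using convex_halfspace_Im_gt convex_connected by blast

lemma i_in_Hp: "\<i> \<in> Hp"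
  by (simp add: Hp_def)

abbreviation (input) \<tau> :: complex where "\<tau> \<equiv> 2 * of_real pi * \<i>"

lemma qpow_add: "qpow (s + t) z = qpow s z * qpow t z"
  unfolding qpow_def by (simp add: exp_add [symmetric] algebra_simps)

lemma qpow_0 [simp]: "qpow 0 z = 1"
  by (simp add: qpow_def)

lemma qpow_nonzero [simp]: "qpow s z \<noteq> 0"
  by (simp add: qpow_def)

lemma qpow_of_nat: "qpow (of_nat n) z = qpow 1 z ^ n"
  by (simp add: qpow_def exp_of_nat_mult [symmetric] algebra_simps)

lemma norm_qpow: "norm (qpow (of_real s) z) = exp (- (2 * pi * s * Im z))"
  by (simp add: qpow_def)

lemma norm_qpow_1: "norm (qpow 1 z) = exp (- (2 * pi * Im z))"
  using norm_qpow [of 1 z] by simp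

lemma qpow_1_in_ball: "z \<in> Hp \<Longrightarrow> qpow 1 z \<in> ball 0 1"
  by (simp add: norm_qpow_1 Hp_def)

lemma qpow_shift: "qpow s (z + 1) = exp (\<tau> * s) * qpow s z"
  unfolding qpow_def by (simp add: exp_add [symmetric] algebra_simps)

lemma qpow_shift_real: "qpow (of_real s) (z + 1) = ee s * qpow (of_real s) z"
  by (simp add: qpow_shift ee_def)

lemma qpow_1_shift: "qpow 1 (z + 1) = qpow 1 z"
  by (simp add: qpow_shift)

lemma qpow_1_surj:
  assumes "q \<in> ball 0 1" "q \<noteq> 0"
  obtains z where "z \<in> Hp" "qpow 1 z = q"
proof
  show "qpow 1 (Ln q / \<tau>) = q"
    using assms by (simp add: qpow_def)
  have "Re (Ln q) < 0" using assms by simp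
  then show "Ln q / \<tau> \<in> Hp"
    by (simp add: Hp_def Im_divide power2_eq_square field_simps mult_neg_pos)
qed

lemma has_derivative_qpow [derivative_intros]:
  "(qpow s has_field_derivative \<tau> * s * qpow s z) (at z within S)"
  unfolding qpow_def by (auto intro!: derivative_eq_intros)

lemma qpow_holomorphic [holomorphic_intros]: "qpow s holomorphic_on S"
  unfolding qpow_def by (intro holomorphic_intros)

text \<open>The exponent \<open>s\<close> is only a lower bound for the order at the cusp, since
  \<open>g 0\<close> may vanish. Nothing is said about \<open>h\<close> outside
  \<open>Hp\<close>.\<close>

definition qexp :: "real \<Rightarrow> (complex \<Rightarrow> complex) \<Rightarrow> (complex \<Rightarrow> complex) \<Rightarrow> bool" where
  "qexp s g h \<longleftrightarrow> g holomorphic_on ball 0 1 \<and>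
     (\<forall>z\<in>Hp. h z = qpow (of_real s) z * g (qpow 1 z))"

lemma qexpD: "qexp s g h \<Longrightarrow> z \<in> Hp \<Longrightarrow> h z = qpow (of_real s) z * g (qpow 1 z)"
  by (simp add: qexp_def)

lemma qexp_cong: "qexp s g h \<Longrightarrow> (\<And>z. z \<in> Hp \<Longrightarrow> h z = h' z) \<Longrightarrow> qexp s g h'"
  by (simp add: qexp_def)

lemma qexp_zero: "qexp s (\<lambda>q. 0) (\<lambda>z. 0)"
  by (simp add: qexp_def)

lemma qexp_const: "qexp 0 (\<lambda>q. c) (\<lambda>z. c)"
  by (simp add: qexp_def)

lemma qexp_add: "qexp s g h \<Longrightarrow> qexp s g' h' \<Longrightarrow> qexp s (\<lambda>q. g q + g' q) (\<lambda>z. h z + h' z)"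
  by (auto simp: qexp_def algebra_simps intro!: holomorphic_intros)

lemma qexp_diff: "qexp s g h \<Longrightarrow> qexp s g' h' \<Longrightarrow> qexp s (\<lambda>q. g q - g' q) (\<lambda>z. h z - h' z)"
  by (auto simp: qexp_def algebra_simps intro!: holomorphic_intros)

lemma qexp_cmult: "qexp s g h \<Longrightarrow> qexp s (\<lambda>q. c * g q) (\<lambda>z. c * h z)"
  by (auto simp: qexp_def algebra_simps intro!: holomorphic_intros)

lemma qexp_mult: "qexp s g h \<Longrightarrow> qexp t g' h' \<Longrightarrow> qexp (s + t) (\<lambda>q. g q * g' q) (\<lambda>z. h z * h' z)"
  by (auto simp: qexp_def qpow_add algebra_simps intro!: holomorphic_intros)

lemma qexp_holomorphic:
  assumes "qexp s g h" shows "h holomorphic_on Hp"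
proof -
  have "(g \<circ> qpow 1) holomorphic_on Hp"
    using assms qpow_1_in_ball
    by (intro holomorphic_on_compose_gen [of _ _ _ "ball 0 1"]) (auto simp: qexp_def intro!: holomorphic_intros)
  then have "(\<lambda>z. qpow (of_real s) z * (g \<circ> qpow 1) z) holomorphic_on Hp"
    by (intro holomorphic_intros)
  then show ?thesis
    using assms by (simp add: qexp_def cong: holomorphic_cong)
qed

text \<open>\<open>qpow 1\<close> maps \<open>Hp\<close> onto the punctured disc, so the two series
  agree off 0, and at 0 by continuity. Hence \<open>g 0\<close> is well defined and leading
  coefficients can be compared.\<close>

lemma qexp_unique:
  assumes "qexp s g h" "qexp s g' h" "q \<in> ball 0 1" shows "g q = g' q"
proof -
  have nz: "g q = g' q" if "q \<in> ball 0 1 - {0}" for q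
  proof -
    have "q \<in> ball 0 1" "q \<noteq> 0" using that by auto
    then obtain z where "z \<in> Hp" "qpow 1 z = q" by (rule qpow_1_surj)
    then show ?thesis using assms qpow_nonzero unfolding qexp_def by (metis mult_cancel_left)
  qed
  show ?thesis
  proof (cases "q = 0")
    case True
    have "isCont g 0" "isCont g' 0"
      using assms by (auto simp: qexp_def intro!: holomorphic_on_imp_continuous_on continuous_on_interior [of "ball 0 1"])
    then have lim: "(g \<longlongrightarrow> g 0) (at 0)" "(g' \<longlongrightarrow> g' 0) (at 0)"
      by (simp_all add: isCont_def)
    have "eventually (\<lambda>q. q \<in> ball 0 1 - {0}) (at (0::complex))"
      by (rule eventually_at_in_open) auto
    then have "eventually (\<lambda>q. g q = g' q) (at 0)"
      by (rule eventually_mono) (use nz in auto)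
    then have "(g' \<longlongrightarrow> g 0) (at 0)"
      using lim(1) tendsto_cong by force
    then show ?thesis using lim(2) True tendsto_unique [of "at (0::complex)"] by auto
  qed (use nz assms in auto)
qed

text \<open>Serves both ways: a vanishing determinant kills its leading coefficient, and a nonzero
  leading coefficient shows that a function is not identically zero.\<close>

lemma qexp_zero_iff:
  assumes "qexp s g h" "\<And>z. z \<in> Hp \<Longrightarrow> h z = 0" shows "g 0 = 0"
proof -
  have "qexp s (\<lambda>q. 0) h"
    using qexp_cong [OF qexp_zero] assms(2) by metis
  from qexp_unique [OF assms(1) this, of 0] show ?thesis by simp
qed

lemma qexp_raise:
  assumes "qexp s g h" "g 0 = 0"
  obtains g' where "qexp (s + 1) g' h"
proof -
  have gh: "g holomorphic_on ball 0 1" using assms by (simp add: qexp_def)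
  define g' where "g' = (\<lambda>q. if q = 0 then deriv g 0 else g q / q)"
  have "g' holomorphic_on ball 0 1"
    by (rule pole_theorem_open_0 [OF gh, of 0 g']) (use assms in \<open>auto simp: g'_def\<close>)
  moreover have "h z = qpow (of_real (s + 1)) z * g' (qpow 1 z)" if "z \<in> Hp" for z
    using qexpD [OF assms(1) that] assms(2) by (simp add: g'_def qpow_add)
  ultimately have "qexp (s + 1) g' h" by (simp add: qexp_def)
  then show ?thesis by (rule that)
qed

lemma qexp_lower:
  assumes "qexp (s + of_nat n) g h" shows "qexp s (\<lambda>q. q ^ n * g q) h"
  using assms by (auto simp: qexp_def qpow_add qpow_of_nat intro!: holomorphic_intros)

text \<open>Divide out the zero of \<open>g\<close> at the cusp. One nonzero value of
  \<open>h\<close> rules out \<open>g = 0\<close>, which has no finite order.\<close>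

lemma qexp_exact:
  assumes "qexp s g h" "z0 \<in> Hp" "h z0 \<noteq> 0"
  obtains n g' where "qexp (s + of_nat n) g' h" "g' 0 \<noteq> 0"
proof -
  have gh: "g holomorphic_on ball 0 1" using assms by (simp add: qexp_def)
  show ?thesis
  proof (cases "g 0 = 0")
    case False then show ?thesis using that [of 0 g] assms by simp
  next
    case True
    have "g (qpow 1 z0) \<noteq> g 0"
      using assms qexpD [OF assms(1,2)] True by auto
    have z0: "(0::complex) \<in> ball 0 1" by simp
    from \<open>g (qpow 1 z0) \<noteq> g 0\<close> have nc: "\<not> g constant_on ball 0 1"
      using qpow_1_in_ball [OF assms(2)] unfolding constant_on_def by fastforce
    show ?thesis
    proof (rule holomorphic_factor_zero_nonconstant [OF gh open_ball connected_ball z0 True nc])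
      fix g' :: "complex \<Rightarrow> complex" and r :: real and n :: nat
      assume *: "0 < n" "0 < r" "ball 0 r \<subseteq> ball 0 (1::real)" "g' holomorphic_on ball 0 r"
        "\<And>w. w \<in> ball 0 r \<Longrightarrow> g w = (w - 0) ^ n * g' w" "\<And>w. w \<in> ball 0 r \<Longrightarrow> g' w \<noteq> 0"
    \<comment> \<open>The factor \<open>g'\<close> lives only on a small disc; off 0 it equals
      \<open>g w / w ^ n\<close>, which extends it to the unit disc.\<close>
    define k where "k = (\<lambda>w. if w \<in> ball 0 r then g' w else g w / w ^ n)"
    have k1: "k w = g w / w ^ n" if "w \<noteq> 0" for w
      using *(5) [of w] that by (auto simp: k_def)
    have "k holomorphic_on ball 0 r \<union> (ball 0 1 - {0})"
    proof (rule holomorphic_on_Un)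
      show "k holomorphic_on ball 0 r"
        by (rule holomorphic_transform [OF *(4)]) (simp add: k_def)
      have "(\<lambda>w. g w / w ^ n) holomorphic_on ball 0 1 - {0}"
        by (intro holomorphic_intros holomorphic_on_subset [OF gh]) auto
      then show "k holomorphic_on ball 0 1 - {0}"
        by (rule holomorphic_transform) (use k1 in auto)
    qed auto
    moreover have "ball 0 1 \<subseteq> ball 0 r \<union> (ball 0 1 - {0::complex})" using *(2) by auto
    ultimately have kh: "k holomorphic_on ball 0 1" using holomorphic_on_subset by blast
    have "h z = qpow (of_real (s + of_nat n)) z * k (qpow 1 z)" if "z \<in> Hp" for z
      using qexpD [OF assms(1) that] k1 [of "qpow 1 z"] by (simp add: qpow_add qpow_of_nat)
    with kh have "qexp (s + of_nat n) k h" by (simp add: qexp_def)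
    moreover have "k 0 \<noteq> 0" using * by (simp add: k_def)
    ultimately show ?thesis by (rule that)
    qed
  qed
qed

lemma qexp_shift:
  assumes "qexp s g h" "z \<in> Hp" shows "h (z + 1) = ee s * h z"
  using qexpD [OF assms] qexpD [OF assms(1), of "z + 1"] assms(2)
  by (simp add: Hp_def qpow_shift_real qpow_1_shift)

lemma norm_ee [simp]: "norm (ee s) = 1"
proof -
  have "ee s = exp (\<i> * of_real (2 * pi * s))" by (simp add: ee_def algebra_simps)
  then show ?thesis by (simp only: norm_exp_i_times)
qed

lemma Hp_Complex: "Complex x y \<in> Hp \<longleftrightarrow> 0 < y"
  by (simp add: Hp_def)

text \<open>For \<open>|q| <= 1/2\<close> the factor \<open>g\<close> is bounded by some
  \<open>B\<close>, and \<open>0 <= s\<close> makes \<open>|q^s| <= 1\<close>. So \<open>h\<close>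
  is even bounded near the cusp; the exponent 1 in the witness comes from requiring
  \<open>y > B\<close>.\<close>

lemma qexp_moderate_growth:
  assumes "qexp s g h" "0 \<le> s" shows "moderate_growth h"
proof -
  have "g holomorphic_on cball 0 (1/2)"
    using assms by (auto simp: qexp_def intro: holomorphic_on_subset)
  then have "compact (g ` cball 0 (1/2))"
    by (simp add: compact_continuous_image holomorphic_on_imp_continuous_on)
  then have "bounded (g ` cball 0 (1/2))" by (rule compact_imp_bounded)
  then obtain B where "\<forall>x\<in>g ` cball 0 (1/2). norm x \<le> B" unfolding bounded_iff ..
  then have B: "norm (g q) \<le> B" if "norm q \<le> 1/2" for q using that by simp
  have "norm (h (Complex x y)) \<le> y ^ 1" if "max 1 (max B (ln 2)) < y" for x y
  proof -
    have y: "y > 1" "y > B" "y > ln 2" using that by auto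
    have "1 * y < 2 * pi * y" using pi_gt3 y by (intro mult_strict_right_mono) auto
    then have "norm (qpow 1 (Complex x y)) \<le> exp (- ln 2)"
      using y unfolding norm_qpow_1 exp_le_cancel_iff complex.sel by linarith
    then have 1: "norm (g (qpow 1 (Complex x y))) \<le> B" by (intro B) (simp add: exp_minus)
    have "norm (qpow (of_real s) (Complex x y)) \<le> 1"
      unfolding norm_qpow using assms(2) y by simp
    then have "norm (qpow (of_real s) (Complex x y)) * norm (g (qpow 1 (Complex x y))) \<le> 1 * B"
      using 1 by (intro mult_mono) auto
    then have "norm (h (Complex x y)) \<le> B"
      using y by (subst qexpD [OF assms(1)]) (auto simp: Hp_Complex norm_mult)
    then show ?thesis using y by simp
  qed
  then show ?thesis unfolding moderate_growth_def by blast
qed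

section \<open>From periodicity and moderate growth to a q-expansion\<close>

lemma periodic_int:
  assumes per: "\<And>z. z \<in> Hp \<Longrightarrow> k (z + 1) = (k z :: complex)" and "z \<in> Hp"
  shows "k (z + of_int n) = k z"
proof -
  have H: "z + of_int m \<in> Hp" for m using assms(2) by (simp add: Hp_def)
  have nat: "k (w + of_nat m) = k w" if "w \<in> Hp" for w and m :: nat
  proof (induction m)
    case (Suc m)
    have "w + of_nat m \<in> Hp" using that by (simp add: Hp_def)
    from per [OF this] Suc show ?case by (simp add: algebra_simps)
  qed simp
  show ?thesis
  proof (cases "n \<ge> 0")
    case True then show ?thesis using nat [OF assms(2), of "nat n"] by simp
  next
    case False then show ?thesis using nat [OF H, of n "nat (-n)"] by simp
  qed
qed

text \<open>Removable singularity at \<open>q = 0\<close>: with \<open>k = q^(-s) h\<close> one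
  needs that \<open>q k\<close> tends to 0, and its norm is at most
  \<open>y^N exp (- 2 pi (1 - s) y)\<close>. Here \<open>s < 1\<close> enters, which is why the
  exponents are normalised to [0,1).\<close>

lemma qexp_of_moderate_growth:
  assumes hol: "h holomorphic_on Hp" and sh: "\<And>z. z \<in> Hp \<Longrightarrow> h (z + 1) = ee s * h z"
    and mg: "moderate_growth h" and s1: "s < 1"
  obtains g where "qexp s g h"
proof -
  define k where "k = (\<lambda>z. h z * qpow (- of_real s) z)"
  have kper: "k (z + 1) = k z" if "z \<in> Hp" for z
  proof -
    have "ee s * exp (\<tau> * (- of_real s)) = 1"
      by (simp add: ee_def exp_add [symmetric])
    then show ?thesis using sh [OF that] by (simp add: k_def qpow_shift)
  qed
  have khol: "k holomorphic_on Hp" unfolding k_def by (intro holomorphic_intros hol)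
  \<comment> \<open>The principal logarithm jumps on the negative axis, but \<open>lg\<close> then
    jumps by an integer, which the periodic \<open>k\<close> does not see.\<close>
  define lg where "lg = (\<lambda>q. Ln q / \<tau>)"
  define g0 where "g0 = (\<lambda>q. k (lg q))"
  have lgq: "qpow 1 (lg q) = q" if "q \<noteq> 0" for q
    using that by (simp add: qpow_def lg_def)
  have Hpq: "z \<in> Hp \<longleftrightarrow> norm (qpow 1 z) < 1" for z by (simp add: Hp_def norm_qpow_1 zero_less_mult_iff)
  have lgH: "lg q \<in> Hp" if "q \<in> ball 0 1 - {0}" for q
    using that lgq [of q] by (simp add: Hpq)
  have g0k: "g0 (qpow 1 z) = k z" if "z \<in> Hp" for z
  proof -
    have "qpow 1 (lg (qpow 1 z)) = qpow 1 z" by (simp add: lgq)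
    then obtain n :: int where "\<tau> * lg (qpow 1 z) = \<tau> * z + of_int (2 * n) * (of_real pi * \<i>)"
      unfolding qpow_def exp_eq by auto
    then have "\<tau> * lg (qpow 1 z) = \<tau> * (z + of_int n)"
      by (simp add: algebra_simps)
    then have "lg (qpow 1 z) = z + of_int n" by (subst (asm) mult_cancel_left) auto
    then show ?thesis unfolding g0_def using periodic_int [of k z n, OF kper that] by simp
  qed
  have "g0 holomorphic_on ball 0 1 - {0}"
  proof (subst holomorphic_on_open)
    show "open (ball 0 1 - {0::complex})" by auto
    show "\<forall>q\<in>ball 0 1 - {0}. \<exists>f'. (g0 has_field_derivative f') (at q)"
    proof
      fix q0 :: complex assume q0: "q0 \<in> ball 0 1 - {0}"
      \<comment> \<open>A branch holomorphic near \<open>q0\<close> even on the cut: the argument of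
        \<open>Ln\<close> equals 1 at \<open>q0\<close>.\<close>
      define l where "l = (\<lambda>q. (Ln (q / q0) + Ln q0) / \<tau>)"
      have lq: "qpow 1 (l q) = q" if "q \<noteq> 0" for q
        using that q0 by (simp add: l_def qpow_def exp_add)
      have "eventually (\<lambda>q. q \<in> ball 0 1 - {0}) (nhds q0)"
        using q0 by (intro eventually_nhds_in_open) auto
      then have ev: "eventually (\<lambda>q. g0 q = k (l q)) (nhds q0)"
      proof eventually_elim
        case (elim q) then show ?case using g0k [of "l q"] lq [of q] by (simp add: Hpq)
      qed
      have "q0 / q0 = 1" using q0 by simp
      then have "(l has_field_derivative 1 / q0 / \<tau>) (at q0)"
        unfolding l_def using q0 by (auto intro!: derivative_eq_intros)
      moreover have "(k has_field_derivative deriv k (l q0)) (at (l q0))"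
        using lq [of q0] q0 by (intro holomorphic_derivI [OF khol open_Hp]) (auto simp: Hpq)
      ultimately have "((\<lambda>q. k (l q)) has_field_derivative deriv k (l q0) * (1 / q0 / \<tau>)) (at q0)"
        by (rule DERIV_chain2 [rotated])
      then show "\<exists>f'. (g0 has_field_derivative f') (at q0)"
        using DERIV_cong_ev [OF refl ev refl] by blast
    qed
  qed
  moreover have "((\<lambda>q. (q - 0) * g0 q) \<longlongrightarrow> 0) (at 0)"
  proof -
    obtain N c where Nc: "\<And>x y. c < y \<Longrightarrow> norm (h (Complex x y)) \<le> y ^ N"
      using mg unfolding moderate_growth_def by blast
    have "filterlim (\<lambda>x::real. - ln x / (2 * pi)) at_top (at_right 0)"
      by real_asymp
    moreover have "filterlim (norm :: complex \<Rightarrow> real) (at_right 0) (at 0)"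
      unfolding filterlim_at by (auto simp: eventually_at_filter intro!: tendsto_norm_zero)
    ultimately have lim1: "filterlim (\<lambda>q::complex. - ln (norm q) / (2 * pi)) at_top (at 0)"
      by (rule filterlim_compose)
    have "((\<lambda>y. y ^ N * exp (- (2 * pi * (1 - s) * y))) \<longlongrightarrow> 0) at_top"
    proof -
      have "1 - s > 0" using s1 by simp
      then show ?thesis by real_asymp
    qed
    from filterlim_compose [OF this lim1]
    have lim2: "((\<lambda>q::complex. (- ln (norm q) / (2 * pi)) ^ N * exp (- (2 * pi * (1 - s) * (- ln (norm q) / (2 * pi))))) \<longlongrightarrow> 0) (at 0)" .
    have "eventually (\<lambda>q::complex. q \<in> ball 0 1 - {0}) (at 0)"
      by (rule eventually_at_in_open) auto
    moreover have "eventually (\<lambda>q::complex. c < - ln (norm q) / (2 * pi)) (at 0)"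
      using lim1 by (simp add: filterlim_at_top_dense)
    ultimately have "eventually (\<lambda>q. norm ((q - 0) * g0 q) \<le> (- ln (norm q) / (2 * pi)) ^ N * exp (- (2 * pi * (1 - s) * (- ln (norm q) / (2 * pi))))) (at 0)"
    proof eventually_elim
      case (elim q)
      define y where "y = Im (lg q)"
      have nq: "norm q = exp (- (2 * pi * y))" using lgq [of q] norm_qpow_1 [of "lg q"] elim by (simp add: y_def)
      then have yq: "y = - ln (norm q) / (2 * pi)" by simp
      have "norm (h (lg q)) \<le> y ^ N"
        using Nc [of y "Re (lg q)"] elim yq by (simp add: y_def)
      moreover have "norm (q * g0 q) = exp (- (2 * pi * (1 - s) * y)) * norm (h (lg q))"
        using norm_qpow [of "-s" "lg q"]
        by (simp add: norm_mult nq g0_def k_def y_def exp_add [symmetric] algebra_simps)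
      ultimately show ?case unfolding yq [symmetric] by (simp add: mult.commute mult_left_mono)
    qed
    then show ?thesis using lim2 by (rule Lim_null_comparison)
  qed
  ultimately obtain g where g: "g holomorphic_on ball 0 1" "\<And>q. q \<in> ball 0 1 - {0} \<Longrightarrow> g q = g0 q"
    using holomorphic_on_extend_lim [of g0 "ball 0 1" 0] by auto
  have "h z = qpow (of_real s) z * g (qpow 1 z)" if "z \<in> Hp" for z
  proof -
    have "g (qpow 1 z) = k z" using g(2) g0k that qpow_1_in_ball by auto
    then show ?thesis by (simp add: k_def qpow_add [symmetric] mult.left_commute)
  qed
  with g(1) have "qexp s g h" by (simp add: qexp_def)
  then show ?thesis by (rule that)
qed

section \<open>The eta function and a maximum principle\<close>

definition eprod :: "complex \<Rightarrow> complex" where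
  "eprod q = prodinf (\<lambda>n. 1 - q ^ Suc n)"

lemma eprod_factor_nonzero:
  fixes q :: complex assumes "norm q < 1" shows "1 - q ^ Suc n \<noteq> 0"
proof
  assume "1 - q ^ Suc n = 0"
  then have "norm (q ^ Suc n) = 1" by simp
  moreover have "norm q ^ Suc n \<le> norm q ^ 1" using assms by (intro power_decreasing) auto
  ultimately show False using assms by (simp add: norm_power norm_mult)
qed

lemma eprod_convergent:
  fixes q :: complex assumes "norm q < 1" shows "convergent_prod (\<lambda>n. 1 - q ^ Suc n)"
proof -
  have "summable (\<lambda>n. norm q * norm q ^ n)"
    using assms by (intro summable_mult summable_geometric) auto
  then have "summable (\<lambda>n. norm ((1 - q ^ Suc n) - 1))" by (simp add: norm_mult norm_power)
  then show ?thesis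
    by (intro abs_convergent_prod_imp_convergent_prod) (simp only: abs_convergent_prod_conv_summable)
qed

lemma eprod_nonzero: "q \<in> ball 0 1 \<Longrightarrow> eprod q \<noteq> 0"
  unfolding eprod_def using eprod_convergent eprod_factor_nonzero by (intro prodinf_nonzero) auto

lemma eprod_holomorphic: "eprod holomorphic_on ball 0 1"
proof (rule holomorphic_uniform_sequence [of _ "\<lambda>N q. \<Prod>n<N. 1 - q ^ Suc n"])
  fix x :: complex assume x: "x \<in> ball 0 1"
  define d where "d = (1 - norm x) / 2"
  have d: "d > 0" "norm x + d < 1" using x by (auto simp: d_def field_simps)
  have nb: "norm q \<le> norm x + d" if "q \<in> cball x d" for q
    using that norm_triangle_ineq2 [of q x] by (auto simp: dist_norm norm_minus_commute)
  have sub: "cball x d \<subseteq> ball 0 1" using nb d by fastforce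
  have "uniformly_convergent_on (cball x d) (\<lambda>N q. \<Sum>n<N. norm ((1 - q ^ Suc n) - 1))"
  proof (rule Weierstrass_m_test')
    show "summable (\<lambda>n. (norm x + d) ^ Suc n)"
      using d by (subst summable_Suc_iff) (auto intro!: summable_geometric)
    fix n q assume q: "q \<in> cball x d"
    then show "norm (norm ((1 - q ^ Suc n) - 1)) \<le> (norm x + d) ^ Suc n"
      using power_mono [OF nb [OF q], of "Suc n"] by (simp add: norm_mult norm_power)
  qed
  then have "uniformly_convergent_on (cball x d) (\<lambda>N q. \<Prod>n<N. 1 - q ^ Suc n)"
    by (intro uniformly_convergent_on_prod') (auto intro!: continuous_intros)
  then have "uniform_limit (cball x d) (\<lambda>N q. \<Prod>n<N. 1 - q ^ Suc n) (\<lambda>q. lim (\<lambda>N. \<Prod>n<N. 1 - q ^ Suc n)) sequentially"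
    by (simp add: uniformly_convergent_uniform_limit_iff)
  moreover have "lim (\<lambda>N. \<Prod>n<N. 1 - q ^ Suc n) = eprod q" if "q \<in> cball x d" for q
  proof -
    have "norm q < 1" using that sub by auto
    then show ?thesis unfolding eprod_def
      by (intro prodinf_eq_lim' [symmetric] eprod_convergent eprod_factor_nonzero)
  qed
  ultimately have "uniform_limit (cball x d) (\<lambda>N q. \<Prod>n<N. 1 - q ^ Suc n) eprod sequentially"
    by (metis (no_types, lifting) uniform_limit_cong')
  then show "\<exists>d>0. cball x d \<subseteq> ball 0 1 \<and>
      uniform_limit (cball x d) (\<lambda>N q. \<Prod>n<N. 1 - q ^ Suc n) eprod sequentially"
    using d sub by blast
qed (auto intro!: holomorphic_intros)

text \<open>\<open>SOME\<close> fixes this logarithm only up to a multiple of 2 pi i, hence powers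
  of \<eta> only up to a constant of modulus 1. What matters later is their norm, their logarithmic
  derivative and proportionality to them.\<close>

definition leprod :: "complex \<Rightarrow> complex" where
  "leprod = (SOME g. g holomorphic_on ball 0 1 \<and> (\<forall>q\<in>ball 0 1. eprod q = exp (g q)))"

lemma leprod: "leprod holomorphic_on ball 0 1" "\<And>q. q \<in> ball 0 1 \<Longrightarrow> eprod q = exp (leprod q)"
proof -
  have "\<exists>g. g holomorphic_on ball 0 1 \<and> (\<forall>q\<in>ball 0 1. eprod q = exp (g q))"
    using contractible_imp_holomorphic_log [OF eprod_holomorphic] eprod_nonzero
    by (metis convex_ball convex_imp_contractible)
  from someI_ex [OF this] show "leprod holomorphic_on ball 0 1" "\<And>q. q \<in> ball 0 1 \<Longrightarrow> eprod q = exp (leprod q)"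
    unfolding leprod_def by auto
qed

definition logeta :: "complex \<Rightarrow> complex" where
  "logeta z = \<tau> * z / 24 + leprod (qpow 1 z)"

lemma eta_eq_exp_logeta: "z \<in> Hp \<Longrightarrow> eta z = exp (logeta z)"
  using leprod(2) [OF qpow_1_in_ball, of z]
  by (simp add: eta_def logeta_def exp_add eprod_def qpow_def)

text \<open>The series of \<open>P\<close> in \<open>q\<close>. Classically \<open>P\<close> is
  -E_2/12, which explains the constant term -1/12.\<close>

definition pq :: "complex \<Rightarrow> complex" where
  "pq q = - 1/12 - 2 * q * deriv leprod q"

lemma logeta_deriv:
  assumes "z \<in> Hp"
  shows "(logeta has_field_derivative - \<i> * of_real pi * pq (qpow 1 z)) (at z)"
proof -
  have "(leprod has_field_derivative deriv leprod (qpow 1 z)) (at (qpow 1 z))"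
    using leprod(1) qpow_1_in_ball [OF assms] by (intro holomorphic_derivI [of _ "ball 0 1"]) auto
  from DERIV_chain2 [OF this has_derivative_qpow]
  show ?thesis unfolding logeta_def
    by (auto intro!: derivative_eq_intros simp: pq_def algebra_simps)
qed

lemma Pfun_eq: assumes "z \<in> Hp" shows "Pfun z = pq (qpow 1 z)"
proof -
  have "eventually (\<lambda>w. w \<in> Hp) (nhds z)"
    using assms open_Hp by (intro eventually_nhds_in_open)
  then have ev: "eventually (\<lambda>w. eta w = exp (logeta w)) (nhds z)"
    by eventually_elim (rule eta_eq_exp_logeta)
  have "((\<lambda>w. exp (logeta w)) has_field_derivative exp (logeta z) * (- \<i> * of_real pi * pq (qpow 1 z))) (at z)"
    by (rule DERIV_chain2 [OF DERIV_exp logeta_deriv [OF assms]])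
  then have "deriv (\<lambda>w. exp (logeta w)) z = exp (logeta z) * (- \<i> * of_real pi * pq (qpow 1 z))"
    by (rule DERIV_imp_deriv)
  then show ?thesis
    unfolding Pfun_def deriv_cong_ev [OF ev refl] eta_eq_exp_logeta [OF assms]
    by (simp add: field_simps)
qed

lemma qexp_Pfun: "qexp 0 pq Pfun"
  unfolding qexp_def pq_def
  using Pfun_eq by (auto simp: pq_def intro!: holomorphic_intros leprod)

lemma pq_0: "pq 0 = - 1/12"
  by (simp add: pq_def)

lemma Pfun_holomorphic: "Pfun holomorphic_on Hp"
  by (rule qexp_holomorphic [OF qexp_Pfun])

lemma has_field_derivative_transform_Hp:
  assumes "(f has_field_derivative D) (at z)" "z \<in> Hp" "\<And>w. w \<in> Hp \<Longrightarrow> f w = g w"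
  shows "(g has_field_derivative D) (at z)"
  using has_field_derivative_transform_within_open [OF assms(1) open_Hp assms(2)] assms(3) by blast

lemma deriv_cong_Hp:
  assumes "\<And>w. w \<in> Hp \<Longrightarrow> f w = g w" "z \<in> Hp" shows "deriv f z = deriv g z"
proof -
  have "eventually (\<lambda>w. w \<in> Hp) (nhds z)"
    using assms open_Hp by (intro eventually_nhds_in_open)
  then show ?thesis by (intro deriv_cong_ev) (auto elim!: eventually_mono simp: assms)
qed

lemma Dop_eqI:
  assumes "(f has_field_derivative D) (at z)" "z \<in> Hp"
  shows "Dop k f z = D / \<tau> + of_real k * Pfun z * f z"
  using assms by (simp add: Dop_def DERIV_imp_deriv)

text \<open>In the variable \<open>q\<close> the derivation d/(2 pi i dz) is q d/dq, so
  \<open>D\<close> keeps the exponent. At \<open>q = 0\<close> only the factor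
  \<open>s + k * pq 0\<close>, that is \<open>s - k/12\<close>, survives.\<close>

lemma qexp_Dop:
  assumes "qexp s g h"
  shows "qexp s (\<lambda>q. of_real s * g q + q * deriv g q + of_real k * pq q * g q) (Dop k h)"
proof -
  have g: "g holomorphic_on ball 0 1" using assms by (simp add: qexp_def)
  have "Dop k h z = qpow (of_real s) z *
     (of_real s * g (qpow 1 z) + qpow 1 z * deriv g (qpow 1 z) + of_real k * pq (qpow 1 z) * g (qpow 1 z))"
    if z: "z \<in> Hp" for z
  proof -
    have "(g has_field_derivative deriv g (qpow 1 z)) (at (qpow 1 z))"
      using g qpow_1_in_ball [OF z] by (intro holomorphic_derivI [of _ "ball 0 1"]) auto
    from DERIV_mult [OF has_derivative_qpow [of "of_real s"] DERIV_chain2 [OF this has_derivative_qpow]]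
    have "((\<lambda>z. qpow (of_real s) z * g (qpow 1 z)) has_field_derivative
        \<tau> * qpow (of_real s) z * (of_real s * g (qpow 1 z) + qpow 1 z * deriv g (qpow 1 z))) (at z)"
      by (simp add: algebra_simps)
    from has_field_derivative_transform_Hp [OF this z, of h]
    have "(h has_field_derivative \<tau> * (qpow (of_real s) z * (of_real s * g (qpow 1 z) + qpow 1 z * deriv g (qpow 1 z)))) (at z)"
      using qexpD [OF assms] by (simp add: mult.assoc)
    from Dop_eqI [OF this z, of k]
    have "Dop k h z = qpow (of_real s) z * (of_real s * g (qpow 1 z) + qpow 1 z * deriv g (qpow 1 z))
        + of_real k * Pfun z * h z" by simp
    then show ?thesis
      unfolding Pfun_eq [OF z] qexpD [OF assms z] by (simp only: distrib_left mult_ac)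
  qed
  moreover have "pq holomorphic_on ball 0 1" using qexp_Pfun by (simp add: qexp_def)
  ultimately show ?thesis
    unfolding qexp_def using g by (auto intro!: holomorphic_intros)
qed

text \<open>The power \<open>\<eta>\<^sup>2\<^sup>K\<close>, on the branch given by the q-expansion.\<close>

definition etapow :: "real \<Rightarrow> complex \<Rightarrow> complex" where
  "etapow K z = exp (2 * of_real K * logeta z)"

lemma etapow_nonzero [simp]: "etapow K z \<noteq> 0"
  by (simp add: etapow_def)

lemma norm_etapow: "z \<in> Hp \<Longrightarrow> norm (etapow K z) = norm (eta z) powr (2 * K)"
  by (simp add: etapow_def eta_eq_exp_logeta powr_def)

lemma etapow_eq: "etapow K z = qpow (of_real (K / 12)) z * exp (2 * of_real K * leprod (qpow 1 z))"
  by (simp add: etapow_def logeta_def qpow_def exp_add [symmetric] algebra_simps)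

lemma qexp_etapow: "qexp (K / 12) (\<lambda>q. exp (2 * of_real K * leprod q)) (etapow K)"
  unfolding qexp_def using etapow_eq by (auto intro!: holomorphic_intros leprod)

lemma etapow_deriv:
  assumes "z \<in> Hp"
  shows "(etapow K has_field_derivative - 2 * of_real pi * \<i> * of_real K * Pfun z * etapow K z) (at z)"
  unfolding etapow_def
  by (rule derivative_eq_intros logeta_deriv assms refl)+ (simp add: Pfun_eq assms)

text \<open>\<open>etapow K\<close> solves the same first order linear equation and never vanishes,
  so the quotient is constant on the connected set \<open>Hp\<close>.\<close>

lemma Dop_eq_0_imp_etapow:
  assumes hol: "w holomorphic_on Hp" and D: "\<And>z. z \<in> Hp \<Longrightarrow> Dop K w z = 0"
  obtains C where "\<And>z. z \<in> Hp \<Longrightarrow> w z = C * etapow K z"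
proof -
  have "(\<lambda>z. w z / etapow K z) constant_on Hp"
  proof (rule has_field_derivative_0_imp_constant_on)
    fix z assume z: "z \<in> Hp"
    have "deriv w z = - 2 * of_real pi * \<i> * of_real K * Pfun z * w z"
      using D [OF z] z by (simp add: Dop_def field_simps add_eq_0_iff)
    with holomorphic_derivI [OF hol open_Hp z]
    have "(w has_field_derivative - 2 * of_real pi * \<i> * of_real K * Pfun z * w z) (at z)" by simp
    from DERIV_divide [OF this etapow_deriv [OF z, of K]]
    show "((\<lambda>z. w z / etapow K z) has_field_derivative 0) (at z)" by (simp add: algebra_simps)
  qed (rule connected_Hp open_Hp)+
  then obtain C where "\<And>z. z \<in> Hp \<Longrightarrow> w z / etapow K z = C" unfolding constant_on_def by blast
  then have "\<And>z. z \<in> Hp \<Longrightarrow> w z = C * etapow K z" by (simp add: field_simps)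
  then show ?thesis by (rule that)
qed

text \<open>Moves a maximum of \<open>|v|\<close> off the boundary line Im z = 1/2. After a
  translation \<open>|Re z1| <= 1/2\<close>, so \<open>|z1|^2 <= 1/2\<close> and
  \<open>Im (- 1 / z1) = Im z1 / |z1|^2 >= 1\<close>.\<close>

lemma interior_representative:
  assumes per: "\<And>z. z \<in> Hp \<Longrightarrow> norm (v (z + 1)) = norm (v z :: complex)"
    and inv: "\<And>z. z \<in> Hp \<Longrightarrow> norm (v (- 1 / z)) = norm (v z)" and z: "Im z \<ge> 1/2"
  obtains z' where "Im z' > 1/2" "norm (v z') = norm (v z)"
proof (cases "Im z > 1/2")
  case True then show ?thesis using that by blast
next
  case False
  then have Im: "Im z = 1/2" using z by simp
  define z1 where "z1 = z + of_int (- round (Re z))"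
  have zH: "z \<in> Hp" "z1 \<in> Hp" using Im by (simp_all add: Hp_def z1_def)
  have n1: "norm (v z1) = norm (v z)"
    using periodic_int [of "\<lambda>z. of_real (norm (v z))" z "- round (Re z)"] per zH by (simp add: z1_def)
  have "\<bar>Re z1\<bar> \<le> 1/2"
    using of_int_round_abs_le [of "Re z"] by (simp add: z1_def abs_minus_commute)
  then have "(Re z1)\<^sup>2 \<le> (1/2)\<^sup>2" by (metis abs_ge_zero power2_abs power_mono)
  then have nz: "(Re z1)\<^sup>2 + (1/2)\<^sup>2 \<le> 1/2" by (simp add: power2_eq_square)
  have Im1: "Im z1 = 1/2" by (simp add: z1_def Im)
  have pos: "(Re z1)\<^sup>2 + (1/2)\<^sup>2 > 0" by (simp add: add_nonneg_pos)
  have "Im (- 1 / z1) = (1/2) / ((Re z1)\<^sup>2 + (1/2)\<^sup>2)"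
    by (simp add: Im_divide Im1 )
  also have "\<dots> \<ge> 1" using nz pos by (subst le_divide_eq_1_pos) auto
  finally have "Im (- 1 / z1) > 1/2" by simp
  then show ?thesis using that inv [OF zH(2)] n1 by metis
qed

text \<open>The maximum principle for \<open>w / \<eta>\<^sup>2\<^sup>K\<close>: its modulus is invariant under \<open>z \<mapsto> z + 1\<close> and
  \<open>z \<mapsto> -1/z\<close>, so its maximum over \<open>Im z \<ge> 1/2\<close> is attained in the interior or at the cusp.\<close>

context
  fixes w g :: "complex \<Rightarrow> complex" and s K :: real
  assumes etaS: "\<And>z. z \<in> Hp \<Longrightarrow> norm (eta (- 1 / z)) = norm z powr (1/2) * norm (eta z)"
    and qw: "qexp s g w"
    and wS: "\<And>z. z \<in> Hp \<Longrightarrow> norm (w (- 1 / z)) = norm z powr K * norm (w z)"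
begin

private definition "v = (\<lambda>z. w z / etapow K z)"
text \<open>The series of \<open>v\<close>, which carries the exponent
  \<open>s - K / 12\<close>.\<close>

private definition "G = (\<lambda>q. g q / exp (2 * of_real K * leprod q))"

private lemma v_eq: "z \<in> Hp \<Longrightarrow> v z = qpow (of_real (s - K / 12)) z * G (qpow 1 z)"
  using qpow_add [of "of_real (s - K/12)" "of_real (K/12)" z]
  by (simp add: v_def G_def etapow_eq qexpD [OF qw] field_simps)

private lemma G_hol: "G holomorphic_on ball 0 1"
  using qw unfolding G_def qexp_def by (auto intro!: holomorphic_intros leprod)

private lemma qv: "qexp (s - K / 12) G v"
  unfolding qexp_def using v_eq G_hol by blast

private lemma v_per: "z \<in> Hp \<Longrightarrow> norm (v (z + 1)) = norm (v z)"
  by (simp add: qexp_shift [OF qv] norm_mult)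

private lemma v_inv: assumes z: "z \<in> Hp" shows "norm (v (- 1 / z)) = norm (v z)"
proof -
  have "- 1 / z \<in> Hp" using z by (auto simp: Hp_def Im_divide zero_less_divide_iff add_nonneg_pos)
  moreover have "z \<noteq> 0" using z by (auto simp: Hp_def)
  ultimately show ?thesis
    unfolding v_def norm_divide wS [OF z] norm_etapow [OF z] norm_etapow [OF \<open>- 1 / z \<in> Hp\<close>] etaS [OF z]
    by (simp add: powr_mult powr_powr)
qed

text \<open>\<Phi> is \<open>|v|\<close> as a function of \<open>q\<close>, extended to the cusp.
  The region Im z >= 1/2 together with the cusp is the compact disc of radius exp(-pi), so a maximum
  exists. At \<open>q = 0\<close> it gives the first alternative; elsewhere it can be moved to an
  interior point and makes \<open>v\<close> constant.\<close>

private lemma attained: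
  assumes cont: "continuous_on (ball 0 1) \<Phi>" and \<Phi>: "\<And>z. z \<in> Hp \<Longrightarrow> \<Phi> (qpow 1 z) = norm (v z)"
  shows "(\<forall>z\<in>Hp. Im z \<ge> 1/2 \<longrightarrow> norm (v z) \<le> \<Phi> 0) \<or> (\<exists>c. \<forall>z\<in>Hp. v z = c)"
proof -
  define \<rho> where "\<rho> = exp (- pi)"
  have \<rho>: "0 < \<rho>" "\<rho> < 1" by (simp_all add: \<rho>_def)
  have "continuous_on (cball 0 \<rho>) \<Phi>" using cont by (rule continuous_on_subset) (use \<rho> in auto)
  from continuous_attains_sup [OF compact_cball _ this] \<rho>
  obtain q where q: "q \<in> cball 0 \<rho>" "\<And>p. p \<in> cball 0 \<rho> \<Longrightarrow> \<Phi> p \<le> \<Phi> q" by fastforce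
  have inn: "qpow 1 z \<in> cball 0 \<rho> \<longleftrightarrow> Im z \<ge> 1/2" for z
    by (simp add: norm_qpow_1 \<rho>_def mult.commute)
  show ?thesis
  proof (cases "q = 0")
    case True then show ?thesis using q(2) \<Phi> inn by metis
  next
    case False
    have "q \<in> ball 0 1" using q(1) \<rho> by auto
    then obtain z where z: "z \<in> Hp" "qpow 1 z = q" using False by (rule qpow_1_surj)
    have le: "norm (v y) \<le> norm (v z)" if "Im y \<ge> 1/2" for y
      using q(2) [of "qpow 1 y"] \<Phi> [OF z(1)] \<Phi> [of y] inn [of y] that z by (simp add: Hp_def)
    have "Im z \<ge> 1/2" using inn [of z] q z by simp
    then obtain z' where z': "Im z' > 1/2" "norm (v z') = norm (v z)"
      using interior_representative [of v z] v_per v_inv by metis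
    have "v constant_on Hp"
    proof (rule maximum_modulus_principle [OF qexp_holomorphic [OF qv] open_Hp connected_Hp, of "{y. 1/2 < Im y}" z'])
      show "open {y. 1/2 < Im y}" by (rule open_halfspace_Im_gt)
      show "{y. 1/2 < Im y} \<subseteq> Hp" by (auto simp: Hp_def)
      show "z' \<in> {y. 1/2 < Im y}" using z' by simp
      show "norm (v y) \<le> norm (v z')" if "y \<in> {y. 1/2 < Im y}" for y
        using le [of y] that z' by simp
    qed
    then show ?thesis unfolding constant_on_def by blast
  qed
qed

private lemma small_imp_zero:
  assumes "\<And>z. z \<in> Hp \<Longrightarrow> Im z \<ge> 1/2 \<Longrightarrow> v z = 0" "z \<in> Hp" shows "v z = 0"
proof (rule analytic_continuation_open [of "{y. 1/2 < Im y}" Hp v "\<lambda>_. 0"])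
  show "open {y. 1/2 < Im y}" by (rule open_halfspace_Im_gt)
  have "\<i> \<in> {y. 1/2 < Im y}" by simp
  then show "{y. 1/2 < Im y} \<noteq> {}" by blast
qed (use assms open_Hp connected_Hp qexp_holomorphic [OF qv] in \<open>auto simp: Hp_def\<close>)

text \<open>The factor \<open>|q|^t\<close> with \<open>t > 0\<close> makes \<Phi> vanish at the
  cusp. Either the maximum is this value 0, or \<open>v\<close> is constant and equal to its limit
  0.\<close>

lemma order_gt_imp_zero:
  assumes sK: "s > K / 12" and z: "z \<in> Hp" shows "w z = 0"
proof -
  define t where "t = s - K / 12"
  have t: "t > 0" using sK by (simp add: t_def)
  define \<Phi> where "\<Phi> = (\<lambda>q. norm q powr t * norm (G q))"
  have contG: "continuous_on (ball 0 1) G" by (rule holomorphic_on_imp_continuous_on [OF G_hol])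
  have cont: "continuous_on (ball 0 1) \<Phi>"
    unfolding \<Phi>_def using t by (intro continuous_intros contG continuous_on_powr') auto
  have \<Phi>: "\<Phi> (qpow 1 y) = norm (v y)" if "y \<in> Hp" for y
    unfolding v_eq [OF that] \<Phi>_def t_def [symmetric] norm_mult norm_qpow norm_qpow_1
    by (simp add: exp_powr_real algebra_simps)
  have \<Phi>0: "\<Phi> 0 = 0" using t by (simp add: \<Phi>_def)
  from attained [OF cont \<Phi>] have "v z = 0"
  proof
    assume "\<forall>z\<in>Hp. Im z \<ge> 1/2 \<longrightarrow> norm (v z) \<le> \<Phi> 0"
    then show ?thesis using small_imp_zero [OF _ z] \<Phi>0 by simp
  next
    assume "\<exists>c. \<forall>z\<in>Hp. v z = c"
    then obtain c where c: "\<And>y. y \<in> Hp \<Longrightarrow> v y = c" by blast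
    have "isCont \<Phi> 0" using cont by (rule continuous_on_interior) simp
    then have l1: "(\<Phi> \<longlongrightarrow> 0) (at 0)" using \<Phi>0 by (simp add: isCont_def)
    have "eventually (\<lambda>q. q \<in> ball 0 1 - {0}) (at (0::complex))"
      by (rule eventually_at_in_open) auto
    then have "eventually (\<lambda>q. \<Phi> q = norm c) (at 0)"
    proof eventually_elim
      case (elim q)
      then have "q \<in> ball 0 1" "q \<noteq> 0" by auto
      then obtain y where "y \<in> Hp" "qpow 1 y = q" by (rule qpow_1_surj)
      then show ?case using \<Phi> [of y] c [of y] by simp
    qed
    then have "((\<lambda>_::complex. norm c) \<longlongrightarrow> 0) (at 0)" using l1 by (rule Lim_transform_eventually [rotated])
    then have "norm c = 0" by (simp add: tendsto_const_iff)
    then show ?thesis using c z by simp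
  qed
  then show ?thesis by (simp add: v_def)
qed

text \<open>Now \<open>v\<close> is itself a series \<open>G\<close> in \<open>q\<close>. If the
  maximum sits at the cusp, the maximum modulus principle is applied to \<open>G\<close> in the
  disc, where the cusp is an interior point.\<close>

lemma order_eq_imp_etapow:
  assumes sK: "s = K / 12"
  obtains C where "\<And>z. z \<in> Hp \<Longrightarrow> w z = C * etapow K z"
proof -
  have vG: "v y = G (qpow 1 y)" if "y \<in> Hp" for y using v_eq [OF that] sK by simp
  have contG: "continuous_on (ball 0 1) G" by (rule holomorphic_on_imp_continuous_on [OF G_hol])
  have cont: "continuous_on (ball 0 1) (\<lambda>q. norm (G q))" by (intro continuous_intros contG)
  have "\<exists>c. \<forall>z\<in>Hp. v z = c"
  proof -
    have *: "norm (G (qpow 1 y)) = norm (v y)" if "y \<in> Hp" for y using vG [OF that] by simp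
    from attained [OF cont *] show ?thesis
    proof
    assume le: "\<forall>z\<in>Hp. 1 / 2 \<le> Im z \<longrightarrow> norm (v z) \<le> norm (G 0)"
    have "G constant_on ball 0 1"
    proof (rule maximum_modulus_principle [OF G_hol open_ball connected_ball, of "ball 0 (exp (- pi))" 0])
      show "norm (G q) \<le> norm (G 0)" if q: "q \<in> ball 0 (exp (- pi))" for q
      proof (cases "q = 0")
        case False
        have "norm q < exp (- pi)" "exp (- pi) < 1" using q by auto
        then have "norm q < 1" by linarith
        then have "q \<in> ball 0 1" by simp
        then obtain y where y: "y \<in> Hp" "qpow 1 y = q" using False by (rule qpow_1_surj)
        then show ?thesis using le vG [of y] q by (auto simp: norm_qpow_1)
      qed simp
      show "ball 0 (exp (- pi)) \<subseteq> ball 0 (1::real)" by (intro subset_ball) auto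
    qed auto
    then show ?thesis using vG qpow_1_in_ball unfolding constant_on_def by metis
    qed
  qed
  then obtain c where "\<And>y. y \<in> Hp \<Longrightarrow> v y = c" by blast
  then have "\<And>z. z \<in> Hp \<Longrightarrow> w z = c * etapow K z" by (simp add: v_def field_simps)
  then show ?thesis by (rule that)
qed

end

section \<open>Determinants of four vectors\<close>

lemma vector_4 [simp]:
  "(vector [x, y, z, w] :: ('a::zero)^4) $ 1 = x"
  "(vector [x, y, z, w] :: ('a::zero)^4) $ 2 = y"
  "(vector [x, y, z, w] :: ('a::zero)^4) $ 3 = z"
  "(vector [x, y, z, w] :: ('a::zero)^4) $ 4 = w"
  unfolding vector_def by auto

definition minor3 :: "4 \<Rightarrow> 4 \<Rightarrow> 4 \<Rightarrow> complex^4 \<Rightarrow> complex^4 \<Rightarrow> complex^4 \<Rightarrow> complex" where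
  "minor3 i j k b c d = b $ i * (c $ j * d $ k - c $ k * d $ j)
     - b $ j * (c $ i * d $ k - c $ k * d $ i) + b $ k * (c $ i * d $ j - c $ j * d $ i)"

text \<open>The explicit expansion turns each multilinear identity into a polynomial identity in at
  most a few dozen entries, within reach of \<open>algebra\<close>; derivatives and holomorphy
  follow entry by entry.\<close>

definition det4 :: "complex^4 \<Rightarrow> complex^4 \<Rightarrow> complex^4 \<Rightarrow> complex^4 \<Rightarrow> complex" where
  "det4 a b c d = a $ 1 * minor3 2 3 4 b c d - a $ 2 * minor3 1 3 4 b c d
     + a $ 3 * minor3 1 2 4 b c d - a $ 4 * minor3 1 2 3 b c d"

lemmas det4_eq = det4_def [unfolded minor3_def]

lemma det4_repeat:
  "det4 a a c d = 0" "det4 a b a d = 0" "det4 a b c a = 0"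
  "det4 a b b d = 0" "det4 a b c b = 0" "det4 a b c c = 0" "det4 0 b c d = 0"
  unfolding det4_eq zero_index by algebra+

lemma det4_linear:
  "det4 (x *s p + y *s q + z *s r + w *s s) b c d = x * det4 p b c d + y * det4 q b c d + z * det4 r b c d + w * det4 s b c d"
  "det4 a (x *s p + y *s q + z *s r + w *s s) c d = x * det4 a p c d + y * det4 a q c d + z * det4 a r c d + w * det4 a s c d"
  "det4 a b (x *s p + y *s q + z *s r + w *s s) d = x * det4 a b p d + y * det4 a b q d + z * det4 a b r d + w * det4 a b s d"
  "det4 a b c (x *s p + y *s q + z *s r + w *s s) = x * det4 a b c p + y * det4 a b c q + z * det4 a b c r + w * det4 a b c s"
  unfolding det4_eq vector_smult_component vector_add_component by algebra+

lemma det4_permute: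
  "det4 a b d c = - det4 a b c d"
  "det4 a c b d = - det4 a b c d"
  "det4 a c d b = det4 a b c d"
  "det4 a d b c = det4 a b c d"
  "det4 a d c b = - det4 a b c d"
  "det4 b a c d = - det4 a b c d"
  "det4 b a d c = det4 a b c d"
  "det4 b c a d = det4 a b c d"
  "det4 b c d a = - det4 a b c d"
  "det4 b d a c = - det4 a b c d"
  "det4 b d c a = det4 a b c d"
  "det4 c a b d = det4 a b c d"
  "det4 c a d b = - det4 a b c d"
  "det4 c b a d = - det4 a b c d"
  "det4 c b d a = det4 a b c d"
  "det4 c d a b = det4 a b c d"
  "det4 c d b a = - det4 a b c d"
  "det4 d a b c = - det4 a b c d"
  "det4 d a c b = det4 a b c d"
  "det4 d b a c = det4 a b c d"
  "det4 d b c a = - det4 a b c d"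
  "det4 d c a b = - det4 a b c d"
  "det4 d c b a = det4 a b c d"
  unfolding det4_eq by algebra+

text \<open>Each \<open>A *v v\<close> is a combination of the columns of \<open>A\<close>.
  Multilinear expansion leaves the 24 permutations of the columns, which \<open>det4_permute\<close>
  reduces to one.\<close>

lemma det4_matrix_mult:
  "det4 (A *v a) (A *v b) (A *v c) (A *v d) =
     det4 (column 1 A) (column 2 A) (column 3 A) (column 4 A) * det4 a b c d"
proof -
  have col: "A *v v = v $ 1 *s column 1 A + v $ 2 *s column 2 A + v $ 3 *s column 3 A + v $ 4 *s column 4 A" for v
    by (simp add: matrix_mult_sum sum_4)
  show ?thesis
    unfolding col
    by (simp only: det4_linear det4_repeat mult_zero_right add_0_left add_0_right
        det4_permute [where a = "column 1 A" and b = "column 2 A" and c = "column 3 A" and d = "column 4 A"])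
      (simp add: det4_eq [of a b c d] algebra_simps)
qed

lemma det4_scale: "det4 (x *s a) (y *s b) (z *s c) (w *s d) = x * y * z * w * det4 a b c d"
  unfolding det4_eq vector_smult_component by algebra

text \<open>Cramer's rule without division, so that it also holds at zeros of the
  determinant.\<close>

lemma det4_cramer:
  "det4 a b c d *s v = det4 v b c d *s a + det4 a v c d *s b + det4 a b v d *s c + det4 a b c v *s d"
  unfolding vec_eq_iff forall_4 vector_smult_component vector_add_component det4_eq
  by (intro conjI; algebra)

lemma det4_combination:
  assumes "det4 a b c d \<noteq> 0" "x *s a + y *s b + z *s c + w *s d = 0"
  shows "x = 0 \<and> y = 0 \<and> z = 0 \<and> w = 0"
proof -
  let ?v = "x *s a + y *s b + z *s c + w *s d"
  have "det4 ?v b c d = x * det4 a b c d" "det4 a ?v c d = y * det4 a b c d"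
      "det4 a b ?v d = z * det4 a b c d" "det4 a b c ?v = w * det4 a b c d"
    unfolding det4_eq vector_smult_component vector_add_component by algebra+
  moreover have "det4 0 b c d = 0" "det4 a 0 c d = 0" "det4 a b 0 d = 0" "det4 a b c 0 = 0"
    by (simp_all add: det4_eq)
  ultimately show ?thesis using assms by auto
qed

text \<open>Strips the lower order terms from iterated derivatives.\<close>

lemma det4_triangular:
  "det4 a (x *s b + p *s a) (y *s c + q *s b + r *s a) (w *s d + s *s c + t *s b + u *s a)
     = x * y * w * det4 a b c d"
  unfolding det4_eq vector_smult_component vector_add_component by algebra

text \<open>The shape of the leading coefficients of F, DF, D^2 F, D^3 F: each derivative multiplies
  by the exponent minus a twelfth of the current weight. The shifts \<alpha> and \<beta> are column
  operations on a Vandermonde matrix and cancel.\<close>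

lemma det4_vandermonde:
  "det4 (\<chi> j. c j) (\<chi> j. x j * c j) (\<chi> j. (x j - \<alpha>) * (x j * c j)) (\<chi> j. (x j - \<beta>) * ((x j - \<alpha>) * (x j * c j)))
    = c 1 * c 2 * c 3 * c 4 * (x 2 - x 1) * (x 3 - x 1) * (x 4 - x 1) * (x 3 - x 2) * (x 4 - x 2) * (x 4 - x 3)"
  unfolding det4_eq vec_lambda_beta by algebra

lemma has_field_derivative_det4:
  assumes "\<And>j. ((\<lambda>z. A z $ j) has_field_derivative A' $ j) (at z)"
    "\<And>j. ((\<lambda>z. B z $ j) has_field_derivative B' $ j) (at z)"
    "\<And>j. ((\<lambda>z. C z $ j) has_field_derivative C' $ j) (at z)"
    "\<And>j. ((\<lambda>z. D z $ j) has_field_derivative D' $ j) (at z)"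
  shows "((\<lambda>z. det4 (A z) (B z) (C z) (D z)) has_field_derivative
     det4 A' (B z) (C z) (D z) + det4 (A z) B' (C z) (D z) + det4 (A z) (B z) C' (D z) + det4 (A z) (B z) (C z) D') (at z)"
  unfolding det4_eq
  by (rule derivative_eq_intros assms refl)+ algebra

lemma det4_holomorphic:
  assumes "\<And>j. (\<lambda>z. A z $ j) holomorphic_on S" "\<And>j. (\<lambda>z. B z $ j) holomorphic_on S"
    "\<And>j. (\<lambda>z. C z $ j) holomorphic_on S" "\<And>j. (\<lambda>z. D z $ j) holomorphic_on S"
  shows "(\<lambda>z. det4 (A z) (B z) (C z) (D z)) holomorphic_on S"
  unfolding det4_eq by (intro holomorphic_intros assms)

lemma diagonal_mult:
  "(\<chi> a b. if a = b then x a else 0) *v v = (\<chi> a. x a * v $ a)" for x :: "'n::finite \<Rightarrow> complex"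
  by (simp add: vec_eq_iff matrix_vector_mult_def if_distrib [of "\<lambda>x. x * _"] sum.delta cong: if_cong)

section \<open>The slash action and modular derivatives\<close>

definition Smat :: sl2 where "Smat = (0, -1, 1, 0)"

lemma Smat_in [simp]: "Smat \<in> SL2Z" and Tmat_in [simp]: "Tmat \<in> SL2Z"
  by (simp_all add: Smat_def Tmat_def SL2Z_def)

lemma moeb_S [simp]: "moeb Smat z = - 1 / z" and jfac_S [simp]: "jfac Smat z = z"
  and moeb_T [simp]: "moeb Tmat z = z + 1" and jfac_T [simp]: "jfac Tmat z = 1"
  by (simp_all add: Smat_def Tmat_def)

lemma jfac_nonzero: assumes "\<gamma> \<in> SL2Z" "z \<in> Hp" shows "jfac \<gamma> z \<noteq> 0"
proof -
  obtain a b c d where \<gamma>: "\<gamma> = (a, b, c, d)" by (cases \<gamma>)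
  have det: "a * d - b * c = 1" using assms \<gamma> by (simp add: SL2Z_def)
  show ?thesis
  proof
    assume 0: "jfac \<gamma> z = 0"
    have "Im (jfac \<gamma> z) = of_int c * Im z" by (simp add: \<gamma>)
    with 0 assms(2) have "c = 0" by (simp add: Hp_def)
    with 0 \<gamma> have "d = 0" by simp
    with \<open>c = 0\<close> det show False by simp
  qed
qed

lemma moeb_in_Hp: assumes "\<gamma> \<in> SL2Z" "z \<in> Hp" shows "moeb \<gamma> z \<in> Hp"
proof -
  obtain a b c d where \<gamma>: "\<gamma> = (a, b, c, d)" by (cases \<gamma>)
  have "a * d - b * c = 1" using assms \<gamma> by (simp add: SL2Z_def)
  then have det: "real_of_int a * of_int d - of_int b * of_int c = 1"
    by (metis of_int_1 of_int_diff of_int_mult)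
  define w where "w = jfac \<gamma> z"
  have w0: "w \<noteq> 0" using jfac_nonzero [OF assms] by (simp add: w_def)
  have "moeb \<gamma> z = (of_int a * z + of_int b) * cnj w / of_real ((norm w)\<^sup>2)"
    using complex_div_cnj [of "of_int a * z + of_int b" w] by (simp add: \<gamma> w_def)
  then have "Im (moeb \<gamma> z) = Im ((of_int a * z + of_int b) * cnj w) / (norm w)\<^sup>2"
    by (simp only: Im_divide_of_real)
  also have "Im ((of_int a * z + of_int b) * cnj w) = Im z"
  proof -
    have "Im ((of_int a * z + of_int b) * cnj w) = (of_int a * of_int d - of_int b * of_int c) * Im z"
      by (simp add: w_def \<gamma> algebra_simps)
    then show ?thesis using det by simp
  qed
  finally show ?thesis using assms(2) w0 by (simp add: Hp_def)
qed

lemma moeb_deriv: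
  assumes "(a, b, c, d) \<in> SL2Z" "z \<in> Hp"
  shows "(moeb (a, b, c, d) has_field_derivative 1 / (jfac (a, b, c, d) z)\<^sup>2) (at z)"
proof -
  have j: "of_int c * z + of_int d \<noteq> 0" using jfac_nonzero [OF assms] by simp
  have "a * d - b * c = 1" using assms by (simp add: SL2Z_def)
  then have det: "(of_int a :: complex) * of_int d - of_int b * of_int c = 1"
    by (metis of_int_1 of_int_diff of_int_mult)
  have num: "of_int a * (of_int c * z + of_int d) - (of_int a * z + of_int b) * of_int c = (1::complex)"
    using det by (simp add: algebra_simps)
  have "((\<lambda>z. (of_int a * z + of_int b) / (of_int c * z + of_int d)) has_field_derivative
     (of_int a * (of_int c * z + of_int d) - (of_int a * z + of_int b) * of_int c) /
     ((of_int c * z + of_int d) * (of_int c * z + of_int d))) (at z)"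
    using j by (auto intro!: derivative_eq_intros)
  moreover have "moeb (a, b, c, d) = (\<lambda>z. (of_int a * z + of_int b) / (of_int c * z + of_int d))"
    by (simp add: fun_eq_iff)
  ultimately show ?thesis unfolding num by (simp add: power2_eq_square)
qed

text \<open>For nonzero \<open>c\<close> the number cz + d has nonzero imaginary part and stays off
  the cut of the principal power; for \<open>c = 0\<close> it is constant.\<close>

lemma jfac_powr_deriv:
  assumes "(a, b, c, d) \<in> SL2Z" "z \<in> Hp"
  shows "((\<lambda>z. jfac (a, b, c, d) z powr of_real k) has_field_derivative
     of_real k * of_int c / jfac (a, b, c, d) z * jfac (a, b, c, d) z powr of_real k) (at z)"
proof (cases "c = 0")
  case False
  have j: "jfac (a, b, c, d) z \<noteq> 0" by (rule jfac_nonzero [OF assms])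
  have "Im (of_int c * z + of_int d) \<noteq> 0" using False assms(2) by (simp add: Hp_def)
  then have "of_int c * z + of_int d \<notin> \<real>\<^sub>\<le>\<^sub>0" by (auto simp: complex_nonpos_Reals_iff)
  then have "((\<lambda>z. (of_int c * z + of_int d) powr of_real k) has_field_derivative
     of_real k * (of_int c * z + of_int d) powr (of_real k - 1) * of_int c) (at z)"
    by (auto intro!: derivative_eq_intros)
  moreover have "(of_int c * z + of_int d) powr (of_real k - 1) = (of_int c * z + of_int d) powr of_real k / (of_int c * z + of_int d)"
    using j by (simp add: powr_diff)
  ultimately show ?thesis by (simp add: mult_ac)
qed simp

text \<open>The derivation \<open>Dop\<close> with \<open>P\<close> replaced by any
  \<open>p\<close>. Slashing changes \<open>P\<close> into another function, and the two can be
  identified only after the Wronskian has been computed.\<close>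

definition Dgen :: "(complex \<Rightarrow> complex) \<Rightarrow> real \<Rightarrow> (complex \<Rightarrow> complex) \<Rightarrow> complex \<Rightarrow> complex" where
  "Dgen p k f = (\<lambda>z. if z \<in> Hp then deriv f z / \<tau> + of_real k * p z * f z else 0)"

lemma Dop_eq_Dgen: "Dop = Dgen Pfun"
  by (intro ext) (simp add: Dop_def Dgen_def)

definition DgenV :: "(complex \<Rightarrow> complex) \<Rightarrow> real \<Rightarrow> (complex \<Rightarrow> complex^'n) \<Rightarrow> complex \<Rightarrow> complex^'n" where
  "DgenV p k F = (\<lambda>z. \<chi> j. Dgen p k (\<lambda>w. F w $ j) z)"

lemma DopV_eq_DgenV: "DopV = DgenV Pfun"
  by (intro ext) (simp add: DopV_def DgenV_def Dop_eq_Dgen)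

lemma DgenV_nth [simp]: "(\<lambda>z. DgenV p k F z $ j) = Dgen p k (\<lambda>z. F z $ j)"
  by (simp add: DgenV_def)

lemma Dgen_cong:
  assumes "\<And>z. z \<in> Hp \<Longrightarrow> f z = g z" "\<And>z. z \<in> Hp \<Longrightarrow> p z = p' z" shows "Dgen p k f = Dgen p' k g"
  using assms deriv_cong_Hp [of f g] by (auto simp: Dgen_def fun_eq_iff)

lemma Dgen_eqI:
  assumes "(f has_field_derivative D) (at z)" "z \<in> Hp"
  shows "Dgen p k f z = D / \<tau> + of_real k * p z * f z"
  using assms by (simp add: Dgen_def DERIV_imp_deriv)

lemma Dgen_holomorphic:
  assumes "f holomorphic_on Hp" "p holomorphic_on Hp" shows "Dgen p k f holomorphic_on Hp"
proof (rule holomorphic_transform)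
  show "(\<lambda>z. deriv f z / \<tau> + of_real k * p z * f z) holomorphic_on Hp"
    using assms open_Hp by (intro holomorphic_intros holomorphic_deriv) auto
qed (simp add: Dgen_def)

text \<open>The function by which \<open>p\<close> must be replaced when \<open>f'/(2\<pi>i) + k p f\<close> is slashed by \<open>\<gamma> = (a, b, c, d)\<close>;
  \<open>pslash \<gamma> P = P\<close> is the quasi-modularity of \<open>P\<close>.\<close>

definition pslash :: "sl2 \<Rightarrow> (complex \<Rightarrow> complex) \<Rightarrow> complex \<Rightarrow> complex" where
  "pslash \<gamma> p z = p (moeb \<gamma> z) / (jfac \<gamma> z)\<^sup>2 + of_int (fst (snd (snd \<gamma>))) / (\<tau> * jfac \<gamma> z)"

lemma moeb_holomorphic: "\<gamma> \<in> SL2Z \<Longrightarrow> moeb \<gamma> holomorphic_on Hp"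
  by (cases \<gamma>) (auto simp: holomorphic_on_open [OF open_Hp] simp del: moeb.simps intro!: moeb_deriv exI)

lemma jfac_holomorphic: "jfac \<gamma> holomorphic_on S"
proof -
  obtain a b c d where \<gamma>: "\<gamma> = (a, b, c, d)" by (cases \<gamma>)
  have "(\<lambda>z. of_int c * z + of_int d) holomorphic_on S" by (intro holomorphic_intros)
  then show ?thesis by (rule holomorphic_transform) (simp add: \<gamma>)
qed

lemma pslash_holomorphic:
  assumes "\<gamma> \<in> SL2Z" "p holomorphic_on Hp" shows "pslash \<gamma> p holomorphic_on Hp"
proof -
  have "(p \<circ> moeb \<gamma>) holomorphic_on Hp"
    by (rule holomorphic_on_compose_gen [OF moeb_holomorphic [OF assms(1)] assms(2)])
      (use moeb_in_Hp [OF assms(1)] in blast)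
  then have "(\<lambda>z. p (moeb \<gamma> z)) holomorphic_on Hp" by (simp add: o_def)
  then have "(\<lambda>z. p (moeb \<gamma> z) / (jfac \<gamma> z)\<^sup>2 + of_int (fst (snd (snd \<gamma>))) / (\<tau> * jfac \<gamma> z)) holomorphic_on Hp"
    using jfac_nonzero [OF assms(1)] by (intro holomorphic_intros jfac_holomorphic) auto
  then show ?thesis by (rule holomorphic_transform) (simp add: pslash_def)
qed

text \<open>The derivative of the automorphy factor contributes \<open>k c / j\<close>, which is the
  correction term in \<open>pslash\<close>. Two functions \<open>f\<close> and \<open>h\<close> are
  needed since a component of a vector is slashed to a combination of components.\<close>

lemma Dgen_slash:
  assumes \<gamma>: "\<gamma> \<in> SL2Z" and f: "f holomorphic_on Hp" and h: "h holomorphic_on Hp" and z: "z \<in> Hp"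
    and eq: "\<And>z. z \<in> Hp \<Longrightarrow> f (moeb \<gamma> z) = u * jfac \<gamma> z powr of_real k * h z"
  shows "Dgen p k f (moeb \<gamma> z) = u * jfac \<gamma> z powr of_real (k + 2) * Dgen (pslash \<gamma> p) k h z"
proof -
  obtain a b c d where g: "\<gamma> = (a, b, c, d)" by (cases \<gamma>)
  define j where "j = jfac \<gamma> z"
  have j0: "j \<noteq> 0" unfolding j_def by (rule jfac_nonzero [OF \<gamma> z])
  have gz: "moeb \<gamma> z \<in> Hp" by (rule moeb_in_Hp [OF \<gamma> z])
  define J where "J = j powr of_real k"
  have J2: "j powr of_real (k + 2) = J * j\<^sup>2"
    using j0 by (simp add: J_def powr_add powr_numeral)
  have "((\<lambda>z. f (moeb \<gamma> z)) has_field_derivative deriv f (moeb \<gamma> z) * (1 / j\<^sup>2)) (at z)"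
    unfolding j_def g
    by (rule DERIV_chain2 [OF _ moeb_deriv]) (use holomorphic_derivI [OF f open_Hp gz] \<gamma> z g in auto)
  then have 1: "((\<lambda>z. u * jfac \<gamma> z powr of_real k * h z) has_field_derivative deriv f (moeb \<gamma> z) * (1 / j\<^sup>2)) (at z)"
    by (rule has_field_derivative_transform_Hp) (use z eq in auto)
  have "((\<lambda>z. jfac \<gamma> z powr of_real k) has_field_derivative of_real k * of_int c / j * J) (at z)"
    using jfac_powr_deriv [of a b c d z k] \<gamma> z unfolding g j_def J_def by simp
  from DERIV_mult [OF DERIV_cmult [OF this, of u] holomorphic_derivI [OF h open_Hp z]]
  have "((\<lambda>z. u * jfac \<gamma> z powr of_real k * h z) has_field_derivative
      u * (of_real k * of_int c / j * J) * h z + deriv h z * (u * J)) (at z)"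
    unfolding J_def j_def .
  from DERIV_unique [OF 1 this]
  have f': "deriv f (moeb \<gamma> z) = j\<^sup>2 * (u * (of_real k * of_int c / j * J) * h z + deriv h z * (u * J))"
    using j0 by (simp add: field_simps)
  have "Dgen p k f (moeb \<gamma> z) = j\<^sup>2 * (u * (of_real k * of_int c / j * J) * h z + deriv h z * (u * J)) / \<tau>
      + of_real k * p (moeb \<gamma> z) * (u * J * h z)"
    using gz eq [OF z] by (simp add: Dgen_def f' J_def j_def)
  also have "\<dots> = u * (J * j\<^sup>2) * (deriv h z / \<tau>
      + of_real k * (p (moeb \<gamma> z) / j\<^sup>2 + of_int c / (\<tau> * j)) * h z)"
    using j0 by (simp add: field_simps power2_eq_square)
  finally show ?thesis using z J2 by (simp add: Dgen_def pslash_def j_def g)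
qed

lemma Dgen_linear_comb:
  assumes "\<And>l. (\<lambda>z. F z $ l) holomorphic_on Hp" "z \<in> Hp"
  shows "Dgen p k (\<lambda>z. (A *v F z) $ i) z = (A *v DgenV p k F z) $ i"
proof -
  have "((\<lambda>z. (A *v F z) $ i) has_field_derivative (\<Sum>l\<in>UNIV. A $ i $ l * deriv (\<lambda>z. F z $ l) z)) (at z)"
    unfolding matrix_vector_mult_def vec_lambda_beta
    by (intro DERIV_sum DERIV_cmult holomorphic_derivI [OF assms(1) open_Hp assms(2)])
  from Dgen_eqI [OF this assms(2)] show ?thesis
    using assms(2)
    by (simp add: DgenV_def Dgen_def matrix_vector_mult_def sum_divide_distrib sum.distrib
        sum_distrib_left algebra_simps)
qed

text \<open>Holomorphy and the transformation law alone; growth is controlled separately through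
  q-expansions. The law is solved for the value at the moved point, the form that can be
  differentiated.\<close>

definition vform :: "real \<Rightarrow> (sl2 \<Rightarrow> complex^'n^'n) \<Rightarrow> (sl2 \<Rightarrow> complex) \<Rightarrow> (complex \<Rightarrow> complex^'n) \<Rightarrow> bool" where
  "vform k \<rho> \<upsilon> F \<longleftrightarrow> (\<forall>j. (\<lambda>z. F z $ j) holomorphic_on Hp) \<and>
     (\<forall>\<gamma>\<in>SL2Z. \<forall>z\<in>Hp. F (moeb \<gamma> z) = (\<upsilon> \<gamma> * jfac \<gamma> z powr of_real k) *s (\<rho> \<gamma> *v F z))"

lemma slashV_eq_iff:
  assumes "\<gamma> \<in> SL2Z" "z \<in> Hp" "\<upsilon> \<gamma> \<noteq> 0"
  shows "slashV k \<upsilon> \<gamma> F z = w \<longleftrightarrow> F (moeb \<gamma> z) = (\<upsilon> \<gamma> * jfac \<gamma> z powr of_real k) *s w"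
proof -
  define c where "c = \<upsilon> \<gamma> * jfac \<gamma> z powr of_real k"
  have c0: "c \<noteq> 0" using assms jfac_nonzero [OF assms(1,2)] by (simp add: c_def)
  have "slashV k \<upsilon> \<gamma> F z = inverse c *s F (moeb \<gamma> z)"
    by (simp add: slashV_def c_def powr_minus)
  then show ?thesis
    unfolding c_def [symmetric] using c0
    by (auto simp: vec_eq_iff field_simps)
qed

lemma DgenV_slash:
  assumes F: "\<And>j. (\<lambda>z. F z $ j) holomorphic_on Hp" and H: "\<And>j. (\<lambda>z. H z $ j) holomorphic_on Hp"
    and \<gamma>: "\<gamma> \<in> SL2Z" and z: "z \<in> Hp"
    and eq: "\<And>z. z \<in> Hp \<Longrightarrow> F (moeb \<gamma> z) = (u * jfac \<gamma> z powr of_real k) *s (A *v H z)"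
  shows "DgenV p k F (moeb \<gamma> z) = (u * jfac \<gamma> z powr of_real (k + 2)) *s (A *v DgenV (pslash \<gamma> p) k H z)"
proof -
  have "Dgen p k (\<lambda>z. F z $ i) (moeb \<gamma> z) = u * jfac \<gamma> z powr of_real (k + 2) * Dgen (pslash \<gamma> p) k (\<lambda>z. (A *v H z) $ i) z" for i
  proof (rule Dgen_slash [OF \<gamma> F _ z])
    show "(\<lambda>z. (A *v H z) $ i) holomorphic_on Hp"
      unfolding matrix_vector_mult_def vec_lambda_beta by (intro holomorphic_intros H)
  qed (simp add: eq)
  then show ?thesis
    using Dgen_linear_comb [of H z _ k A, OF H z] by (simp add: vec_eq_iff DgenV_def)
qed

lemma vform_DopV:
  assumes F: "vform k \<rho> \<upsilon> F" and P: "\<And>\<gamma> z. \<gamma> \<in> SL2Z \<Longrightarrow> z \<in> Hp \<Longrightarrow> pslash \<gamma> Pfun z = Pfun z"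
  shows "vform (k + 2) \<rho> \<upsilon> (DopV k F)"
  unfolding vform_def
proof (intro conjI ballI allI)
  have hol: "(\<lambda>z. F z $ j) holomorphic_on Hp" for j using F by (simp add: vform_def)
  show "(\<lambda>z. DopV k F z $ j) holomorphic_on Hp" for j
    unfolding DopV_eq_DgenV DgenV_nth by (intro Dgen_holomorphic hol Pfun_holomorphic)
  fix \<gamma> z assume g: "\<gamma> \<in> SL2Z" and z: "z \<in> Hp"
  have "DgenV (pslash \<gamma> Pfun) k F = DgenV Pfun k F"
    using P [OF g] by (auto simp: DgenV_def fun_eq_iff vec_eq_iff Dgen_def)
  with DgenV_slash [of F F \<gamma> z "\<upsilon> \<gamma>" k "\<rho> \<gamma>" Pfun, OF hol hol g z] F g
  show "DopV k F (moeb \<gamma> z) = (\<upsilon> \<gamma> * jfac \<gamma> z powr of_real (k + 2)) *s (\<rho> \<gamma> *v DopV k F z)"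
    by (simp add: vform_def DopV_eq_DgenV)
qed

definition coldet :: "complex^4^4 \<Rightarrow> complex" where
  "coldet A = det4 (column 1 A) (column 2 A) (column 3 A) (column 4 A)"

lemma det4_slash:
  assumes "A' = (u * j powr of_real ka) *s (R *v A)" "B' = (u * j powr of_real kb) *s (R *v B)"
    "C' = (u * j powr of_real kc) *s (R *v C)" "D' = (u * j powr of_real kd) *s (R *v D)" "j \<noteq> 0"
  shows "det4 A' B' C' D' = u ^ 4 * coldet R * j powr of_real (ka + kb + kc + kd) * det4 A B C D"
  unfolding assms(1-4) det4_scale det4_matrix_mult coldet_def
  using assms(5) by (simp add: powr_add power4_eq_xxxx algebra_simps)

lemma det4_row_scale:
  "det4 (\<chi> j. x j * a j) (\<chi> j. x j * b j) (\<chi> j. x j * c j) (\<chi> j. x j * d j)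
     = x 1 * x 2 * x 3 * x 4 * det4 (\<chi> j. a j) (\<chi> j. b j) (\<chi> j. c j) (\<chi> j. d j)"
  unfolding det4_eq vec_lambda_beta by algebra

text \<open>The exponent belongs to the component and is shared by all four forms, so one power of
  \<open>q\<close> factors out of each row.\<close>

lemma qexp_det4:
  assumes "\<And>j. qexp (\<nu> j) (a j) (\<lambda>z. A z $ j)" "\<And>j. qexp (\<nu> j) (b j) (\<lambda>z. B z $ j)"
    "\<And>j. qexp (\<nu> j) (c j) (\<lambda>z. C z $ j)" "\<And>j. qexp (\<nu> j) (d j) (\<lambda>z. D z $ j)"
  shows "qexp (\<Sum>j\<in>UNIV. \<nu> j) (\<lambda>q. det4 (\<chi> j. a j q) (\<chi> j. b j q) (\<chi> j. c j q) (\<chi> j. d j q))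
     (\<lambda>z. det4 (A z) (B z) (C z) (D z))"
  unfolding qexp_def
proof (intro conjI ballI)
  show "(\<lambda>q. det4 (\<chi> j. a j q) (\<chi> j. b j q) (\<chi> j. c j q) (\<chi> j. d j q)) holomorphic_on ball 0 1"
    using assms by (intro det4_holomorphic) (auto simp: qexp_def)
  fix z assume z: "z \<in> Hp"
  have "A z = (\<chi> j. qpow (of_real (\<nu> j)) z * a j (qpow 1 z))" "B z = (\<chi> j. qpow (of_real (\<nu> j)) z * b j (qpow 1 z))"
    "C z = (\<chi> j. qpow (of_real (\<nu> j)) z * c j (qpow 1 z))" "D z = (\<chi> j. qpow (of_real (\<nu> j)) z * d j (qpow 1 z))"
    using assms z by (auto simp: vec_eq_iff qexp_def)
  moreover have "qpow (of_real (\<Sum>j\<in>UNIV. \<nu> j)) z = qpow (of_real (\<nu> 1)) z * qpow (of_real (\<nu> 2)) z * qpow (of_real (\<nu> 3)) z * qpow (of_real (\<nu> 4)) z"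
    by (simp add: sum_4 qpow_add)
  ultimately show "det4 (A z) (B z) (C z) (D z) = qpow (of_real (\<Sum>j\<in>UNIV. \<nu> j)) z *
      det4 (\<chi> j. a j (qpow 1 z)) (\<chi> j. b j (qpow 1 z)) (\<chi> j. c j (qpow 1 z)) (\<chi> j. d j (qpow 1 z))"
    by (simp add: det4_row_scale)
qed

text \<open>Leibniz rule; the terms in \<open>P\<close> match because the weight of the determinant
  is the sum of the four weights.\<close>

lemma det4_Dop:
  assumes hol: "\<And>j. (\<lambda>z. A z $ j) holomorphic_on Hp" "\<And>j. (\<lambda>z. B z $ j) holomorphic_on Hp"
    "\<And>j. (\<lambda>z. C z $ j) holomorphic_on Hp" "\<And>j. (\<lambda>z. D z $ j) holomorphic_on Hp" and z: "z \<in> Hp"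
  shows "Dop (ka + kb + kc + kd) (\<lambda>z. det4 (A z) (B z) (C z) (D z)) z =
     det4 (DopV ka A z) (B z) (C z) (D z) + det4 (A z) (DopV kb B z) (C z) (D z)
     + det4 (A z) (B z) (DopV kc C z) (D z) + det4 (A z) (B z) (C z) (DopV kd D z)"
proof -
  define dv where "dv = (\<lambda>(X :: complex \<Rightarrow> complex^4). \<chi> j. deriv (\<lambda>z. X z $ j) z)"
  have DV: "DopV k X z = (1 / \<tau>) *s dv X + (of_real k * Pfun z) *s X z" for k and X :: "complex \<Rightarrow> complex^4"
    using z by (simp add: vec_eq_iff DopV_def Dop_def dv_def)
  have lin: "det4 (x *s a + y *s a') b c d = x * det4 a b c d + y * det4 a' b c d"
    "det4 b (x *s a + y *s a') c d = x * det4 b a c d + y * det4 b a' c d"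
    "det4 b c (x *s a + y *s a') d = x * det4 b c a d + y * det4 b c a' d"
    "det4 b c d (x *s a + y *s a') = x * det4 b c d a + y * det4 b c d a'" for x y a a' b c d
    unfolding det4_eq vector_smult_component vector_add_component by algebra+
  have d: "((\<lambda>z. X z $ j) has_field_derivative dv X $ j) (at z)"
    if "\<And>j. (\<lambda>z. X z $ j) holomorphic_on Hp" for X :: "complex \<Rightarrow> complex^4" and j
    using holomorphic_derivI [OF that open_Hp z] by (simp add: dv_def)
  from Dop_eqI [OF has_field_derivative_det4 [of A "dv A" z B "dv B" C "dv C" D "dv D", OF d d d d] z, OF hol]
  show ?thesis unfolding DV lin by (simp add: algebra_simps add_divide_distrib)
qed

text \<open>The coefficients do not depend on \<open>f\<close>, so all components of a vector
  function get the same ones, and the top coefficients are powers of \<open>1 / \<tau>\<close>, free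
  of \<open>p\<close>.\<close>

lemma Dgen_triangular:
  assumes p: "p holomorphic_on Hp" and z: "z \<in> Hp"
  obtains A1 A2 B2 A3 B3 C3 where "\<And>f. f holomorphic_on Hp \<Longrightarrow>
       Dgen p k f z = 1 / \<tau> * deriv f z + A1 * f z \<and>
       Dgen p (k + 2) (Dgen p k f) z = (1 / \<tau>)\<^sup>2 * deriv (deriv f) z + A2 * deriv f z + B2 * f z \<and>
       Dgen p (k + 4) (Dgen p (k + 2) (Dgen p k f)) z = (1 / \<tau>) ^ 3 * deriv (deriv (deriv f)) z
          + A3 * deriv (deriv f) z + B3 * deriv f z + C3 * f z"
proof -
  define i0 where "i0 = 1 / \<tau>"
  define A2 where "A2 = (\<lambda>z. i0 * (of_real k * p z) + of_real (k + 2) * p z * i0)"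
  define B2 where "B2 = (\<lambda>z. i0 * (of_real k * deriv p z) + of_real (k + 2) * p z * (of_real k * p z))"
  have p': "deriv p holomorphic_on Hp" by (rule holomorphic_deriv [OF p open_Hp])
  have A2': "A2 holomorphic_on Hp" and B2': "B2 holomorphic_on Hp"
    unfolding A2_def B2_def by (intro holomorphic_intros p p')+
  show ?thesis
  proof (rule that [of "of_real k * p z" "A2 z" "B2 z" "i0 * A2 z + of_real (k + 4) * p z * i0\<^sup>2"
        "i0 * (deriv A2 z + B2 z) + of_real (k + 4) * p z * A2 z"
        "i0 * deriv B2 z + of_real (k + 4) * p z * B2 z"], intro conjI; unfold i0_def [symmetric])
    fix f assume f: "f holomorphic_on Hp"
    have f': "deriv f holomorphic_on Hp" by (rule holomorphic_deriv [OF f open_Hp])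
    have f'': "deriv (deriv f) holomorphic_on Hp" by (rule holomorphic_deriv [OF f' open_Hp])
    note D = holomorphic_derivI [OF _ open_Hp]
    have eqI: "Dgen p l g y = i0 * g' + of_real l * p y * g y"
      if "(g has_field_derivative g') (at y)" "y \<in> Hp" for g g' y l
      using Dgen_eqI [OF that] by (simp add: i0_def)
    have 1: "Dgen p k f y = i0 * deriv f y + of_real k * p y * f y" if "y \<in> Hp" for y
      using that by (simp add: Dgen_def i0_def)
    then show "Dgen p k f z = i0 * deriv f z + of_real k * p z * f z" using z .
    have 2: "Dgen p (k + 2) (Dgen p k f) y = i0\<^sup>2 * deriv (deriv f) y + A2 y * deriv f y + B2 y * f y" if y: "y \<in> Hp" for y
    proof -
      have "((\<lambda>y. i0 * deriv f y + of_real k * p y * f y) has_field_derivative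
          i0 * deriv (deriv f) y + (of_real k * deriv p y * f y + deriv f y * (of_real k * p y))) (at y)"
        by (intro DERIV_add DERIV_mult DERIV_cmult D f f' p y)
      from has_field_derivative_transform_Hp [OF this y, of "Dgen p k f"]
      have "(Dgen p k f has_field_derivative
          i0 * deriv (deriv f) y + (of_real k * deriv p y * f y + deriv f y * (of_real k * p y))) (at y)"
        using 1 by simp
      from eqI [OF this y, of "k + 2"] show ?thesis
        unfolding 1 [OF y] by (simp add: A2_def B2_def power2_eq_square algebra_simps)
    qed
    then show "Dgen p (k + 2) (Dgen p k f) z = i0\<^sup>2 * deriv (deriv f) z + A2 z * deriv f z + B2 z * f z" using z .
    have "((\<lambda>y. i0\<^sup>2 * deriv (deriv f) y + A2 y * deriv f y + B2 y * f y) has_field_derivative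
        i0\<^sup>2 * deriv (deriv (deriv f)) z + (deriv A2 z * deriv f z + deriv (deriv f) z * A2 z)
        + (deriv B2 z * f z + deriv f z * B2 z)) (at z)"
      by (intro DERIV_add DERIV_mult DERIV_cmult D f f' f'' A2' B2' z)
    from has_field_derivative_transform_Hp [OF this z, of "Dgen p (k + 2) (Dgen p k f)"]
    have "(Dgen p (k + 2) (Dgen p k f) has_field_derivative
        i0\<^sup>2 * deriv (deriv (deriv f)) z + (deriv A2 z * deriv f z + deriv (deriv f) z * A2 z)
        + (deriv B2 z * f z + deriv f z * B2 z)) (at z)"
      using 2 by simp
    from eqI [OF this z, of "k + 4"]
    show "Dgen p (k + 4) (Dgen p (k + 2) (Dgen p k f)) z = i0 ^ 3 * deriv (deriv (deriv f)) z
          + (i0 * A2 z + of_real (k + 4) * p z * i0\<^sup>2) * deriv (deriv f) z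
          + (i0 * (deriv A2 z + B2 z) + of_real (k + 4) * p z * A2 z) * deriv f z
          + (i0 * deriv B2 z + of_real (k + 4) * p z * B2 z) * f z"
      unfolding 2 [OF z] by (simp add: power2_eq_square power3_eq_cube algebra_simps)
  qed
qed

section \<open>The Wronskian of a vector-valued form\<close>

definition wronskian :: "(complex \<Rightarrow> complex) \<Rightarrow> real \<Rightarrow> (complex \<Rightarrow> complex^4) \<Rightarrow> complex \<Rightarrow> complex" where
  "wronskian p k F z = det4 (F z) (DgenV p k F z) (DgenV p (k + 2) (DgenV p k F) z)
     (DgenV p (k + 4) (DgenV p (k + 2) (DgenV p k F)) z)"

text \<open>\<open>det4_triangular\<close> leaves only the plain derivatives, with the factor
  \<open>(1 / \<tau>)^6\<close>. Thus the Wronskian can be shown to transform before anything is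
  known about \<open>P\<close>.\<close>

lemma wronskian_independent:
  assumes F: "\<And>j. (\<lambda>z. F z $ j) holomorphic_on Hp" and p: "p holomorphic_on Hp" and p': "p' holomorphic_on Hp"
    and z: "z \<in> Hp"
  shows "wronskian p k F z = wronskian p' k F z"
proof -
  define i0 where "i0 = 1 / \<tau>"
  have "wronskian p k F z = i0 * i0\<^sup>2 * i0 ^ 3 * det4 (F z) (\<chi> j. deriv (\<lambda>z. F z $ j) z)
      (\<chi> j. deriv (deriv (\<lambda>z. F z $ j)) z) (\<chi> j. deriv (deriv (deriv (\<lambda>z. F z $ j))) z)"
    if p: "p holomorphic_on Hp" for p
  proof -
    obtain A1 A2 B2 A3 B3 C3 where *: "\<And>f. f holomorphic_on Hp \<Longrightarrow>
       Dgen p k f z = i0 * deriv f z + A1 * f z \<and>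
       Dgen p (k + 2) (Dgen p k f) z = i0\<^sup>2 * deriv (deriv f) z + A2 * deriv f z + B2 * f z \<and>
       Dgen p (k + 4) (Dgen p (k + 2) (Dgen p k f)) z = i0 ^ 3 * deriv (deriv (deriv f)) z
          + A3 * deriv (deriv f) z + B3 * deriv f z + C3 * f z"
      unfolding i0_def using Dgen_triangular [OF p z, of k] by blast
    have "DgenV p k F z = i0 *s (\<chi> j. deriv (\<lambda>z. F z $ j) z) + A1 *s F z"
      "DgenV p (k + 2) (DgenV p k F) z = i0\<^sup>2 *s (\<chi> j. deriv (deriv (\<lambda>z. F z $ j)) z)
         + A2 *s (\<chi> j. deriv (\<lambda>z. F z $ j) z) + B2 *s F z"
      "DgenV p (k + 4) (DgenV p (k + 2) (DgenV p k F)) z = i0 ^ 3 *s (\<chi> j. deriv (deriv (deriv (\<lambda>z. F z $ j))) z)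
         + A3 *s (\<chi> j. deriv (deriv (\<lambda>z. F z $ j)) z) + B3 *s (\<chi> j. deriv (\<lambda>z. F z $ j) z) + C3 *s F z"
      using * [OF F] by (simp_all add: vec_eq_iff DgenV_def)
    then show ?thesis unfolding wronskian_def by (simp only: det4_triangular)
  qed
  from this [OF p] this [OF p'] show ?thesis by simp
qed

text \<open>Slashing replaces \<open>p\<close> by \<open>pslash \<gamma> p\<close> in all the
  derivatives at once, and \<open>wronskian_independent\<close> changes it back.\<close>

lemma wronskian_slash:
  assumes F: "vform k \<rho> \<upsilon> F" and p: "p holomorphic_on Hp" and \<gamma>: "\<gamma> \<in> SL2Z" and z: "z \<in> Hp"
  shows "wronskian p k F (moeb \<gamma> z) =
     \<upsilon> \<gamma> ^ 4 * coldet (\<rho> \<gamma>) * jfac \<gamma> z powr of_real (4 * k + 12) * wronskian p k F z"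
proof -
  have hol: "(\<lambda>z. F z $ j) holomorphic_on Hp" for j using F by (simp add: vform_def)
  have ps: "pslash \<gamma> p holomorphic_on Hp" by (rule pslash_holomorphic [OF \<gamma> p])
  have eq0: "F (moeb \<gamma> y) = (\<upsilon> \<gamma> * jfac \<gamma> y powr of_real k) *s (\<rho> \<gamma> *v F y)" if "y \<in> Hp" for y
    using F \<gamma> that by (simp add: vform_def)
  note h1 = Dgen_holomorphic [OF hol]
  note eq1 = DgenV_slash [of F F \<gamma> _ "\<upsilon> \<gamma>" k "\<rho> \<gamma>" p, OF hol hol \<gamma> _ eq0]
  have eq2: "DgenV p (k + 2) (DgenV p k F) (moeb \<gamma> y) = (\<upsilon> \<gamma> * jfac \<gamma> y powr of_real (k + 4)) *s
       (\<rho> \<gamma> *v DgenV (pslash \<gamma> p) (k + 2) (DgenV (pslash \<gamma> p) k F) y)" if "y \<in> Hp" for y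
    using DgenV_slash [of "DgenV p k F" "DgenV (pslash \<gamma> p) k F" \<gamma> y "\<upsilon> \<gamma>" "k + 2" "\<rho> \<gamma>" p, OF _ _ \<gamma> that eq1]
    unfolding DgenV_nth using h1 p ps by (simp add: add.commute)
  have eq3: "DgenV p (k + 4) (DgenV p (k + 2) (DgenV p k F)) (moeb \<gamma> y) = (\<upsilon> \<gamma> * jfac \<gamma> y powr of_real (k + 6)) *s
       (\<rho> \<gamma> *v DgenV (pslash \<gamma> p) (k + 4) (DgenV (pslash \<gamma> p) (k + 2) (DgenV (pslash \<gamma> p) k F)) y)" if "y \<in> Hp" for y
    using DgenV_slash [of "DgenV p (k + 2) (DgenV p k F)" "DgenV (pslash \<gamma> p) (k + 2) (DgenV (pslash \<gamma> p) k F)" \<gamma> y "\<upsilon> \<gamma>" "k + 4" "\<rho> \<gamma>" p, OF _ _ \<gamma> that eq2]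
    unfolding DgenV_nth using Dgen_holomorphic [OF h1] p ps by (simp add: add.commute)
  have "wronskian p k F (moeb \<gamma> z) = \<upsilon> \<gamma> ^ 4 * coldet (\<rho> \<gamma>) * jfac \<gamma> z powr of_real (k + (k + 2) + (k + 4) + (k + 6))
      * wronskian (pslash \<gamma> p) k F z"
    unfolding wronskian_def
    by (rule det4_slash [OF eq0 [OF z] eq1 [OF z] eq2 [OF z] eq3 [OF z] jfac_nonzero [OF \<gamma> z]])
  also have "k + (k + 2) + (k + 4) + (k + 6) = 4 * k + 12" by simp
  finally show ?thesis using wronskian_independent [OF hol p ps z] by simp
qed

section \<open>Modularity of eta and scalar modular forms\<close>

lemma qexp_Dop_lead:
  assumes "qexp s g h"
  obtains g' where "qexp s g' (Dop k h)" "g' 0 = (of_real s - of_real k / 12) * g 0"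
  using qexp_Dop [OF assms, of k] by (rule that) (simp add: pq_0 algebra_simps)

lemma vqexp_DopV:
  assumes "\<And>j. qexp (\<nu> j) (g j) (\<lambda>z. F z $ j)"
  obtains g' where "\<And>j. qexp (\<nu> j) (g' j) (\<lambda>z. DopV k F z $ j)"
    "\<And>j. g' j 0 = (of_real (\<nu> j) - of_real k / 12) * g j 0"
proof -
  have "\<forall>j. \<exists>h. qexp (\<nu> j) h (\<lambda>z. DopV k F z $ j) \<and> h 0 = (of_real (\<nu> j) - of_real k / 12) * g j 0"
    unfolding DopV_def vec_lambda_beta using qexp_Dop_lead [OF assms] by metis
  then show ?thesis using that by metis
qed

text \<open>With nonzero leading coefficients and distinct exponents the Vandermonde product is
  nonzero, so the order of the Wronskian is exactly the sum of the exponents.\<close>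

lemma qexp_wronskian:
  assumes "\<And>j. qexp (\<nu> j) (g j) (\<lambda>z. F z $ j)"
  obtains h where "qexp (\<Sum>j\<in>UNIV. \<nu> j) h (wronskian Pfun k F)"
    "(\<And>j. g j 0 \<noteq> 0) \<Longrightarrow> inj \<nu> \<Longrightarrow> h 0 \<noteq> 0"
proof -
  obtain g1 where g1: "\<And>j. qexp (\<nu> j) (g1 j) (\<lambda>z. DopV k F z $ j)"
    "\<And>j. g1 j 0 = (of_real (\<nu> j) - of_real k / 12) * g j 0"
    using vqexp_DopV [OF assms] by metis
  obtain g2 where g2: "\<And>j. qexp (\<nu> j) (g2 j) (\<lambda>z. DopV (k + 2) (DopV k F) z $ j)"
    "\<And>j. g2 j 0 = (of_real (\<nu> j) - of_real (k + 2) / 12) * g1 j 0"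
    using vqexp_DopV [OF g1(1)] by metis
  obtain g3 where g3: "\<And>j. qexp (\<nu> j) (g3 j) (\<lambda>z. DopV (k + 4) (DopV (k + 2) (DopV k F)) z $ j)"
    "\<And>j. g3 j 0 = (of_real (\<nu> j) - of_real (k + 4) / 12) * g2 j 0"
    using vqexp_DopV [OF g2(1)] by metis
  define h where "h = (\<lambda>q. det4 (\<chi> j. g j q) (\<chi> j. g1 j q) (\<chi> j. g2 j q) (\<chi> j. g3 j q))"
  show ?thesis
  proof (rule that)
    show "qexp (\<Sum>j\<in>UNIV. \<nu> j) h (wronskian Pfun k F)"
      unfolding h_def wronskian_def [abs_def] DopV_eq_DgenV [symmetric]
      by (rule qexp_det4 [OF assms g1(1) g2(1) g3(1)])
    assume nz: "\<And>j. g j 0 \<noteq> 0" and inj: "inj \<nu>"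
    define x where "x = (\<lambda>j. complex_of_real (\<nu> j) - of_real k / 12)"
    have "h 0 = det4 (\<chi> j. g j 0) (\<chi> j. x j * g j 0) (\<chi> j. (x j - 1/6) * (x j * g j 0))
        (\<chi> j. (x j - 1/3) * ((x j - 1/6) * (x j * g j 0)))"
    proof -
      \<comment> \<open>Raising the weight by 2 or 4 lowers \<open>x\<close> by 1/6 or 1/3; these
        are the \<alpha> and \<beta> of \<open>det4_vandermonde\<close>.\<close>
      have x2: "of_real (\<nu> j) - of_real (k + 2) / 12 = x j - 1/6"
        and x3: "of_real (\<nu> j) - of_real (k + 4) / 12 = x j - 1/3" for j
        by (simp_all add: x_def add_divide_distrib)
      show ?thesis unfolding h_def g3(2) g2(2) g1(2) x2 x3 by (simp add: x_def)
    qed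
    also have "\<dots> = g 1 0 * g 2 0 * g 3 0 * g 4 0 * (x 2 - x 1) * (x 3 - x 1) * (x 4 - x 1) * (x 3 - x 2) * (x 4 - x 2) * (x 4 - x 3)"
      by (rule det4_vandermonde)
    also have "\<dots> \<noteq> 0"
    proof -
      have "x i \<noteq> x j" if "i \<noteq> j" for i j using inj that by (simp add: x_def inj_eq)
      then show ?thesis using nz by simp
    qed
    finally show "h 0 \<noteq> 0" .
  qed
qed

lemma etapow_holomorphic: "etapow K holomorphic_on Hp"
  by (rule qexp_holomorphic [OF qexp_etapow])

text \<open>Abel's identity: three terms in the derivative of the Wronskian repeat a column, and the
  fourth vanishes because D^4 F has no part along D^3 F.\<close>

lemma wronskian_ode_imp_etapow:
  assumes F: "\<And>j. (\<lambda>z. F z $ j) holomorphic_on Hp"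
    and ode: "\<And>z. z \<in> Hp \<Longrightarrow> \<exists>x y w. DopV (k + 6) (DopV (k + 4) (DopV (k + 2) (DopV k F))) z =
       x *s DopV (k + 2) (DopV k F) z + y *s DopV k F z + w *s F z"
  obtains C where "\<And>z. z \<in> Hp \<Longrightarrow> wronskian Pfun k F z = C * etapow (4 * k + 12) z"
proof -
  let ?D1 = "DopV k F" and ?D2 = "DopV (k + 2) (DopV k F)"
    and ?D3 = "DopV (k + 4) (DopV (k + 2) (DopV k F))"
  have h1: "(\<lambda>z. ?D1 z $ j) holomorphic_on Hp" for j
    unfolding DopV_eq_DgenV DgenV_nth by (intro Dgen_holomorphic F Pfun_holomorphic)
  have h2: "(\<lambda>z. ?D2 z $ j) holomorphic_on Hp" for j
    unfolding DopV_eq_DgenV DgenV_nth by (intro Dgen_holomorphic F Pfun_holomorphic)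
  have h3: "(\<lambda>z. ?D3 z $ j) holomorphic_on Hp" for j
    unfolding DopV_eq_DgenV DgenV_nth by (intro Dgen_holomorphic F Pfun_holomorphic)
  have W: "wronskian Pfun k F = (\<lambda>z. det4 (F z) (?D1 z) (?D2 z) (?D3 z))"
    by (simp add: wronskian_def fun_eq_iff DopV_eq_DgenV)
  have dep: "det4 a b c (x *s c + y *s b + w *s a) = 0" for a b c x y w
    unfolding det4_eq vector_smult_component vector_add_component by algebra
  have "Dop (k + (k + 2) + (k + 4) + (k + 6)) (wronskian Pfun k F) z = 0" if z: "z \<in> Hp" for z
  proof -
    obtain x y w where "DopV (k + 6) ?D3 z = x *s ?D2 z + y *s ?D1 z + w *s F z" using ode [OF z] by blast
    then show ?thesis
      unfolding W det4_Dop [OF F h1 h2 h3 z] by (simp add: det4_repeat dep)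
  qed
  moreover have "k + (k + 2) + (k + 4) + (k + 6) = 4 * k + 12" by simp
  moreover have "wronskian Pfun k F holomorphic_on Hp"
    unfolding W by (intro det4_holomorphic F h1 h2 h3)
  ultimately show ?thesis using Dop_eq_0_imp_etapow [of "wronskian Pfun k F" "4 * k + 12"] that by metis
qed

text \<open>The modularity of \<open>\<eta>\<close>, in the form needed here: \<open>|\<eta>|\<close> transforms with weight 1/2 under
  \<open>z \<mapsto> -1/z\<close>, and \<open>P\<close> is quasi-modular of weight 2. Both are read off the Wronskian of a
  vector-valued modular form solving a monic MLDE, which is a power of \<open>\<eta>\<close>.\<close>

locale eta_modular =
  assumes etaS: "z \<in> Hp \<Longrightarrow> norm (eta (- 1 / z)) = norm z powr (1/2) * norm (eta z)"
    and P_slash: "\<gamma> \<in> SL2Z \<Longrightarrow> z \<in> Hp \<Longrightarrow> pslash \<gamma> Pfun z = Pfun z"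

lemma wronskian_imp_eta_modular:
  assumes F: "vform k \<rho> \<upsilon> F" and unit: "\<And>\<gamma>. \<gamma> \<in> SL2Z \<Longrightarrow> norm (\<upsilon> \<gamma>) = 1"
    and W: "\<And>z. z \<in> Hp \<Longrightarrow> wronskian Pfun k F z = C * etapow (4 * k + 12) z"
    and C: "C \<noteq> 0" and k: "4 * k + 12 > 0"
  shows "eta_modular" and "norm (coldet (\<rho> Smat)) = 1"
proof -
  define K where "K = 4 * k + 12"
  define w where "w = wronskian Pfun k F"
  have w0: "w z \<noteq> 0" if "z \<in> Hp" for z using W [OF that] C by (simp add: w_def)
  have whol: "w holomorphic_on Hp"
  proof (rule holomorphic_transform)
    show "(\<lambda>z. C * etapow K z) holomorphic_on Hp" by (intro holomorphic_intros etapow_holomorphic)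
  qed (simp add: w_def W K_def)
  have sl: "w (moeb \<gamma> z) = (\<upsilon> \<gamma> ^ 4 * coldet (\<rho> \<gamma>)) * jfac \<gamma> z powr of_real K * w z"
    if "\<gamma> \<in> SL2Z" "z \<in> Hp" for \<gamma> z
    unfolding w_def K_def by (rule wronskian_slash [OF F Pfun_holomorphic that])
  have Sin: "- 1 / z \<in> Hp" if "z \<in> Hp" for z using moeb_in_Hp [OF Smat_in that] by simp
  have S: "norm (w (- 1 / z)) = norm (coldet (\<rho> Smat)) * norm z powr K * norm (w z)" if "z \<in> Hp" for z
    using sl [OF Smat_in that] unit [OF Smat_in] by (simp add: norm_mult norm_power norm_powr_real_powr')
  \<comment> \<open>S fixes \<open>\<i>\<close>, where the weight factor has norm 1, so the
    character can be read off.\<close>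
  show det1: "norm (coldet (\<rho> Smat)) = 1"
  proof -
    have "- 1 / \<i> = \<i>" by (simp add: divide_eq_eq)
    then show ?thesis using S [OF i_in_Hp] w0 [OF i_in_Hp] by simp
  qed
  show "eta_modular"
  proof
    fix z assume z: "z \<in> Hp"
    have "norm (eta (- 1 / z)) powr (2 * K) = norm z powr K * norm (eta z) powr (2 * K)"
      using S [OF z] det1 C unfolding w_def W [OF z] W [OF Sin [OF z]] norm_mult
      by (simp add: norm_etapow z Sin [simplified] flip: K_def)
    also have "\<dots> = (norm z powr (1/2) * norm (eta z)) powr (2 * K)"
      by (simp add: powr_mult powr_powr)
    \<comment> \<open>As \<open>K > 0\<close>, the power \<open>2 * K\<close> can be undone on
      nonnegative reals.\<close>
    finally have "(norm (eta (- 1 / z)) powr (2 * K)) powr (1 / (2 * K)) = ((norm z powr (1/2) * norm (eta z)) powr (2 * K)) powr (1 / (2 * K))"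
      by simp
    then show "norm (eta (- 1 / z)) = norm z powr (1/2) * norm (eta z)"
      using k by (simp add: powr_powr K_def)
  next
    fix \<gamma> z assume g: "\<gamma> \<in> SL2Z" and z: "z \<in> Hp"
    have gz: "moeb \<gamma> z \<in> Hp" by (rule moeb_in_Hp [OF g z])
    \<comment> \<open>The derivation with \<open>P\<close> kills \<open>w\<close>; slashing this
      shows that the one with \<open>pslash \<gamma> Pfun\<close> kills it too. Since
      \<open>w\<close> has no zero, the two functions agree.\<close>
    have D0: "Dgen Pfun K w y = 0" if y: "y \<in> Hp" for y
    proof -
      have "((\<lambda>z. C * etapow K z) has_field_derivative C * (- 2 * of_real pi * \<i> * of_real K * Pfun y * etapow K y)) (at y)"
        by (intro DERIV_cmult etapow_deriv y)
      moreover have "C * (- 2 * of_real pi * \<i> * of_real K * Pfun y * etapow K y)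
          = \<tau> * (- (of_real K * Pfun y * w y))"
        using W [OF y] by (simp add: w_def K_def)
      ultimately have "((\<lambda>z. C * etapow K z) has_field_derivative \<tau> * (- (of_real K * Pfun y * w y))) (at y)"
        by (simp only:)
      from has_field_derivative_transform_Hp [OF this y, of w]
      have "(w has_field_derivative \<tau> * (- (of_real K * Pfun y * w y))) (at y)"
        using W by (simp add: w_def K_def)
      from Dgen_eqI [OF this y, of Pfun K] show ?thesis by simp
    qed
    have u0: "\<upsilon> \<gamma> ^ 4 * coldet (\<rho> \<gamma>) \<noteq> 0" using sl [OF g z] w0 [OF gz] by auto
    have "0 = (\<upsilon> \<gamma> ^ 4 * coldet (\<rho> \<gamma>)) * jfac \<gamma> z powr of_real (K + 2) * Dgen (pslash \<gamma> Pfun) K w z"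
      using Dgen_slash [OF g whol whol z sl [OF g], of Pfun] D0 [OF gz] by simp
    then have "Dgen (pslash \<gamma> Pfun) K w z = 0"
      using u0 jfac_nonzero [OF g z] by simp
    with D0 [OF z] have "of_real K * pslash \<gamma> Pfun z * w z = of_real K * Pfun z * w z"
      using z by (simp add: Dgen_def add_eq_0_iff)
    moreover have "K \<noteq> 0" using k by (simp add: K_def)
    ultimately show "pslash \<gamma> Pfun z = Pfun z" using w0 [OF z] by simp
  qed
qed

text \<open>By induction the equations make all derivatives of \<open>f\<close> and \<open>g\<close>
  vanish at \<open>z0\<close>, and the identity theorem finishes. The coefficients may involve
  \<open>f\<close> itself, so a Riccati equation is covered.\<close>

lemma ode_system_unique:
  assumes hol: "f holomorphic_on Hp" "g holomorphic_on Hp" "a holomorphic_on Hp" "b holomorphic_on Hp"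
      "c holomorphic_on Hp" "d holomorphic_on Hp"
    and f': "\<And>z. z \<in> Hp \<Longrightarrow> deriv f z = a z * f z + b z * g z"
    and g': "\<And>z. z \<in> Hp \<Longrightarrow> deriv g z = c z * f z + d z * g z"
    and z0: "z0 \<in> Hp" "f z0 = 0" "g z0 = 0" and z: "z \<in> Hp"
  shows "f z = 0"
proof -
  have "(deriv ^^ n) f z0 = 0 \<and> (deriv ^^ n) g z0 = 0" for n
  proof (induction n rule: less_induct)
    case (less n)
    show ?case
    proof (cases n)
      case (Suc m)
      have IH: "(deriv ^^ l) f z0 = 0" "(deriv ^^ l) g z0 = 0" if "l \<le> m" for l
        using less.IH [of l] that Suc by simp_all
      have comb: "(deriv ^^ m) (\<lambda>z. u z * f z + v z * g z) z0 = 0"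
        if uv: "u holomorphic_on Hp" "v holomorphic_on Hp" for u v
      proof -
        have "(deriv ^^ m) (\<lambda>z. u z * f z + v z * g z) z0 = (deriv ^^ m) (\<lambda>z. u z * f z) z0 + (deriv ^^ m) (\<lambda>z. v z * g z) z0"
          using uv hol by (intro higher_deriv_add [OF _ _ open_Hp z0(1)] holomorphic_on_mult)
        also have "(deriv ^^ m) (\<lambda>z. u z * f z) z0 = 0"
          unfolding higher_deriv_mult [OF uv(1) hol(1) open_Hp z0(1)] by (simp add: IH)
        also have "(deriv ^^ m) (\<lambda>z. v z * g z) z0 = 0"
          unfolding higher_deriv_mult [OF uv(2) hol(2) open_Hp z0(1)] by (simp add: IH)
        finally show ?thesis by simp
      qed
      have ev: "eventually (\<lambda>z. z \<in> Hp) (nhds z0)"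
        using z0 open_Hp by (intro eventually_nhds_in_open)
      have "(deriv ^^ m) (deriv f) z0 = (deriv ^^ m) (\<lambda>z. a z * f z + b z * g z) z0"
        by (rule higher_deriv_cong_ev [OF _ refl]) (use ev f' in \<open>auto elim!: eventually_mono\<close>)
      moreover have "(deriv ^^ m) (deriv g) z0 = (deriv ^^ m) (\<lambda>z. c z * f z + d z * g z) z0"
        by (rule higher_deriv_cong_ev [OF _ refl]) (use ev g' in \<open>auto elim!: eventually_mono\<close>)
      ultimately show ?thesis
        using comb [OF hol(3,4)] comb [OF hol(5,6)] by (simp add: Suc funpow_Suc_right del: funpow.simps)
    qed (simp add: z0)
  qed
  then show ?thesis
    using holomorphic_fun_eq_0_on_connected [OF hol(1) open_Hp connected_Hp _ z0(1) z] by blast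
qed

section \<open>Scalar modular forms of integral weight\<close>

lemma powi_eq_powr: "z \<noteq> 0 \<Longrightarrow> (z :: complex) powi k = z powr of_real (of_int k)"
  by (simp add: complex_powr_of_int)

lemma Mk_slash: "f \<in> Mk k \<Longrightarrow> \<gamma> \<in> SL2Z \<Longrightarrow> z \<in> Hp \<Longrightarrow> f (moeb \<gamma> z) = jfac \<gamma> z powi k * f z"
  by (simp add: Mk_def)

lemma Mk_outside: "f \<in> Mk k \<Longrightarrow> z \<notin> Hp \<Longrightarrow> f z = 0"
  by (simp add: Mk_def)

lemma Mk_hol: "f \<in> Mk k \<Longrightarrow> f holomorphic_on Hp"
  by (simp add: Mk_def)

lemma Mk_qexp: assumes "f \<in> Mk k" obtains g where "qexp 0 g f"
proof (rule qexp_of_moderate_growth)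
  show "f holomorphic_on Hp" "moderate_growth f" using assms by (auto simp: Mk_def)
  show "f (z + 1) = ee 0 * f z" if "z \<in> Hp" for z
    using Mk_slash [OF assms Tmat_in that] by (simp add: ee_def)
qed auto

lemma MkI:
  assumes "qexp 0 g f" "\<And>z. z \<notin> Hp \<Longrightarrow> f z = 0"
    "\<And>\<gamma> z. \<gamma> \<in> SL2Z \<Longrightarrow> z \<in> Hp \<Longrightarrow> f (moeb \<gamma> z) = jfac \<gamma> z powi k * f z"
  shows "f \<in> Mk k"
  using assms qexp_holomorphic [OF assms(1)] qexp_moderate_growth [OF assms(1)] by (simp add: Mk_def)

lemma Mk_zero: "(\<lambda>z. 0) \<in> Mk k"
  by (rule MkI [OF qexp_zero]) auto

lemma Mk_add: assumes "f \<in> Mk k" "g \<in> Mk k" shows "(\<lambda>z. f z + g z) \<in> Mk k"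
proof -
  obtain a b where "qexp 0 a f" "qexp 0 b g" using assms Mk_qexp by metis
  from MkI [OF qexp_add [OF this]] show ?thesis
    using assms by (simp add: Mk_slash Mk_outside algebra_simps)
qed

lemma Mk_cmult: assumes "f \<in> Mk k" shows "(\<lambda>z. c * f z) \<in> Mk k"
proof -
  obtain a where "qexp 0 a f" using assms Mk_qexp by metis
  from MkI [OF qexp_cmult [OF this]] show ?thesis
    using assms by (simp add: Mk_slash Mk_outside)
qed

lemma Mk_diff: assumes "f \<in> Mk k" "g \<in> Mk k" shows "(\<lambda>z. f z - g z) \<in> Mk k"
  using Mk_add [OF assms(1) Mk_cmult [OF assms(2), of "-1"]] by simp

lemma Mk_mult: assumes "f \<in> Mk k" "g \<in> Mk l" shows "(\<lambda>z. f z * g z) \<in> Mk (k + l)"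
proof -
  obtain a b where "qexp 0 a f" "qexp 0 b g" using assms Mk_qexp by metis
  from qexp_mult [OF this] have "qexp 0 (\<lambda>q. a q * b q) (\<lambda>z. f z * g z)" by simp
  from MkI [OF this, of "k + l"] show ?thesis
    using assms by (simp add: Mk_slash Mk_outside power_int_add jfac_nonzero)
qed

lemma Mk_one: "(\<lambda>z. if z \<in> Hp then 1 else 0) \<in> Mk 0"
  by (rule MkI [OF qexp_cong [OF qexp_const [of 1]]]) (auto simp: moeb_in_Hp)

lemma Mk_norm_S:
  assumes "f \<in> Mk k" "z \<in> Hp" shows "norm (f (- 1 / z)) = norm z powr of_int k * norm (f z)"
proof -
  have "z \<noteq> 0" using assms by (auto simp: Hp_def)
  then show ?thesis
    using Mk_slash [OF assms(1) Smat_in assms(2)] by (simp add: norm_mult norm_power_int powr_real_of_int')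
qed

context eta_modular
begin

text \<open>Without constant term the order is at least 1, which exceeds
  \<open>k / 12\<close>.\<close>

lemma Mk_lead_0:
  assumes f: "f \<in> Mk k" and g: "qexp 0 g f" "g 0 = 0" and k: "k < 12"
  shows "f = (\<lambda>z. 0)"
proof
  obtain g' where "qexp (0 + 1) g' f" using qexp_raise [OF g] .
  from order_gt_imp_zero [OF etaS this Mk_norm_S [OF f]] k
  show "f z = 0" for z by (cases "z \<in> Hp") (auto simp: Mk_outside [OF f])
qed

lemma Mk_neg: assumes f: "f \<in> Mk k" and k: "k < 0" shows "f = (\<lambda>z. 0)"
proof
  obtain g where "qexp 0 g f" using Mk_qexp [OF f] .
  from order_gt_imp_zero [OF etaS this Mk_norm_S [OF f]] k
  show "f z = 0" for z by (cases "z \<in> Hp") (auto simp: Mk_outside [OF f])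
qed

lemma Mk_unique:
  assumes "f \<in> Mk k" "h \<in> Mk k" "qexp 0 a f" "qexp 0 b h" "a 0 = b 0" "k < 12" shows "f = h"
proof -
  have "(\<lambda>z. f z - h z) = (\<lambda>z. 0)"
    using Mk_lead_0 [OF Mk_diff [OF assms(1,2)] qexp_diff [OF assms(3,4)]] assms by simp
  then show ?thesis by (simp add: fun_eq_iff)
qed

lemma Mk_proportional:
  assumes f: "f \<in> Mk k" and E: "E \<in> Mk k" "qexp 0 a E" "a 0 \<noteq> 0" and k: "k < 12"
  obtains c where "f = (\<lambda>z. c * E z)"
proof -
  obtain h where h: "qexp 0 h f" using Mk_qexp [OF f] .
  have "f = (\<lambda>z. h 0 / a 0 * E z)"
    by (rule Mk_unique [OF f Mk_cmult [OF E(1)] h qexp_cmult [OF E(2)]]) (use E(3) k in simp_all)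
  then show ?thesis by (rule that)
qed

lemma Mk_Dop: assumes f: "f \<in> Mk k" shows "Dop (of_int k) f \<in> Mk (k + 2)"
proof -
  obtain g where g: "qexp 0 g f" using Mk_qexp [OF f] .
  obtain g' where g': "qexp 0 g' (Dop (of_int k) f)" using qexp_Dop_lead [OF g] by metis
  show ?thesis
  proof (rule MkI [OF g'])
    fix \<gamma> z assume \<gamma>: "\<gamma> \<in> SL2Z" and z: "z \<in> Hp"
    have eq: "f (moeb \<gamma> z) = 1 * jfac \<gamma> z powr of_real (of_int k) * f z" if "z \<in> Hp" for z
      using Mk_slash [OF f \<gamma> that] powi_eq_powr [OF jfac_nonzero [OF \<gamma> that]] by simp
    have "Dgen (pslash \<gamma> Pfun) (of_int k) f z = Dgen Pfun (of_int k) f z"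
      using P_slash [OF \<gamma> z] by (simp add: Dgen_def)
    with Dgen_slash [OF \<gamma> Mk_hol [OF f] Mk_hol [OF f] z eq, of Pfun]
    show "Dop (of_int k) f (moeb \<gamma> z) = jfac \<gamma> z powi (k + 2) * Dop (of_int k) f z"
      using powi_eq_powr [OF jfac_nonzero [OF \<gamma> z], of "k + 2"] by (simp add: Dop_eq_Dgen)
  qed (simp add: Dop_def)
qed

text \<open>With a nonzero constant term, comparing constant terms in weight 4 gives Df = -f^2 / (6
  \<open>g 0\<close>), a Riccati equation. At the fixed point \<open>\<i>\<close> of S weight 2
  forces \<open>f \<i> = - f \<i>\<close>, and uniqueness gives f = 0.\<close>

lemma Mk_weight_2: assumes f: "f \<in> Mk 2" shows "f = (\<lambda>z. 0)"
proof -
  obtain g where g: "qexp 0 g f" using Mk_qexp [OF f] .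
  show ?thesis
  proof (cases "g 0 = 0")
    case True then show ?thesis using Mk_lead_0 [OF f g] by simp
  next
    case False
    obtain g' where g': "qexp 0 g' (Dop 2 f)" "g' 0 = (of_real 0 - of_real 2 / 12) * g 0"
      using qexp_Dop_lead [OF g, of 2] by metis
    define \<kappa> where "\<kappa> = 1 / (6 * g 0)"
    have D: "Dop 2 f \<in> Mk 4" using Mk_Dop [OF f] by simp
    have "(\<lambda>z. f z * f z) \<in> Mk 4" using Mk_mult [OF f f] by simp
    then have f2: "(\<lambda>z. - 1 / (6 * g 0) * (f z * f z)) \<in> Mk 4" by (rule Mk_cmult)
    have "Dop 2 f = (\<lambda>z. - 1 / (6 * g 0) * (f z * f z))"
      by (rule Mk_unique [OF D f2 g'(1) qexp_cmult [OF qexp_mult [OF g g, simplified]]])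
        (use False in \<open>simp_all add: g'(2)\<close>)
    then have e: "Dop 2 f z = - \<kappa> * (f z * f z)" for z by (simp add: \<kappa>_def)
    \<comment> \<open>The Riccati equation read as a linear one whose coefficient contains
      \<open>f\<close>.\<close>
    have f': "deriv f z = (- 2 * of_real pi * \<i> * (\<kappa> * f z + 2 * Pfun z)) * f z + 0 * f z" if "z \<in> Hp" for z
    proof -
      have "deriv f z / \<tau> = - \<kappa> * (f z * f z) - 2 * Pfun z * f z"
        using e [of z] that by (simp add: Dop_def add_eq_0_iff eq_diff_eq)
      then have "deriv f z = \<tau> * (- \<kappa> * (f z * f z) - 2 * Pfun z * f z)"
        by (subst (asm) divide_eq_eq) (simp add: mult.commute)
      also have "\<dots> = (- 2 * of_real pi * \<i> * (\<kappa> * f z + 2 * Pfun z)) * f z + 0 * f z"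
        by (simp add: algebra_simps)
      finally show ?thesis .
    qed
    have fi: "f \<i> = 0"
    proof -
      have "- 1 / \<i> = \<i>" by (simp add: divide_eq_eq)
      moreover have "\<i> powi 2 = - 1" by (simp add: power_int_def nat_numeral)
      ultimately have "f \<i> = - f \<i>" using Mk_slash [OF f Smat_in i_in_Hp] by (simp only: moeb_S jfac_S mult_minus1)
      then have "2 * f \<i> = 0" by (simp only: eq_neg_iff_add_eq_0 mult_2)
      then show ?thesis by simp
    qed
    have hol: "(\<lambda>z. - 2 * of_real pi * \<i> * (\<kappa> * f z + 2 * Pfun z)) holomorphic_on Hp"
      by (intro holomorphic_intros Mk_hol [OF f] Pfun_holomorphic)
    have "f z = 0" if "z \<in> Hp" for z
      by (rule ode_system_unique [OF Mk_hol [OF f] Mk_hol [OF f] hol holomorphic_on_const hol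
            holomorphic_on_const f' f' i_in_Hp fi fi that])
    then show ?thesis using Mk_outside [OF f] by (auto simp: fun_eq_iff)
  qed
qed

text \<open>By Ramanujan's identities these are the Eisenstein series up to scaling, with constant terms
  \<open>1/144\<close> and \<open>-1/432\<close>; taking them as definitions avoids Eisenstein sums.\<close>

definition E4 :: "complex \<Rightarrow> complex" where "E4 = Dop 1 Pfun"
definition E6 :: "complex \<Rightarrow> complex" where "E6 = Dop 4 E4"

lemma P_transform:
  assumes "(a, b, c, d) \<in> SL2Z" "z \<in> Hp"
  shows "Pfun (moeb (a, b, c, d) z) = (jfac (a, b, c, d) z)\<^sup>2 * Pfun z - of_int c * jfac (a, b, c, d) z / \<tau>"
proof -
  define j where "j = jfac (a, b, c, d) z"
  have "j \<noteq> 0" unfolding j_def by (rule jfac_nonzero [OF assms])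
  moreover have "Pfun (moeb (a, b, c, d) z) / j\<^sup>2 + of_int c / (\<tau> * j) = Pfun z"
    using P_slash [OF assms] unfolding pslash_def j_def by simp
  ultimately show ?thesis unfolding j_def [symmetric]
    by (simp add: field_simps power2_eq_square)
qed

text \<open>The anomalous terms in \<open>c\<close> and \<open>c^2\<close> cancel since P^2 enters
  with coefficient 1, half the weight of \<open>P\<close>; this is why \<open>E4\<close> uses
  \<open>Dop 1\<close>.\<close>

lemma E4_in: "E4 \<in> Mk 4" and E4_qexp: "\<exists>g. qexp 0 g E4 \<and> g 0 = 1/144"
proof -
  obtain g where g: "qexp 0 g E4" "g 0 = (of_real 0 - of_real 1 / 12) * pq 0"
    using qexp_Dop_lead [OF qexp_Pfun, of 1] unfolding E4_def by metis
  then show "\<exists>g. qexp 0 g E4 \<and> g 0 = 1/144" by (auto simp: pq_0)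
  show "E4 \<in> Mk 4"
  proof (rule MkI [OF g(1)])
    fix \<gamma> z assume \<gamma>: "\<gamma> \<in> SL2Z" and z: "z \<in> Hp"
    obtain a b c d where ab: "\<gamma> = (a, b, c, d)" by (cases \<gamma>)
    define j where "j = jfac \<gamma> z"
    have j0: "j \<noteq> 0" unfolding j_def by (rule jfac_nonzero [OF \<gamma> z])
    have gz: "moeb \<gamma> z \<in> Hp" by (rule moeb_in_Hp [OF \<gamma> z])
    have "((\<lambda>z. Pfun (moeb \<gamma> z)) has_field_derivative deriv Pfun (moeb \<gamma> z) * (1 / j\<^sup>2)) (at z)"
      unfolding j_def ab
      by (rule DERIV_chain2 [OF _ moeb_deriv]) (use holomorphic_derivI [OF Pfun_holomorphic open_Hp gz] \<gamma> z ab in auto)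
    then have 1: "((\<lambda>z. (jfac \<gamma> z)\<^sup>2 * Pfun z - of_int c * jfac \<gamma> z / \<tau>) has_field_derivative deriv Pfun (moeb \<gamma> z) * (1 / j\<^sup>2)) (at z)"
      by (rule has_field_derivative_transform_Hp) (use z P_transform \<gamma> ab in auto)
    have jd: "(jfac \<gamma> has_field_derivative of_int c) (at z)"
    proof -
      have "jfac \<gamma> = (\<lambda>z. of_int c * z + of_int d)" by (simp add: ab fun_eq_iff)
      then show ?thesis by (auto intro!: derivative_eq_intros)
    qed
    have "((\<lambda>z. (jfac \<gamma> z)\<^sup>2 * Pfun z - of_int c * jfac \<gamma> z / \<tau>) has_field_derivative
       (2 * j * of_int c * Pfun z + j\<^sup>2 * deriv Pfun z - of_int c * of_int c / \<tau>)) (at z)"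
      by (rule derivative_eq_intros jd holomorphic_derivI [OF Pfun_holomorphic open_Hp z] refl)+ (simp_all add: j_def)
    from DERIV_unique [OF 1 this]
    have P': "deriv Pfun (moeb \<gamma> z) = j\<^sup>2 * (2 * j * of_int c * Pfun z + j\<^sup>2 * deriv Pfun z - of_int c * of_int c / \<tau>)"
      using j0 by (simp add: field_simps)
    have PT: "Pfun (moeb \<gamma> z) = j\<^sup>2 * Pfun z - of_int c * j / \<tau>"
      using P_transform \<gamma> z unfolding ab j_def by blast
    define i0 where "i0 = 1 / \<tau>"
    have "E4 (moeb \<gamma> z) = i0 * (j\<^sup>2 * (2 * j * of_int c * Pfun z + j\<^sup>2 * deriv Pfun z - of_int c * of_int c * i0))
        + (j\<^sup>2 * Pfun z - of_int c * j * i0) * (j\<^sup>2 * Pfun z - of_int c * j * i0)"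
      using gz by (simp add: E4_def Dop_def P' PT i0_def)
    also have "\<dots> = j ^ 4 * (i0 * deriv Pfun z + Pfun z * Pfun z)" by algebra
    also have "\<dots> = j ^ 4 * E4 z" using z by (simp add: E4_def Dop_def i0_def)
    finally show "E4 (moeb \<gamma> z) = jfac \<gamma> z powi 4 * E4 z" by (simp add: j_def)
  qed (simp add: E4_def Dop_def)
qed

lemma E6_in: "E6 \<in> Mk 6" and E6_qexp: "\<exists>g. qexp 0 g E6 \<and> g 0 = - 1/432"
proof -
  show "E6 \<in> Mk 6" using Mk_Dop [OF E4_in] by (simp add: E6_def)
  obtain g where "qexp 0 g E4" "g 0 = 1/144" using E4_qexp by blast
  with qexp_Dop_lead [OF this(1), of 4] show "\<exists>g. qexp 0 g E6 \<and> g 0 = - 1/432"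
    unfolding E6_def by fastforce
qed

lemma E4_not_zero: "\<exists>z\<in>Hp. E4 z \<noteq> 0"
proof (rule ccontr)
  obtain g where g: "qexp 0 g E4" "g 0 = 1/144" using E4_qexp by blast
  assume "\<not> ?thesis"
  then show False using qexp_zero_iff [OF g(1)] g(2) by simp
qed

text \<open>In weight 8 the constant terms give D E6 = 24 E4^2 (1/864 on both sides). So
  \<open>E4\<close> and \<open>E6\<close> solve a linear system whose coefficients contain
  \<open>E4\<close>, and a common zero would annihilate \<open>E4\<close>.\<close>

lemma E4_E6_no_common_zero: assumes z: "z \<in> Hp" "E4 z = 0" shows "E6 z \<noteq> 0"
proof
  assume "E6 z = 0"
  obtain a where a: "qexp 0 a E4" "a 0 = 1/144" using E4_qexp by blast
  obtain b where b: "qexp 0 b E6" "b 0 = -1/432" using E6_qexp by blast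
  obtain c where c: "qexp 0 c (Dop 6 E6)" "c 0 = (of_real 0 - of_real 6 / 12) * b 0"
    using qexp_Dop_lead [OF b(1), of 6] by metis
  have D6: "Dop 6 E6 \<in> Mk 8" using Mk_Dop [OF E6_in] by simp
  have "Dop 6 E6 = (\<lambda>z. 24 * (E4 z * E4 z))"
    by (rule Mk_unique [OF D6 Mk_cmult [OF Mk_mult [OF E4_in E4_in, simplified]] c(1)
          qexp_cmult [OF qexp_mult [OF a(1) a(1), simplified]]]) (simp_all add: a(2) b(2) c(2))
  then have e: "Dop 6 E6 y = 24 * (E4 y * E4 y)" for y by simp
  have g': "deriv E6 y = (\<tau> * 24 * E4 y) * E4 y + (- 2 * of_real pi * \<i> * 6 * Pfun y) * E6 y" if "y \<in> Hp" for y
  proof -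
    have "deriv E6 y / \<tau> = 24 * (E4 y * E4 y) - 6 * Pfun y * E6 y"
      using e [of y] that by (simp add: Dop_def eq_diff_eq)
    then have "deriv E6 y = \<tau> * (24 * (E4 y * E4 y) - 6 * Pfun y * E6 y)"
      by (subst (asm) divide_eq_eq) (simp add: mult.commute)
    also have "\<dots> = (\<tau> * 24 * E4 y) * E4 y + (- 2 * of_real pi * \<i> * 6 * Pfun y) * E6 y"
      by (simp add: algebra_simps)
    finally show ?thesis .
  qed
  have f': "deriv E4 y = (- 2 * of_real pi * \<i> * 4 * Pfun y) * E4 y + \<tau> * E6 y" if "y \<in> Hp" for y
    using that by (simp add: E6_def Dop_def field_simps)
  have "E4 y = 0" if "y \<in> Hp" for y
    by (rule ode_system_unique [OF Mk_hol [OF E4_in] Mk_hol [OF E6_in] _ _ _ _ f' g' z(1,2) \<open>E6 z = 0\<close> that])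
      (intro holomorphic_intros Pfun_holomorphic Mk_hol [OF E4_in])+
  then show False using E4_not_zero by blast
qed

definition rho0 :: complex where "rho0 = Complex (- 1/2) (sqrt 3 / 2)"

lemma rho0_in: "rho0 \<in> Hp"
  by (simp add: rho0_def Hp_def)

text \<open>S sends \<open>rho0\<close> to \<open>rho0 + 1\<close>, so weight 4 and periodicity give
  \<open>E4 rho0 = rho0 ^ 4 * E4 rho0\<close>, where \<open>rho0 ^ 4 = rho0\<close>.\<close>

lemma E4_rho0: "E4 rho0 = 0"
proof -
  have 1: "- 1 / rho0 = rho0 + 1" and 2: "rho0 ^ 4 = rho0"
    by (simp_all add: rho0_def complex_eq_iff Re_divide Im_divide power4_eq_xxxx power2_eq_square field_simps)
  have "E4 (rho0 + 1) = E4 rho0" using Mk_slash [OF E4_in Tmat_in rho0_in] by simp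
  moreover have "E4 (- 1 / rho0) = rho0 ^ 4 * E4 rho0" using Mk_slash [OF E4_in Smat_in rho0_in] by simp
  ultimately have "(1 - rho0) * E4 rho0 = 0" unfolding 1 2 by (simp add: algebra_simps)
  moreover have "rho0 \<noteq> 1" by (simp add: rho0_def complex_eq_iff)
  ultimately show ?thesis by simp
qed

text \<open>The factors turn the constant terms of \<open>E4\<close> and \<open>E6\<close> into 1
  and -1, so that those of the cube and the square cancel. In classical normalisation this is E_4^3
  - E_6^2, that is 1728 times the discriminant.\<close>

definition Delta :: "complex \<Rightarrow> complex" where
  "Delta = (\<lambda>z. 144 ^ 3 * (E4 z * (E4 z * E4 z)) - 432\<^sup>2 * (E6 z * E6 z))"

lemma Delta_in: "Delta \<in> Mk 12"
  unfolding Delta_def using Mk_mult [OF E4_in Mk_mult [OF E4_in E4_in]] Mk_mult [OF E6_in E6_in]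
  by (intro Mk_diff Mk_cmult) simp_all

text \<open>Order 1 and weight 12 are the equality case of the order bound. The constant is nonzero
  because at \<open>rho0\<close> only the term in \<open>E6\<close> survives.\<close>

lemma Delta_etapow: "\<exists>C. C \<noteq> 0 \<and> (\<forall>z\<in>Hp. Delta z = C * etapow 12 z)"
proof -
  obtain a where a: "qexp 0 a E4" "a 0 = 1/144" using E4_qexp by blast
  obtain b where b: "qexp 0 b E6" "b 0 = -1/432" using E6_qexp by blast
  have "qexp 0 (\<lambda>q. 144 ^ 3 * (a q * (a q * a q)) - 432\<^sup>2 * (b q * b q)) Delta"
    unfolding Delta_def using qexp_mult [OF a(1) qexp_mult [OF a(1) a(1)]] qexp_mult [OF b(1) b(1)]
    by (intro qexp_diff qexp_cmult) simp_all
  then obtain g where g: "qexp (0 + 1) g Delta"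
    by (rule qexp_raise) (simp add: a(2) b(2) power2_eq_square power3_eq_cube)
  obtain C where C: "\<And>z. z \<in> Hp \<Longrightarrow> Delta z = C * etapow 12 z"
    by (rule order_eq_imp_etapow [OF etaS g Mk_norm_S [OF Delta_in]]) auto
  have "Delta rho0 \<noteq> 0"
    using E4_E6_no_common_zero [OF rho0_in E4_rho0] by (simp add: Delta_def E4_rho0)
  then show ?thesis using C rho0_in by force
qed

end

section \<open>Dimensions of spaces of scalar modular forms\<close>

lemma qexp_divide_etapow:
  assumes "qexp s g w" "\<And>z. z \<in> Hp \<Longrightarrow> W z = C * etapow K z" "C \<noteq> 0"
  obtains h where "qexp (s - K / 12) h (\<lambda>z. w z / W z)"
proof
  show "qexp (s - K / 12) (\<lambda>q. g q / (C * exp (2 * of_real K * leprod q))) (\<lambda>z. w z / W z)"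
    unfolding qexp_def
  proof (intro conjI ballI)
    show "(\<lambda>q. g q / (C * exp (2 * of_real K * leprod q))) holomorphic_on ball 0 1"
      using assms by (auto simp: qexp_def intro!: holomorphic_intros leprod)
    fix z assume z: "z \<in> Hp"
    have "qpow (of_real s) z = qpow (of_real (s - K / 12)) z * qpow (of_real (K / 12)) z"
      using qpow_add [of "of_real (s - K/12)" "of_real (K/12)" z] by simp
    then show "w z / W z = qpow (of_real (s - K / 12)) z * (g (qpow 1 z) / (C * exp (2 * of_real K * leprod (qpow 1 z))))"
      unfolding qexpD [OF assms(1) z] assms(2) [OF z] etapow_eq by simp
  qed
qed

text \<open>A basis as an indexed family, relative to an explicit scaling. One notion then serves
  the scalars, the scalar forms and the vector-valued forms; it becomes a statement about
  \<open>dim\<close> only in \<open>coords_imp_dim\<close>.\<close>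

definition coords :: "(complex \<Rightarrow> 'b \<Rightarrow> 'b::ab_group_add) \<Rightarrow> 'b set \<Rightarrow> nat \<Rightarrow> (nat \<Rightarrow> 'b) \<Rightarrow> bool" where
  "coords sc V n e \<longleftrightarrow>
     (0 \<in> V \<and> (\<forall>x\<in>V. \<forall>y\<in>V. x + y \<in> V) \<and> (\<forall>c. \<forall>x\<in>V. sc c x \<in> V)) \<and> (\<forall>i<n. e i \<in> V) \<and> (\<forall>v\<in>V. \<exists>c. v = (\<Sum>i<n. sc (c i) (e i))) \<and>
     (\<forall>c. (\<Sum>i<n. sc (c i) (e i)) = 0 \<longrightarrow> (\<forall>i<n. c i = 0))"

text \<open>\<open>T\<close> and \<open>U\<close> are typically multiplications by fixed forms.
  Being linear and jointly injective, they carry the two concatenated families to one for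
  \<open>W\<close>.\<close>

lemma coords_direct_sum:
  assumes e1: "coords sc1 V1 n1 e1" and e2: "coords sc2 V2 n2 e2"
    and T: "T 0 = 0" "\<And>x y. T (x + y) = T x + T y" "\<And>c x. T (sc1 c x) = sc c (T x)"
    and U: "U 0 = 0" "\<And>x y. U (x + y) = U x + U y" "\<And>c x. U (sc2 c x) = sc c (U x)"
    and W: "W = {T x + U y | x y. x \<in> V1 \<and> y \<in> V2}"
    and sc: "\<And>c x y. sc c (x + y) = sc c x + sc c y"
    and inj: "\<And>x y. x \<in> V1 \<Longrightarrow> y \<in> V2 \<Longrightarrow> T x + U y = 0 \<Longrightarrow> x = 0 \<and> y = 0"
  shows "\<exists>e. coords sc W (n1 + n2) e"
proof
  define e where "e = (\<lambda>i. if i < n1 then T (e1 i) else U (e2 (i - n1)))"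
  have V1: "0 \<in> V1" "\<And>x y. x \<in> V1 \<Longrightarrow> y \<in> V1 \<Longrightarrow> x + y \<in> V1" "\<And>c x. x \<in> V1 \<Longrightarrow> sc1 c x \<in> V1"
    and V2: "0 \<in> V2" "\<And>x y. x \<in> V2 \<Longrightarrow> y \<in> V2 \<Longrightarrow> x + y \<in> V2" "\<And>c x. x \<in> V2 \<Longrightarrow> sc2 c x \<in> V2"
    using e1 e2 unfolding coords_def by blast+
  have in1: "(\<Sum>i<n. sc1 (c i) (e1 i)) \<in> V1" if "n \<le> n1" for c n
    using that by (induction n) (use e1 in \<open>auto simp: coords_def intro!: V1\<close>)
  have in2: "(\<Sum>i<n. sc2 (c i) (e2 i)) \<in> V2" if "n \<le> n2" for c n
    using that by (induction n) (use e2 in \<open>auto simp: coords_def intro!: V2\<close>)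
  have Tsum: "T (\<Sum>i<n. sc1 (c i) (e1 i)) = (\<Sum>i<n. sc (c i) (T (e1 i)))" for c n
    by (induction n) (simp_all add: T)
  have Usum: "U (\<Sum>i<n. sc2 (c i) (e2 i)) = (\<Sum>i<n. sc (c i) (U (e2 i)))" for c n
    by (induction n) (simp_all add: U)
  have split: "(\<Sum>i<n1 + n2. sc (c i) (e i)) = T (\<Sum>i<n1. sc1 (c i) (e1 i)) + U (\<Sum>i<n2. sc2 (c (n1 + i)) (e2 i))" for c
  proof -
    have "(\<Sum>i<n1 + n2. sc (c i) (e i)) = (\<Sum>i<n1. sc (c i) (e i)) + (\<Sum>i<n2. sc (c (n1 + i)) (e (n1 + i)))"
      by (induction n2) (simp_all add: add.assoc)
    then show ?thesis unfolding Tsum Usum by (simp add: e_def)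
  qed
  show "coords sc W (n1 + n2) e"
    unfolding coords_def
  proof (intro conjI allI ballI impI)
    show "0 \<in> W" unfolding W using V1(1) V2(1) T(1) U(1) by force
    show "u + v \<in> W" if uv: "u \<in> W" "v \<in> W" for u v
    proof -
      obtain x y x' y' where *: "x \<in> V1" "y \<in> V2" "x' \<in> V1" "y' \<in> V2" "u = T x + U y" "v = T x' + U y'"
        using uv unfolding W by blast
      have "u + v = T (x + x') + U (y + y')" by (simp add: * T U algebra_simps)
      then show ?thesis unfolding W using V1(2) V2(2) * by blast
    qed
    show "sc c u \<in> W" if u: "u \<in> W" for c u
    proof -
      obtain x y where *: "x \<in> V1" "y \<in> V2" "u = T x + U y" using u unfolding W by blast
      have "sc c u = T (sc1 c x) + U (sc2 c y)" by (simp add: * T U sc)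
      then show ?thesis unfolding W using V1(3) V2(3) * by blast
    qed
  next
    fix i assume i: "i < n1 + n2"
    show "e i \<in> W"
    proof (cases "i < n1")
      case True
      then have "e1 i \<in> V1" using e1 by (simp add: coords_def)
      then show ?thesis unfolding W using True V2(1) U(1) by (force simp: e_def)
    next
      case False
      then have "e2 (i - n1) \<in> V2" using e2 i by (simp add: coords_def)
      then show ?thesis unfolding W using False V1(1) T(1) by (force simp: e_def)
    qed
  next
    fix v assume "v \<in> W"
    then obtain x y where xy: "x \<in> V1" "y \<in> V2" "v = T x + U y" unfolding W by blast
    obtain c1 where c1: "x = (\<Sum>i<n1. sc1 (c1 i) (e1 i))" using e1 xy(1) unfolding coords_def by blast
    obtain c2 where c2: "y = (\<Sum>i<n2. sc2 (c2 i) (e2 i))" using e2 xy(2) unfolding coords_def by blast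
    have "v = (\<Sum>i<n1 + n2. sc (if i < n1 then c1 i else c2 (i - n1)) (e i))"
      unfolding split xy(3) c1 c2 by simp
    then show "\<exists>c. v = (\<Sum>i<n1 + n2. sc (c i) (e i))"
      by (rule exI [of _ "\<lambda>i. if i < n1 then c1 i else c2 (i - n1)"])
  next
    fix c i assume 0: "(\<Sum>i<n1 + n2. sc (c i) (e i)) = 0" and i: "i < n1 + n2"
    from inj [OF in1 [OF order_refl, of c] in2 [OF order_refl, of "\<lambda>i. c (n1 + i)"]] 0
    have "(\<Sum>i<n1. sc1 (c i) (e1 i)) = 0" "(\<Sum>i<n2. sc2 (c (n1 + i)) (e2 i)) = 0"
      unfolding split by blast+
    moreover have "\<forall>c. (\<Sum>i<n1. sc1 (c i) (e1 i)) = 0 \<longrightarrow> (\<forall>i<n1. c i = 0)"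
      "\<forall>c. (\<Sum>i<n2. sc2 (c i) (e2 i)) = 0 \<longrightarrow> (\<forall>i<n2. c i = 0)"
      using e1 e2 unfolding coords_def by simp_all
    ultimately have l: "\<forall>i<n1. c i = 0" and u: "\<forall>i<n2. c (n1 + i) = 0"
      by (auto dest: spec [of _ c] spec [of _ "\<lambda>i. c (n1 + i)"])
    show "c i = 0"
    proof (cases "i < n1")
      case False
      with i have "i - n1 < n2" "n1 + (i - n1) = i" by auto
      with u show ?thesis by metis
    qed (use l in simp)
  qed
qed

lemma coords_imp_dim:
  assumes vs: "vector_space sc" and e: "coords sc V n e"
  shows "vector_space.dim sc V = n"
proof -
  interpret vector_space sc by (rule vs)
  have inV: "\<And>i. i < n \<Longrightarrow> e i \<in> V" and ex: "\<And>v. v \<in> V \<Longrightarrow> \<exists>c. v = (\<Sum>i<n. sc (c i) (e i))"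
    and ind: "\<And>c i. (\<Sum>i<n. sc (c i) (e i)) = 0 \<Longrightarrow> i < n \<Longrightarrow> c i = 0"
    using e unfolding coords_def by blast+
  have inj: "inj_on e {..<n}"
  proof (rule inj_onI, rule ccontr)
    fix i j assume ij: "i \<in> {..<n}" "j \<in> {..<n}" "e i = e j" "i \<noteq> j"
    define c :: "nat \<Rightarrow> complex" where "c = (\<lambda>l. if l = i then 1 else if l = j then -1 else 0)"
    have "(\<Sum>l<n. sc (c l) (e l)) = (\<Sum>l\<in>{i, j}. sc (c l) (e l))"
      using ij by (intro sum.mono_neutral_right) (auto simp: c_def)
    also have "\<dots> = 0" using ij by (simp add: c_def)
    finally have "c i = 0" using ind ij(1) by blast
    then show False by (simp add: c_def)
  qed
  show ?thesis
  proof (rule dim_unique)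
    show "e ` {..<n} \<subseteq> V" using inV by auto
    show "V \<subseteq> span (e ` {..<n})"
    proof
      fix v assume "v \<in> V"
      then obtain c where v: "v = (\<Sum>i<n. sc (c i) (e i))" using ex by blast
      show "v \<in> span (e ` {..<n})" unfolding v by (intro span_sum span_scale span_base imageI)
    qed
    show "card (e ` {..<n}) = n" using inj by (simp add: card_image)
    show "independent (e ` {..<n})"
    proof
      assume "dependent (e ` {..<n})"
      then obtain u v where u: "v \<in> e ` {..<n}" "u v \<noteq> 0" "(\<Sum>v\<in>e ` {..<n}. sc (u v) v) = 0"
        by (subst (asm) dependent_finite) auto
      from u(3) have "(\<Sum>i<n. sc (u (e i)) (e i)) = 0"
        by (simp add: sum.reindex [OF inj] o_def)
      from ind [OF this] u(1,2) show False by auto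
    qed
  qed
qed

text \<open>The dimension in weight \<open>2 * j\<close>; residue 1 modulo 6 corresponds to weights
  congruent to 2 modulo 12, where there is one form fewer.\<close>

definition mdim :: "int \<Rightarrow> nat" where
  "mdim j = (if j < 0 then 0 else if j mod 6 = 1 then nat (j div 6) else nat (j div 6) + 1)"

abbreviation (input) sscale :: "complex \<Rightarrow> (complex \<Rightarrow> complex) \<Rightarrow> complex \<Rightarrow> complex" where
  "sscale c f \<equiv> \<lambda>z. c * f z"

lemma Mk_subspace: "0 \<in> Mk k" "f \<in> Mk k \<Longrightarrow> g \<in> Mk k \<Longrightarrow> f + g \<in> Mk k" "f \<in> Mk k \<Longrightarrow> sscale c f \<in> Mk k"
  using Mk_zero [of k] Mk_add [of f k g] Mk_cmult [of f k c] by (simp_all add: zero_fun_def plus_fun_def)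

context eta_modular
begin

text \<open>Multiplication by \<open>E4\<close> reaches every weight from 0, 4 and 6; for
  \<open>j >= 4\<close> the step back by 2 avoids the excluded index 1.\<close>

lemma Mk_exists_lead:
  assumes "j \<noteq> 1" shows "\<exists>E\<in>Mk (2 * int j). \<exists>g. qexp 0 g E \<and> g 0 \<noteq> 0"
  using assms
proof (induction j rule: less_induct)
  case (less j)
  obtain a where a: "qexp 0 a E4" "a 0 = 1/144" using E4_qexp by blast
  obtain b where b: "qexp 0 b E6" "b 0 = -1/432" using E6_qexp by blast
  consider "j = 0" | "j = 2" | "j = 3" | "j \<ge> 4" using less.prems by linarith
  then show ?case
  proof cases
    case 1
    have "qexp 0 (\<lambda>q. 1) (\<lambda>z. if z \<in> Hp then 1 else 0)" by (rule qexp_cong [OF qexp_const]) simp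
    then show ?thesis using Mk_one 1 by (intro bexI [of _ "\<lambda>z. if z \<in> Hp then 1 else 0"] exI [of _ "\<lambda>q. 1"]) auto
  next
    case 2 then show ?thesis using a E4_in by (intro bexI [of _ E4] exI [of _ a]) auto
  next
    case 3 then show ?thesis using b E6_in by (intro bexI [of _ E6] exI [of _ b]) auto
  next
    case 4
    then have "j - 2 < j" "j - 2 \<noteq> 1" by auto
    then obtain E g where E: "E \<in> Mk (2 * int (j - 2))" "qexp 0 g E" "g 0 \<noteq> 0"
      using less.IH [of "j - 2"] by blast
    have "(\<lambda>z. E4 z * E z) \<in> Mk (2 * int j)"
      using Mk_mult [OF E4_in E(1)] 4 by (simp add: of_nat_diff)
    moreover have "qexp 0 (\<lambda>q. a q * g q) (\<lambda>z. E4 z * E z)" using qexp_mult [OF a(1) E(2)] by simp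
    ultimately show ?thesis using a(2) E(3) by (intro bexI [of _ "\<lambda>z. E4 z * E z"] exI [of _ "\<lambda>q. a q * g q"]) auto
  qed
qed

lemma Mk_lead_eq:
  assumes "qexp 0 g E" "g 0 \<noteq> 0" "qexp 0 h (\<lambda>z. c * E z)" "h 0 = 0" shows "c = 0"
proof -
  have "h 0 = c * g 0" by (rule qexp_unique [OF assms(3) qexp_cmult [OF assms(1)]]) simp
  then show ?thesis using assms by simp
qed

lemma Mk_dim_small:
  assumes "j < 6" shows "\<exists>e. coords sscale (Mk (2 * int j)) (mdim (int j)) e"
proof (cases "j = 1")
  case True
  have "\<forall>f\<in>Mk 2. f = 0" using Mk_weight_2 by (auto simp: zero_fun_def)
  then show ?thesis using True Mk_subspace by (auto simp: coords_def mdim_def zero_fun_def)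
next
  case False
  then obtain E g where E: "E \<in> Mk (2 * int j)" "qexp 0 g E" "g 0 \<noteq> 0" using Mk_exists_lead by blast
  have "int j mod 6 = int j" "int j div 6 = 0" using assms by auto
  then have m: "mdim (int j) = 1" using False by (simp add: mdim_def)
  have "coords sscale (Mk (2 * int j)) 1 (\<lambda>_. E)"
    unfolding coords_def
  proof (intro conjI allI ballI impI)
    fix f assume f: "f \<in> Mk (2 * int j)"
    obtain c where "f = (\<lambda>z. c * E z)" using Mk_proportional [OF f E] assms by auto
    then show "\<exists>c :: nat \<Rightarrow> complex. f = (\<Sum>i<1. sscale (c i) E)"
      by (intro exI [of _ "\<lambda>_. c"]) simp
  next
    fix c :: "nat \<Rightarrow> complex" and i :: nat assume 0: "(\<Sum>i<1. sscale (c i) E) = 0" and "i < 1"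
    have "(\<lambda>z. c 0 * E z) = (\<lambda>z. 0)" using 0 by (simp add: zero_fun_def)
    then have "qexp 0 (\<lambda>q. 0) (\<lambda>z. c 0 * E z)" using qexp_zero by simp
    then show "c i = 0" using Mk_lead_eq [OF E(2,3)] \<open>i < 1\<close> by simp
  qed (use E in \<open>auto intro: Mk_subspace\<close>)
  then show ?thesis using m by auto
qed

lemma Delta_nonzero: "z \<in> Hp \<Longrightarrow> Delta z \<noteq> 0"
  using Delta_etapow by auto

text \<open>\<open>Delta\<close> has no zero on \<open>Hp\<close> and order 1 at the cusp, so
  division by it keeps the quotient holomorphic at both.\<close>

lemma Mk_12_decomp:
  assumes f: "f \<in> Mk (k + 12)" and g: "qexp 0 g f" "g 0 = 0"
  shows "\<exists>h\<in>Mk k. f = (\<lambda>z. Delta z * h z)"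
proof
  obtain C where C: "C \<noteq> 0" "\<And>z. z \<in> Hp \<Longrightarrow> Delta z = C * etapow 12 z" using Delta_etapow by blast
  obtain g' where "qexp (0 + 1) g' f" using qexp_raise [OF g] .
  from qexp_divide_etapow [OF this C(2) C(1)] obtain h where "qexp (0 + 1 - 12 / 12) h (\<lambda>z. f z / Delta z)" .
  then have h: "qexp 0 h (\<lambda>z. f z / Delta z)" by simp
  show "(\<lambda>z. f z / Delta z) \<in> Mk k"
  proof (rule MkI [OF h])
    fix \<gamma> z assume \<gamma>: "\<gamma> \<in> SL2Z" and z: "z \<in> Hp"
    show "f (moeb \<gamma> z) / Delta (moeb \<gamma> z) = jfac \<gamma> z powi k * (f z / Delta z)"
      using jfac_nonzero [OF \<gamma> z] by (simp add: Mk_slash [OF f \<gamma> z] Mk_slash [OF Delta_in \<gamma> z] power_int_add)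
  qed (simp add: Mk_outside [OF f])
  show "f = (\<lambda>z. Delta z * (f z / Delta z))"
  proof
    fix z show "f z = Delta z * (f z / Delta z)"
      by (cases "z \<in> Hp") (simp_all add: Delta_nonzero Mk_outside [OF f])
  qed
qed

text \<open>Weight \<open>2 * j\<close> is the sum of a line, spanned by a form with nonzero
  constant term, and \<open>Delta\<close> times weight \<open>2 * j - 12\<close>;
  \<open>mdim\<close> obeys the same recursion.\<close>

lemma Mk_dim_nat: "\<exists>e. coords sscale (Mk (2 * int j)) (mdim (int j)) e"
proof (induction j rule: less_induct)
  case (less j)
  show ?case
  proof (cases "j < 6")
    case True then show ?thesis by (rule Mk_dim_small)
  next
    case False
    define l where "l = j - 6"
    have j: "j = l + 6" using False by (simp add: l_def)
    have w: "2 * int j = 2 * int l + 12" by (simp add: j)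
    from less.IH [of l] obtain e where e: "coords sscale (Mk (2 * int l)) (mdim (int l)) e" using j by auto
    have "j \<noteq> 1" using False by simp
    then obtain E g where E: "E \<in> Mk (2 * int j)" "qexp 0 g E" "g 0 \<noteq> 0" using Mk_exists_lead by blast
    have line: "coords (*) (UNIV :: complex set) 1 (\<lambda>_. 1)"
      unfolding coords_def
    proof (intro conjI ballI)
      show "\<exists>c :: nat \<Rightarrow> complex. v = (\<Sum>i<1. c i * 1)" for v :: complex by (rule exI [of _ "\<lambda>_. v"]) simp
    qed auto
    have "\<exists>e. coords sscale (Mk (2 * int j)) (1 + mdim (int l)) e"
    proof (rule coords_direct_sum [OF line e, where T = "\<lambda>c z. c * E z" and U = "\<lambda>f z. Delta z * f z"])
      show "Mk (2 * int j) = {(\<lambda>z. x * E z) + (\<lambda>z. Delta z * y z) |x y. x \<in> UNIV \<and> y \<in> Mk (2 * int l)}"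
      proof (intro equalityI subsetI)
        fix f assume f: "f \<in> Mk (2 * int j)"
        obtain h where h: "qexp 0 h f" using Mk_qexp [OF f] .
        define c where "c = h 0 / g 0"
        have "(\<lambda>z. f z - c * E z) \<in> Mk (2 * int l + 12)"
          unfolding w [symmetric] by (intro Mk_diff f Mk_cmult E)
        from Mk_12_decomp [OF this qexp_diff [OF h qexp_cmult [OF E(2)]]] E(3)
        obtain y where y: "y \<in> Mk (2 * int l)" "(\<lambda>z. f z - c * E z) = (\<lambda>z. Delta z * y z)"
          by (auto simp: c_def)
        have "f z = c * E z + Delta z * y z" for z using fun_cong [OF y(2), of z] by (simp add: algebra_simps)
        then have "f = (\<lambda>z. c * E z) + (\<lambda>z. Delta z * y z)" by (simp add: plus_fun_def fun_eq_iff)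
        with y(1) show "f \<in> {(\<lambda>z. x * E z) + (\<lambda>z. Delta z * y z) |x y. x \<in> UNIV \<and> y \<in> Mk (2 * int l)}" by blast
      next
        fix f assume "f \<in> {(\<lambda>z. x * E z) + (\<lambda>z. Delta z * y z) |x y. x \<in> UNIV \<and> y \<in> Mk (2 * int l)}"
        then obtain x y where f: "f = (\<lambda>z. x * E z) + (\<lambda>z. Delta z * y z)" and y: "y \<in> Mk (2 * int l)" by blast
        have "(\<lambda>z. Delta z * y z) \<in> Mk (2 * int j)" using Mk_mult [OF Delta_in y] by (simp add: w add.commute)
        then show "f \<in> Mk (2 * int j)" unfolding f using E by (intro Mk_subspace)
      qed
      fix x y assume y: "y \<in> Mk (2 * int l)" and 0: "(\<lambda>z. x * E z) + (\<lambda>z. Delta z * y z) = 0"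
      obtain C where C: "C \<noteq> 0" "\<And>z. z \<in> Hp \<Longrightarrow> Delta z = C * etapow 12 z" using Delta_etapow by blast
      obtain h where "qexp 0 h y" using Mk_qexp [OF y] .
      from qexp_mult [OF qexp_cmult [OF qexp_etapow [of 12], of "- C"] this]
      have "qexp (0 + of_nat 1) (\<lambda>q. - C * exp (2 * of_real 12 * leprod q) * h q) (\<lambda>z. - C * etapow 12 z * y z)" by simp
      from qexp_lower [OF this]
      \<comment> \<open>The factor \<open>q ^ 1\<close> shows that \<open>Delta z * y z\<close> has
        no constant term, which forces \<open>x = 0\<close>.\<close>
      have h': "qexp 0 (\<lambda>q. q ^ 1 * (- C * exp (2 * of_real 12 * leprod q) * h q)) (\<lambda>z. - C * etapow 12 z * y z)" .
      have xE: "x * E z = - (Delta z * y z)" for z using fun_cong [OF 0, of z] by (simp add: add_eq_0_iff)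
      have "qexp 0 (\<lambda>q. q ^ 1 * (- C * exp (2 * of_real 12 * leprod q) * h q)) (\<lambda>z. x * E z)"
        by (rule qexp_cong [OF h']) (simp add: xE C)
      from Mk_lead_eq [OF E(2,3) this] have x: "x = 0" by simp
      have "y z = 0" for z
        using xE [of z] Delta_nonzero [of z] Mk_outside [OF y, of z] x by (cases "z \<in> Hp") auto
      then have y0: "y = 0" by (simp add: fun_eq_iff)
      show "x = 0 \<and> y = 0" using x y0 by simp
    qed (simp_all add: zero_fun_def plus_fun_def algebra_simps)
    moreover have "mdim (int j) = 1 + mdim (int l)" by (simp add: mdim_def nat_add_distrib j)
    ultimately show ?thesis by simp
  qed
qed

lemma Mk_dim: "\<exists>e. coords sscale (Mk (2 * j)) (mdim j) e"
proof (cases "j < 0")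
  case True
  then have "\<forall>f\<in>Mk (2 * j). f = 0" using Mk_neg [of _ "2 * j"] by (auto simp: zero_fun_def)
  then show ?thesis using True Mk_subspace by (auto simp: coords_def mdim_def zero_fun_def)
next
  case False
  then show ?thesis using Mk_dim_nat [of "nat j"] by simp
qed

end

section \<open>The representation attached to a fourth order MLDE\<close>

text \<open>The MLDE enters as a pointwise linear relation that involves no third derivative; this
  is what Abel's identity uses.\<close>

locale mlde_form =
  fixes \<rho> :: "sl2 \<Rightarrow> complex^4^4" and \<upsilon> :: "sl2 \<Rightarrow> complex" and k :: real and lam :: "4 \<Rightarrow> real"
    and i :: 4 and F :: "complex \<Rightarrow> complex^4" and g :: "4 \<Rightarrow> complex \<Rightarrow> complex"
  assumes unit: "\<gamma> \<in> SL2Z \<Longrightarrow> norm (\<upsilon> \<gamma>) = 1"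
    and lam_nonneg: "0 \<le> lam j" and lam_less_1: "lam j < 1" and lam_inj: "inj lam"
    and k_eq: "k = 3 * (\<Sum>j\<in>UNIV. lam j)"
    and F_form: "vform k \<rho> \<upsilon> F"
    and F_qexp: "qexp (lam j + (if j = i then 1 else 0)) (g j) (\<lambda>z. F z $ j)" and F_lead: "g j 0 = 1"
    and F_ode: "z \<in> Hp \<Longrightarrow> \<exists>x y w. DopV (k + 6) (DopV (k + 4) (DopV (k + 2) (DopV k F))) z =
       x *s DopV (k + 2) (DopV k F) z + y *s DopV k F z + w *s F z"
begin

definition "\<Lambda> = (\<Sum>j\<in>UNIV. lam j)"
definition "\<mu> = (\<lambda>j. lam j + (if j = i then 1 else 0))"

lemma sum_\<mu>: "(\<Sum>j\<in>UNIV. \<mu> j) = \<Lambda> + 1"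
  by (simp add: \<mu>_def \<Lambda>_def sum.distrib)

text \<open>The \<open>lam j\<close> are distinct modulo the integers. This serves for
  \<open>F\<close> and also for \<open>G\<close>, whose exponents are at first known only up to
  integer shifts.\<close>

lemma inj_add_nat:
  fixes n :: "4 \<Rightarrow> nat" shows "inj (\<lambda>j. lam j + real (n j))"
proof (rule injI)
  fix a b assume eq: "lam a + real (n a) = lam b + real (n b)"
  have "\<bar>real_of_int (int (n a) - int (n b))\<bar> < 1"
    using eq lam_nonneg [of a] lam_nonneg [of b] lam_less_1 [of a] lam_less_1 [of b] by simp
  then have "n a = n b" by linarith
  with eq have "lam a = lam b" by simp
  then show "a = b" using lam_inj by (simp add: inj_eq)
qed

lemma inj_\<mu>: "inj \<mu>"
  using inj_add_nat [of "\<lambda>j. if j = i then 1 else 0"] by (simp add: \<mu>_def if_distrib cong: if_cong)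

lemma F_hol: "(\<lambda>z. F z $ j) holomorphic_on Hp"
  using F_form by (simp add: vform_def)

lemma \<Lambda>_nonneg: "0 \<le> \<Lambda>"
  unfolding \<Lambda>_def by (intro sum_nonneg) (rule lam_nonneg)

lemma k_\<Lambda>: "k = 3 * \<Lambda>"
  by (simp add: k_eq \<Lambda>_def)

lemma wronskian_F: "\<exists>C. C \<noteq> 0 \<and> (\<forall>z\<in>Hp. wronskian Pfun k F z = C * etapow (12 * \<Lambda> + 12) z)"
proof -
  obtain C where C: "\<And>z. z \<in> Hp \<Longrightarrow> wronskian Pfun k F z = C * etapow (4 * k + 12) z"
    using wronskian_ode_imp_etapow [OF F_hol F_ode] by blast
  obtain h where h: "qexp (\<Sum>j\<in>UNIV. \<mu> j) h (wronskian Pfun k F)"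
    "(\<And>j. g j 0 \<noteq> 0) \<Longrightarrow> inj \<mu> \<Longrightarrow> h 0 \<noteq> 0"
    using qexp_wronskian [of \<mu> g F k] F_qexp unfolding \<mu>_def by blast
  have "h 0 \<noteq> 0" using h(2) inj_\<mu> F_lead by simp
  have "C \<noteq> 0"
  proof
    assume "C = 0"
    then have "h 0 = 0" using qexp_zero_iff [OF h(1)] C by simp
    with \<open>h 0 \<noteq> 0\<close> show False by simp
  qed
  moreover have "4 * k + 12 = 12 * \<Lambda> + 12" by (simp add: k_\<Lambda>)
  ultimately show ?thesis using C by auto
qed

lemma eta_modular: "eta_modular" and coldet_S: "norm (coldet (\<rho> Smat)) = 1"
proof -
  obtain C where C: "C \<noteq> 0" "\<And>z. z \<in> Hp \<Longrightarrow> wronskian Pfun k F z = C * etapow (4 * k + 12) z"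
    using wronskian_F unfolding k_\<Lambda> by auto
  have "4 * k + 12 > 0" using \<Lambda>_nonneg by (simp add: k_\<Lambda>)
  from wronskian_imp_eta_modular [OF F_form unit C(2) C(1) this]
  show "eta_modular" "norm (coldet (\<rho> Smat)) = 1" by auto
qed

sublocale eta_modular by (rule eta_modular)

lemma vform_D: "vform l \<rho> \<upsilon> H \<Longrightarrow> vform (l + 2) \<rho> \<upsilon> (DopV l H)"
  using vform_DopV P_slash by blast

lemma vform_hol: "vform l \<rho> \<upsilon> H \<Longrightarrow> (\<lambda>z. H z $ j) holomorphic_on Hp"
  by (simp add: vform_def)

lemma det4_vform_slash:
  assumes "vform ka \<rho> \<upsilon> A" "vform kb \<rho> \<upsilon> B" "vform kc \<rho> \<upsilon> C" "vform kd \<rho> \<upsilon> D"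
    and "\<gamma> \<in> SL2Z" "z \<in> Hp"
  shows "det4 (A (moeb \<gamma> z)) (B (moeb \<gamma> z)) (C (moeb \<gamma> z)) (D (moeb \<gamma> z))
    = \<upsilon> \<gamma> ^ 4 * coldet (\<rho> \<gamma>) * jfac \<gamma> z powr of_real (ka + kb + kc + kd) * det4 (A z) (B z) (C z) (D z)"
  using assms by (intro det4_slash jfac_nonzero) (simp_all add: vform_def)

lemma det4_vform_S:
  assumes "vform ka \<rho> \<upsilon> A" "vform kb \<rho> \<upsilon> B" "vform kc \<rho> \<upsilon> C" "vform kd \<rho> \<upsilon> D" "z \<in> Hp"
  shows "norm (det4 (A (- 1 / z)) (B (- 1 / z)) (C (- 1 / z)) (D (- 1 / z)))
    = norm z powr (ka + kb + kc + kd) * norm (det4 (A z) (B z) (C z) (D z))"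
  using det4_vform_slash [OF assms(1-4) Smat_in assms(5)] coldet_S unit [OF Smat_in]
  by (simp add: norm_mult norm_power norm_powr_real_powr' flip: of_real_add)

text \<open>Turns the order bound into algebra: the determinant vanishes identically, and with it
  the determinant of the leading coefficients.\<close>

lemma det4_lead_zero:
  assumes "vform ka \<rho> \<upsilon> A" "vform kb \<rho> \<upsilon> B" "vform kc \<rho> \<upsilon> C" "vform kd \<rho> \<upsilon> D"
    and "\<And>j. qexp (\<nu> j) (a j) (\<lambda>z. A z $ j)" "\<And>j. qexp (\<nu> j) (b j) (\<lambda>z. B z $ j)"
      "\<And>j. qexp (\<nu> j) (c j) (\<lambda>z. C z $ j)" "\<And>j. qexp (\<nu> j) (d j) (\<lambda>z. D z $ j)"
    and "(\<Sum>j\<in>UNIV. \<nu> j) > (ka + kb + kc + kd) / 12"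
  shows "det4 (\<chi> j. a j 0) (\<chi> j. b j 0) (\<chi> j. c j 0) (\<chi> j. d j 0) = 0"
  by (rule qexp_zero_iff [OF qexp_det4 [OF assms(5-8)]],
      rule order_gt_imp_zero [OF etaS qexp_det4 [OF assms(5-8)] det4_vform_S [OF assms(1-4)] assms(9)])

text \<open>Let \<open>R\<close> be the difference of the two sides. The expansions show that
  \<open>R\<close> kills \<open>F\<close>, hence all derivatives of \<open>F\<close>, and these span
  the space at \<open>\<i>\<close> because the Wronskian is nonzero there.\<close>

lemma rho_T: "\<rho> Tmat = (\<chi> a b. if a = b then inverse (\<upsilon> Tmat) * ee (lam a) else 0)"
proof -
  define u where "u = \<upsilon> Tmat"
  have u0: "u \<noteq> 0" using unit [OF Tmat_in] by (auto simp: u_def)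
  define R where "R = \<rho> Tmat - (\<chi> a b. if a = b then inverse u * ee (lam a) else 0)"
  have F0: "R *v F z = 0" if z: "z \<in> Hp" for z
  proof -
    have "F (moeb Tmat z) = (\<upsilon> Tmat * jfac Tmat z powr of_real k) *s (\<rho> Tmat *v F z)"
      using F_form z Tmat_in unfolding vform_def by blast
    then have "F (z + 1) = u *s (\<rho> Tmat *v F z)" by (simp add: u_def)
    moreover have "F (z + 1) $ j = ee (lam j) * F z $ j" for j
    proof -
      have "ee (lam j + 1) = ee (lam j)" by (simp add: ee_def exp_add ring_distribs)
      then show ?thesis using qexp_shift [OF F_qexp z, of j] by (auto split: if_splits)
    qed
    ultimately have "u * (\<rho> Tmat *v F z) $ j = ee (lam j) * F z $ j" for j
      by (metis vector_smult_component)
    then have "(\<rho> Tmat *v F z) $ j = inverse u * (ee (lam j) * F z $ j)" for j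
      using u0 by (simp add: field_simps)
    then show ?thesis
      by (simp add: R_def matrix_vector_mult_diff_rdistrib diagonal_mult vec_eq_iff mult.assoc)
  qed
  have step: "R *v DgenV Pfun l H z = 0"
    if "\<And>j. (\<lambda>z. H z $ j) holomorphic_on Hp" "\<And>z. z \<in> Hp \<Longrightarrow> R *v H z = 0" "z \<in> Hp" for l H z
  proof -
    have "(R *v DgenV Pfun l H z) $ j = 0" for j
    proof -
      have "Dgen Pfun l (\<lambda>z. (R *v H z) $ j) z = Dgen Pfun l (\<lambda>z. 0) z"
        by (rule fun_cong [OF Dgen_cong]) (simp_all add: that)
      moreover have "Dgen Pfun l (\<lambda>z. 0) z = 0" by (simp add: Dgen_def)
      ultimately show ?thesis using Dgen_linear_comb [OF that(1,3), of Pfun l R j] by simp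
    qed
    then show ?thesis by (simp add: vec_eq_iff)
  qed
  note h1 = Dgen_holomorphic [OF F_hol Pfun_holomorphic]
  note h2 = Dgen_holomorphic [OF h1 Pfun_holomorphic]
  have F1: "R *v DgenV Pfun k F z = 0" if "z \<in> Hp" for z by (rule step [OF F_hol F0 that])
  have F2: "R *v DgenV Pfun (k + 2) (DgenV Pfun k F) z = 0" if "z \<in> Hp" for z
    by (rule step [OF _ F1 that]) (simp add: h1)
  have F3: "R *v DgenV Pfun (k + 4) (DgenV Pfun (k + 2) (DgenV Pfun k F)) z = 0" if "z \<in> Hp" for z
    by (rule step [OF _ F2 that]) (simp add: h2)
  let ?a = "F \<i>" and ?b = "DgenV Pfun k F \<i>" and ?c = "DgenV Pfun (k + 2) (DgenV Pfun k F) \<i>"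
    and ?d = "DgenV Pfun (k + 4) (DgenV Pfun (k + 2) (DgenV Pfun k F)) \<i>"
  have nz: "det4 ?a ?b ?c ?d \<noteq> 0"
    using wronskian_F i_in_Hp unfolding wronskian_def by force
  have "R *v v = 0" for v
  proof -
    have "R *v (det4 ?a ?b ?c ?d *s v) = 0"
      unfolding det4_cramer [of ?a ?b ?c ?d v]
      by (simp add: matrix_vector_right_distrib vector_scalar_commute F0 F1 F2 F3 i_in_Hp)
    then show ?thesis using nz by (simp add: vector_scalar_commute)
  qed
  then have "R = 0" by (metis matrix_vector_mult_0 matrix_eq)
  then have "\<rho> Tmat = (\<chi> a b. if a = b then inverse u * ee (lam a) else 0)" by (simp add: R_def)
  then show ?thesis unfolding u_def .
qed

lemma ee_eq_iff: "ee x = ee y \<Longrightarrow> x - y \<in> \<int>"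
proof -
  assume "ee x = ee y"
  then obtain n :: int where "\<tau> * of_real x = \<tau> * of_real y + of_int (2 * n) * (of_real pi * \<i>)"
    unfolding ee_def exp_eq by auto
  then have "\<tau> * of_real x = \<tau> * of_real (y + of_int n)"
    by (simp add: algebra_simps)
  then have "x = y + of_int n" by (subst (asm) mult_cancel_left) (simp only: of_real_eq_iff, simp)
  then show ?thesis by simp
qed

lemma ee_lam_inj: assumes "ee (lam a) = ee (lam b)" shows "a = b"
proof -
  obtain n where "lam a - lam b = of_int n" using ee_eq_iff [OF assms] by (auto elim: Ints_cases)
  moreover have "\<bar>lam a - lam b\<bar> < 1"
    using lam_nonneg [of a] lam_nonneg [of b] lam_less_1 [of a] lam_less_1 [of b] by simp
  ultimately have "\<bar>real_of_int n\<bar> < 1" by simp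
  then have "n = 0" by linarith
  then have "lam a = lam b" using \<open>lam a - lam b = of_int n\<close> by simp
  then show ?thesis using lam_inj by (simp add: inj_eq)
qed

lemma eigvals_rho_T: "eigvals (\<rho> Tmat) = (\<lambda>j. inverse (\<upsilon> Tmat) * ee (lam j)) ` UNIV"
proof -
  define t where "t = (\<lambda>j. inverse (\<upsilon> Tmat) * ee (lam j))"
  have dv: "\<rho> Tmat *v v = (\<chi> a. t a * v $ a)" for v
    by (simp add: rho_T t_def diagonal_mult)
  show ?thesis
    unfolding t_def [symmetric]
  proof (intro equalityI subsetI)
    fix m assume "m \<in> eigvals (\<rho> Tmat)"
    then obtain v where v: "v \<noteq> 0" "\<rho> Tmat *v v = m *s v" by (auto simp: eigvals_def)
    obtain a where "v $ a \<noteq> 0" using v(1) by (auto simp: vec_eq_iff)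
    moreover have "t a * v $ a = m * v $ a" using v(2) unfolding dv by (simp add: vec_eq_iff)
    ultimately show "m \<in> t ` UNIV" by auto
  next
    fix m assume "m \<in> t ` UNIV"
    then obtain a where m: "m = t a" by blast
    have "\<rho> Tmat *v axis a 1 = m *s axis a 1" unfolding dv by (simp add: vec_eq_iff axis_def m)
    moreover have "axis a (1::complex) \<noteq> 0" by simp
    ultimately show "m \<in> eigvals (\<rho> Tmat)" unfolding eigvals_def by blast
  qed
qed

section \<open>Algebraic conditions on a diagonal projection\<close>

lemma det4_segre:
  "det4 (\<chi> j. 1) (\<chi> j. a j) (\<chi> j. x j) (\<chi> j. x j * a j) =
     (a 1 - a 2) * (a 3 - a 4) * (x 1 - x 3) * (x 2 - x 4) - (a 1 - a 3) * (a 2 - a 4) * (x 1 - x 2) * (x 3 - x 4)"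
  unfolding det4_eq vec_lambda_beta by algebra

lemma det4_vandermonde3:
  "det4 (\<chi> j. a j) (\<chi> j. 1) (\<chi> j. x j) (\<chi> j. (x j - \<alpha>) * x j) =
     a 1 * ((x 3 - x 2) * (x 4 - x 2) * (x 4 - x 3)) - a 2 * ((x 3 - x 1) * (x 4 - x 1) * (x 4 - x 3))
   + a 3 * ((x 2 - x 1) * (x 4 - x 1) * (x 4 - x 2)) - a 4 * ((x 2 - x 1) * (x 3 - x 1) * (x 3 - x 2))"
  unfolding det4_eq vec_lambda_beta by algebra

text \<open>A 0-1 vector splits the four indices as 4+0, 3+1 or 2+2. The first determinant excludes
  2+2 and the second excludes 3+1, since in these cases they become nonzero products of differences
  of the \<open>x j\<close>, up to sign.\<close>

lemma idempotent_constant: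
  fixes a x :: "4 \<Rightarrow> complex"
  assumes a: "\<And>j. a j = 0 \<or> a j = 1" and x: "inj x"
    and 1: "det4 (\<chi> j. 1) (\<chi> j. a j) (\<chi> j. x j) (\<chi> j. x j * a j) = 0"
    and 2: "det4 (\<chi> j. a j) (\<chi> j. 1) (\<chi> j. x j) (\<chi> j. (x j - \<alpha>) * x j) = 0"
  shows "(\<forall>j. a j = 0) \<or> (\<forall>j. a j = 1)"
proof -
  have d: "x p \<noteq> x q" if "p \<noteq> q" for p q using x that by (simp add: inj_eq)
  note e1 = 1 [unfolded det4_segre] and e2 = 2 [unfolded det4_vandermonde3]
  \<comment> \<open>The three-term relation between products of differences rewrites the first
    condition so that the split {1,4}, {2,3} also leaves a single product.\<close>
  have e1': "(a 1 - a 2) * (a 3 - a 4) * (x 1 - x 4) * (x 2 - x 3) - (a 1 - a 4) * (a 2 - a 3) * (x 1 - x 2) * (x 3 - x 4) = 0"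
    using e1 by algebra
  \<comment> \<open>The all-ones vector is another column, so passing from \<open>a\<close> to
    \<open>1 - a\<close> only changes the sign; this handles three ones.\<close>
  have e2': "(1 - a 1) * ((x 3 - x 2) * (x 4 - x 2) * (x 4 - x 3)) - (1 - a 2) * ((x 3 - x 1) * (x 4 - x 1) * (x 4 - x 3))
   + (1 - a 3) * ((x 2 - x 1) * (x 4 - x 1) * (x 4 - x 2)) - (1 - a 4) * ((x 2 - x 1) * (x 3 - x 1) * (x 3 - x 2)) = 0"
    using e2 by algebra
  from a [of 1] a [of 2] a [of 3] a [of 4] show ?thesis
    unfolding forall_4
    by (elim disjE) (use e1 e1' e2 e2' in \<open>simp_all add: d\<close>)
qed

end

section \<open>Spaces of vector-valued modular forms\<close>

context mlde_form
begin

text \<open>\<open>A\<close> is the projection onto \<open>W1\<close> along \<open>W2\<close>; its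
  linearity and equivariance both follow from uniqueness of the decomposition.\<close>

lemma sum_split_T:
  assumes W: "invariant_subspace \<rho> W1" "invariant_subspace \<rho> W2" "W1 \<inter> W2 = {0}"
    "\<forall>v. \<exists>x\<in>W1. \<exists>y\<in>W2. v = x + y"
  obtains A where "\<And>v. A *v v \<in> W1" "\<And>v. v - A *v v \<in> W2" "\<And>x. x \<in> W1 \<Longrightarrow> A *v x = x"
    "\<And>y. y \<in> W2 \<Longrightarrow> A *v y = 0" "\<And>\<gamma> v. \<gamma> \<in> SL2Z \<Longrightarrow> A *v (\<rho> \<gamma> *v v) = \<rho> \<gamma> *v (A *v v)"
proof -
  have s1: "vec.subspace W1" and s2: "vec.subspace W2" using W by (auto simp: invariant_subspace_def)
  have "\<exists>x. x \<in> W1 \<and> v - x \<in> W2" for v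
  proof -
    obtain x y where "x \<in> W1" "y \<in> W2" "v = x + y" using W(4) by blast
    then show ?thesis by (intro exI [of _ x]) simp
  qed
  then have "\<forall>v. \<exists>x. x \<in> W1 \<and> v - x \<in> W2" by blast
  from choice [OF this] obtain p where "\<forall>v. p v \<in> W1 \<and> v - p v \<in> W2" by blast
  then have p: "p v \<in> W1" "v - p v \<in> W2" for v by simp_all
  have uniq: "p v = x" if "x \<in> W1" "v - x \<in> W2" for v x
  proof -
    have "x - p v \<in> W1" using vec.subspace_diff [OF s1 that(1) p(1)] .
    moreover have "(v - p v) - (v - x) \<in> W2" using vec.subspace_diff [OF s2 p(2) that(2)] .
    ultimately have "x - p v \<in> W1 \<inter> W2" by simp
    then show ?thesis using W(3) by simp
  qed
  have "Vector_Spaces.linear (*s) (*s) p"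
  proof (unfold Vector_Spaces.linear_iff, intro conjI allI)
    show "vector_space ((*s) :: complex \<Rightarrow> complex^4 \<Rightarrow> _)" by (rule vec.vector_space_axioms)
    show "vector_space ((*s) :: complex \<Rightarrow> complex^4 \<Rightarrow> _)" by (rule vec.vector_space_axioms)
  next
    fix v w
    show "p (v + w) = p v + p w"
    proof (rule uniq)
      show "p v + p w \<in> W1" by (rule vec.subspace_add [OF s1 p(1) p(1)])
      have "(v - p v) + (w - p w) \<in> W2" by (rule vec.subspace_add [OF s2 p(2) p(2)])
      then show "v + w - (p v + p w) \<in> W2" by (simp add: algebra_simps)
    qed
  next
    fix c v
    show "p (c *s v) = c *s p v"
    proof (rule uniq)
      show "c *s p v \<in> W1" by (rule vec.subspace_scale [OF s1 p(1)])
      have "c *s (v - p v) \<in> W2" by (rule vec.subspace_scale [OF s2 p(2)])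
      then show "c *s v - c *s p v \<in> W2" by (simp add: vec.scale_right_diff_distrib)
    qed
  qed
  then have A: "matrix p *v v = p v" for v by (rule matrix_works)
  show ?thesis
  proof (rule that [of "matrix p"], unfold A)
    show "p v \<in> W1" "v - p v \<in> W2" for v by (rule p)+
    show "p x = x" if "x \<in> W1" for x
      by (rule uniq [OF that]) (use vec.subspace_0 [OF s2] in simp)
    show "p y = 0" if "y \<in> W2" for y
      by (rule uniq [OF vec.subspace_0 [OF s1]]) (use that in simp)
    fix \<gamma> v assume g: "\<gamma> \<in> SL2Z"
    show "p (\<rho> \<gamma> *v v) = \<rho> \<gamma> *v p v"
    proof (rule uniq)
      show "\<rho> \<gamma> *v p v \<in> W1" using W(1) g p(1) by (auto simp: invariant_subspace_def)
      have "\<rho> \<gamma> *v (v - p v) \<in> W2" using W(2) g p(2) by (auto simp: invariant_subspace_def)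
      then show "\<rho> \<gamma> *v v - \<rho> \<gamma> *v p v \<in> W2" by (simp add: matrix_vector_mult_diff_distrib)
    qed
  qed
qed

text \<open>\<rho>(T) is diagonal with distinct entries, so its commutant consists of diagonal
  matrices.\<close>

lemma commuting_diagonal:
  assumes com: "\<And>v. A *v (\<rho> Tmat *v v) = \<rho> Tmat *v (A *v v)"
  shows "A *v v = (\<chi> j. A $ j $ j * v $ j)"
proof -
  define t where "t = (\<lambda>j. inverse (\<upsilon> Tmat) * ee (lam j))"
  have t: "t a = t b \<Longrightarrow> a = b" for a b
    using unit [OF Tmat_in] ee_lam_inj [of a b] by (auto simp: t_def)
  have dv: "\<rho> Tmat *v v = (\<chi> a. t a * v $ a)" for v
    by (simp add: rho_T t_def diagonal_mult)
  have off: "A $ a $ b = 0" if "a \<noteq> b" for a b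
  proof -
    have "\<rho> Tmat *v axis b 1 = t b *s axis b 1" unfolding dv by (simp add: vec_eq_iff axis_def)
    with com [of "axis b 1"] have "t b *s (A *v axis b 1) = (\<chi> a. t a * (A *v axis b 1) $ a)"
      by (simp add: vector_scalar_commute dv)
    from arg_cong [OF this, of "\<lambda>v. v $ a"] have "t b * A $ a $ b = t a * A $ a $ b"
      by (simp add: matrix_vector_mult_def axis_def if_distrib [of "\<lambda>x. _ * x"] sum.delta cong: if_cong)
    then show ?thesis using t [of b a] that by auto
  qed
  show ?thesis
  proof (subst vec_eq_iff, intro allI)
    fix j
    have "(\<Sum>l\<in>UNIV. A $ j $ l * v $ l) = (\<Sum>l\<in>UNIV. if l = j then A $ j $ j * v $ j else 0)"
      by (rule sum.cong) (use off in auto)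
    then show "(A *v v) $ j = (\<chi> j. A $ j $ j * v $ j) $ j"
      by (simp add: matrix_vector_mult_def)
  qed
qed

text \<open>The projection is diagonal with entries 0 and 1, so \<open>AF\<close> keeps the
  exponents of \<open>F\<close>, of sum \<open>\<Lambda> + 1\<close>. The vanishing leading terms of
  det(F, AF, DF, D AF) and det(AF, F, DF, D^2 F) are the two conditions of
  \<open>idempotent_constant\<close>.\<close>

lemma indecomposable: "indecomposable_rep \<rho>"
  unfolding indecomposable_rep_def
proof (rule notI, elim exE conjE)
  fix W1 W2
  assume W: "invariant_subspace \<rho> W1" "invariant_subspace \<rho> W2" "W1 \<noteq> {0}" "W2 \<noteq> {0}" "W1 \<inter> W2 = {0}"
    "\<forall>v. \<exists>x\<in>W1. \<exists>y\<in>W2. v = x + y"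
  obtain A where A: "\<And>v. A *v v \<in> W1" "\<And>v. v - A *v v \<in> W2" "\<And>x. x \<in> W1 \<Longrightarrow> A *v x = x"
    "\<And>y. y \<in> W2 \<Longrightarrow> A *v y = 0" "\<And>\<gamma> v. \<gamma> \<in> SL2Z \<Longrightarrow> A *v (\<rho> \<gamma> *v v) = \<rho> \<gamma> *v (A *v v)"
    using sum_split_T [OF W(1,2,5,6)] by blast
  define a where "a = (\<lambda>j. A $ j $ j)"
  have Av: "A *v v = (\<chi> j. a j * v $ j)" for v
    unfolding a_def by (rule commuting_diagonal) (rule A(5) [OF Tmat_in])
  have a01: "a j = 0 \<or> a j = 1" for j
  proof -
    have "A *v (A *v axis j 1) = A *v axis j 1" by (rule A(3) [OF A(1)])
    from arg_cong [OF this, of "\<lambda>v. v $ j"] have "a j * (a j * 1) = a j * 1"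
      unfolding Av by (simp add: axis_def)
    then show ?thesis by simp
  qed
  define AF where "AF = (\<lambda>z. A *v F z)"
  have AF_form: "vform k \<rho> \<upsilon> AF"
    unfolding vform_def AF_def
  proof (intro conjI allI ballI)
    show "(\<lambda>z. (A *v F z) $ j) holomorphic_on Hp" for j
      unfolding Av vec_lambda_beta by (intro holomorphic_intros F_hol)
    fix \<gamma> z assume g: "\<gamma> \<in> SL2Z" "z \<in> Hp"
    then have "F (moeb \<gamma> z) = (\<upsilon> \<gamma> * jfac \<gamma> z powr of_real k) *s (\<rho> \<gamma> *v F z)"
      using F_form by (simp add: vform_def)
    then show "A *v F (moeb \<gamma> z) = (\<upsilon> \<gamma> * jfac \<gamma> z powr of_real k) *s (\<rho> \<gamma> *v (A *v F z))"
      using A(5) [OF g(1)] by (simp add: vector_scalar_commute)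
  qed
  have Fq: "qexp (\<mu> j) (g j) (\<lambda>z. F z $ j)" for j using F_qexp [of j] by (simp add: \<mu>_def)
  have AFq: "qexp (\<mu> j) (\<lambda>q. a j * g j q) (\<lambda>z. AF z $ j)" for j
    unfolding AF_def Av vec_lambda_beta by (rule qexp_cmult [OF Fq])
  obtain g1 where g1: "\<And>j. qexp (\<mu> j) (g1 j) (\<lambda>z. DopV k F z $ j)"
    "\<And>j. g1 j 0 = (of_real (\<mu> j) - of_real k / 12) * g j 0"
    using vqexp_DopV [of \<mu> g F k, OF Fq] by metis
  obtain g2 where g2: "\<And>j. qexp (\<mu> j) (g2 j) (\<lambda>z. DopV (k + 2) (DopV k F) z $ j)"
    "\<And>j. g2 j 0 = (of_real (\<mu> j) - of_real (k + 2) / 12) * g1 j 0"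
    using vqexp_DopV [OF g1(1)] by metis
  obtain h1 where h1: "\<And>j. qexp (\<mu> j) (h1 j) (\<lambda>z. DopV k AF z $ j)"
    "\<And>j. h1 j 0 = (of_real (\<mu> j) - of_real k / 12) * (a j * g j 0)"
    using vqexp_DopV [OF AFq] by metis
  define x where "x = (\<lambda>j. complex_of_real (\<mu> j) - of_real k / 12)"
  have xinj: "inj x"
    using inj_\<mu> by (auto simp: inj_def x_def)
  \<comment> \<open>The weights are 12 \<Lambda> + 4 and 12 \<Lambda> + 6, below the critical 12
    \<Lambda> + 12.\<close>
  have l1: "k + k + (k + 2) + (k + 2) < 12 * (\<Lambda> + 1)" and l2: "k + k + (k + 2) + (k + 4) < 12 * (\<Lambda> + 1)"
    by (simp_all add: k_\<Lambda>)
  have "det4 (\<chi> j. g j 0) (\<chi> j. a j * g j 0) (\<chi> j. g1 j 0) (\<chi> j. h1 j 0) = 0"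
    by (rule det4_lead_zero [OF F_form AF_form vform_D [OF F_form] vform_D [OF AF_form] Fq AFq g1(1) h1(1)])
      (use l1 in \<open>simp add: sum_\<mu>\<close>)
  then have d1: "det4 (\<chi> j. 1) (\<chi> j. a j) (\<chi> j. x j) (\<chi> j. x j * a j) = 0"
    by (simp add: F_lead g1(2) h1(2) x_def)
  have DD: "vform (k + 4) \<rho> \<upsilon> (DopV (k + 2) (DopV k F))"
    using vform_D [OF vform_D [OF F_form]] by (simp add: add.commute)
  have "det4 (\<chi> j. a j * g j 0) (\<chi> j. g j 0) (\<chi> j. g1 j 0) (\<chi> j. g2 j 0) = 0"
    by (rule det4_lead_zero [OF AF_form F_form vform_D [OF F_form] DD AFq Fq g1(1) g2(1)])
      (use l2 in \<open>simp add: sum_\<mu>\<close>)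
  moreover have "of_real (\<mu> j) - of_real (k + 2) / 12 = x j - 1/6" for j
    by (simp add: x_def add_divide_distrib)
  ultimately have d2: "det4 (\<chi> j. a j) (\<chi> j. 1) (\<chi> j. x j) (\<chi> j. (x j - 1/6) * x j) = 0"
    by (simp only: F_lead g1(2) g2(2) mult_1_right) (simp add: x_def)
  from idempotent_constant [OF a01 xinj d1 d2] show False
  proof
    assume "\<forall>j. a j = 0"
    then have "A *v v = 0" for v unfolding Av by (simp add: vec_eq_iff)
    then have "W1 \<subseteq> {0}" using A(3) by (metis singletonI subsetI)
    moreover have "0 \<in> W1" using W(5) by blast
    ultimately show False using W(3) by blast
  next
    assume "\<forall>j. a j = 1"
    then have "A *v v = v" for v unfolding Av by (simp add: vec_eq_iff)
    then have "W2 \<subseteq> {0}" using A(4) by (metis singletonI subsetI)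
    moreover have "0 \<in> W2" using W(5) by blast
    ultimately show False using W(4) by blast
  qed
qed

section \<open>Expansions of forms and operations on them\<close>

abbreviation (input) "\<H> l \<equiv> Hspace l \<rho> \<upsilon>"
abbreviation (input) "form l \<equiv> vform l \<rho> \<upsilon>"

lemma unit_nonzero: "\<gamma> \<in> SL2Z \<Longrightarrow> \<upsilon> \<gamma> \<noteq> 0"
  using unit [of \<gamma>] by auto

lemma Hspace_vform: "H \<in> \<H> l \<Longrightarrow> form l H"
  by (auto simp: Hspace_def vform_def slashV_eq_iff unit_nonzero)

lemma Hspace_outside: "H \<in> \<H> l \<Longrightarrow> z \<notin> Hp \<Longrightarrow> H z = 0"
  by (simp add: Hspace_def)

lemma Hspace_qexp:
  assumes "H \<in> \<H> l" obtains h where "\<And>j. qexp (lam j) (h j) (\<lambda>z. H z $ j)"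
proof -
  have "\<exists>h. qexp (lam j) h (\<lambda>z. H z $ j)" for j
  proof -
    have sh: "H (z + 1) $ j = ee (lam j) * H z $ j" if z: "z \<in> Hp" for z
    proof -
      have "H (moeb Tmat z) = (\<upsilon> Tmat * jfac Tmat z powr of_real l) *s (\<rho> Tmat *v H z)"
        using Hspace_vform [OF assms] z Tmat_in unfolding vform_def by blast
      moreover have "(\<rho> Tmat *v H z) $ j = inverse (\<upsilon> Tmat) * ee (lam j) * H z $ j"
        by (simp add: rho_T diagonal_mult)
      ultimately show ?thesis using unit_nonzero [OF Tmat_in] by simp
    qed
    have "(\<lambda>z. H z $ j) holomorphic_on Hp" "moderate_growth (\<lambda>z. H z $ j)" using assms by (auto simp: Hspace_def)
    from qexp_of_moderate_growth [OF this(1) sh this(2) lam_less_1] show ?thesis by blast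
  qed
  then show ?thesis using that by metis
qed

text \<open>Here \<open>lam j >= 0\<close> supplies the growth condition, so closure properties can
  be checked on expansions.\<close>

lemma HspaceI:
  assumes "form l H" "\<And>j. qexp (lam j) (h j) (\<lambda>z. H z $ j)" "\<And>z. z \<notin> Hp \<Longrightarrow> H z = 0"
  shows "H \<in> \<H> l"
  using assms(1,3) qexp_moderate_growth [OF assms(2) lam_nonneg]
  by (auto simp: Hspace_def vform_def slashV_eq_iff unit_nonzero)

lemma Hspace_DopV:
  assumes "H \<in> \<H> l" shows "DopV l H \<in> \<H> (l + 2)"
proof -
  obtain h where h: "\<And>j. qexp (lam j) (h j) (\<lambda>z. H z $ j)" using Hspace_qexp [OF assms] by metis
  obtain h' where "\<And>j. qexp (lam j) (h' j) (\<lambda>z. DopV l H z $ j)" using vqexp_DopV [OF h] by metis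
  then show ?thesis
    by (rule HspaceI [OF vform_D [OF Hspace_vform [OF assms]]]) (simp add: DopV_def Dop_def vec_eq_iff)
qed

lemma Hspace_mult:
  assumes a: "a \<in> Mk n" and H: "H \<in> \<H> l" shows "(\<lambda>z. a z *s H z) \<in> \<H> (l + of_int n)"
proof -
  obtain h where h: "\<And>j. qexp (lam j) (h j) (\<lambda>z. H z $ j)" using Hspace_qexp [OF H] by metis
  obtain b where b: "qexp 0 b a" using Mk_qexp [OF a] .
  have "qexp (lam j) (\<lambda>q. b q * h j q) (\<lambda>z. (a z *s H z) $ j)" for j
    using qexp_mult [OF b h [of j]] by simp
  moreover have "form (l + of_int n) (\<lambda>z. a z *s H z)"
    unfolding vform_def
  proof (intro conjI allI ballI)
    show "(\<lambda>z. (a z *s H z) $ j) holomorphic_on Hp" for j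
      using Hspace_vform [OF H] Mk_hol [OF a] by (auto simp: vform_def intro!: holomorphic_intros)
    fix \<gamma> z assume g: "\<gamma> \<in> SL2Z" "z \<in> Hp"
    have "H (moeb \<gamma> z) = (\<upsilon> \<gamma> * jfac \<gamma> z powr of_real l) *s (\<rho> \<gamma> *v H z)"
      using Hspace_vform [OF H] g by (simp add: vform_def)
    moreover have "a (moeb \<gamma> z) = jfac \<gamma> z powr of_real (of_int n) * a z"
      using Mk_slash [OF a g] powi_eq_powr [OF jfac_nonzero [OF g]] by simp
    moreover have "jfac \<gamma> z powr of_real (l + of_int n) = jfac \<gamma> z powr of_real l * jfac \<gamma> z powr of_real (of_int n)"
      using jfac_nonzero [OF g] by (simp add: powr_add)
    ultimately show "a (moeb \<gamma> z) *s H (moeb \<gamma> z) = (\<upsilon> \<gamma> * jfac \<gamma> z powr of_real (l + of_int n)) *s (\<rho> \<gamma> *v (a z *s H z))"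
      by (simp only: vector_scalar_commute vector_smult_assoc mult_ac)
  qed
  ultimately show ?thesis using Hspace_outside [OF H] by (intro HspaceI) auto
qed

lemma Hspace_add: assumes "A \<in> \<H> l" "B \<in> \<H> l" shows "(\<lambda>z. A z + B z) \<in> \<H> l"
proof -
  obtain a where a: "\<And>j. qexp (lam j) (a j) (\<lambda>z. A z $ j)" using Hspace_qexp [OF assms(1)] by metis
  obtain b where b: "\<And>j. qexp (lam j) (b j) (\<lambda>z. B z $ j)" using Hspace_qexp [OF assms(2)] by metis
  have "qexp (lam j) (\<lambda>q. a j q + b j q) (\<lambda>z. (A z + B z) $ j)" for j using qexp_add [OF a b] by simp
  moreover have "form l (\<lambda>z. A z + B z)"
    using Hspace_vform [OF assms(1)] Hspace_vform [OF assms(2)]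
    by (auto simp: vform_def matrix_vector_right_distrib vector_add_ldistrib intro!: holomorphic_intros)
  ultimately show ?thesis using Hspace_outside [OF assms(1)] Hspace_outside [OF assms(2)] by (intro HspaceI) auto
qed

lemma F_qexp_lam: "qexp (lam j) (\<lambda>q. q ^ (if j = i then 1 else 0) * g j q) (\<lambda>z. F z $ j)"
  using qexp_lower [of "lam j" "if j = i then 1 else 0" "g j"] F_qexp [of j] by (simp split: if_splits)

text \<open>A nowhere vanishing form of weight \<open>12 \<Lambda>\<close> with the character of the determinants, so that dividing by it
  leaves the trivial multiplier.\<close>

definition Omega :: "complex \<Rightarrow> complex" where
  "Omega z = wronskian Pfun k F z / Delta z"

lemma Omega_etapow: "\<exists>C. C \<noteq> 0 \<and> (\<forall>z\<in>Hp. Omega z = C * etapow (12 * \<Lambda>) z)"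
proof -
  obtain C where C: "C \<noteq> 0" "\<And>z. z \<in> Hp \<Longrightarrow> wronskian Pfun k F z = C * etapow (12 * \<Lambda> + 12) z"
    using wronskian_F by auto
  obtain C' where C': "C' \<noteq> 0" "\<And>z. z \<in> Hp \<Longrightarrow> Delta z = C' * etapow 12 z" using Delta_etapow by auto
  have "etapow (12 * \<Lambda> + 12) z = etapow (12 * \<Lambda>) z * etapow 12 z" for z
    by (simp add: etapow_def exp_add [symmetric] algebra_simps)
  then have "\<forall>z\<in>Hp. Omega z = (C / C') * etapow (12 * \<Lambda>) z"
    using C' by (simp add: Omega_def C(2) C'(2))
  then show ?thesis using C(1) C'(1) by (metis divide_eq_0_iff)
qed

lemma Omega_nonzero: "z \<in> Hp \<Longrightarrow> Omega z \<noteq> 0"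
  using Omega_etapow by auto

lemma Omega_slash:
  assumes "\<gamma> \<in> SL2Z" "z \<in> Hp"
  shows "Omega (moeb \<gamma> z) = \<upsilon> \<gamma> ^ 4 * coldet (\<rho> \<gamma>) * jfac \<gamma> z powr of_real (12 * \<Lambda>) * Omega z"
proof -
  have j: "jfac \<gamma> z \<noteq> 0" by (rule jfac_nonzero [OF assms])
  have "jfac \<gamma> z powr of_real (4 * k + 12) = jfac \<gamma> z powr of_real (12 * \<Lambda>) * jfac \<gamma> z powr of_real (of_int 12)"
  proof -
    have "4 * k + 12 = 12 * \<Lambda> + of_int 12" by (simp add: k_\<Lambda>)
    then show ?thesis using j by (simp only: of_real_add powr_add simp_thms if_False)
  qed
  then show ?thesis
    unfolding Omega_def wronskian_slash [OF F_form Pfun_holomorphic assms] Mk_slash [OF Delta_in assms]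
      powi_eq_powr [OF j]
    using j by simp
qed

text \<open>Numerator and \<open>Omega\<close> share the character, and the numerator has order at
  least \<Lambda>, the order of \<open>Omega\<close>. The quotient is therefore holomorphic at the
  cusp, and the excess weight \<open>w\<close> is an integer.\<close>

lemma det4_quotient_in_Mk:
  assumes H: "A \<in> \<H> ka" "B \<in> \<H> kb" "C \<in> \<H> kc" "D \<in> \<H> kd"
    and w: "ka + kb + kc + kd = 12 * \<Lambda> + of_int w"
  shows "(\<lambda>z. if z \<in> Hp then det4 (A z) (B z) (C z) (D z) / Omega z else 0) \<in> Mk w"
proof -
  note forms = H [THEN Hspace_vform]
  obtain a where a: "\<And>j. qexp (lam j) (a j) (\<lambda>z. A z $ j)" using Hspace_qexp [OF H(1)] by metis
  obtain b where b: "\<And>j. qexp (lam j) (b j) (\<lambda>z. B z $ j)" using Hspace_qexp [OF H(2)] by metis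
  obtain c where c: "\<And>j. qexp (lam j) (c j) (\<lambda>z. C z $ j)" using Hspace_qexp [OF H(3)] by metis
  obtain d where d: "\<And>j. qexp (lam j) (d j) (\<lambda>z. D z $ j)" using Hspace_qexp [OF H(4)] by metis
  note q = a b c d
  obtain K where K: "K \<noteq> 0" "\<And>z. z \<in> Hp \<Longrightarrow> Omega z = K * etapow (12 * \<Lambda>) z" using Omega_etapow by auto
  obtain h where "qexp ((\<Sum>j\<in>UNIV. lam j) - 12 * \<Lambda> / 12) h (\<lambda>z. det4 (A z) (B z) (C z) (D z) / Omega z)"
    by (rule qexp_divide_etapow [OF qexp_det4 [OF q] K(2) K(1)])
  then have "qexp 0 h (\<lambda>z. det4 (A z) (B z) (C z) (D z) / Omega z)" by (simp add: \<Lambda>_def)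
  then have h: "qexp 0 h (\<lambda>z. if z \<in> Hp then det4 (A z) (B z) (C z) (D z) / Omega z else 0)"
    by (rule qexp_cong) simp
  show ?thesis
  proof (rule MkI [OF h])
    fix \<gamma> z assume g: "\<gamma> \<in> SL2Z" and z: "z \<in> Hp"
    have gz: "moeb \<gamma> z \<in> Hp" by (rule moeb_in_Hp [OF g z])
    have j: "jfac \<gamma> z \<noteq> 0" by (rule jfac_nonzero [OF g z])
    have u: "\<upsilon> \<gamma> ^ 4 * coldet (\<rho> \<gamma>) * jfac \<gamma> z powr of_real (12 * \<Lambda>) \<noteq> 0"
      using Omega_slash [OF g z] Omega_nonzero [OF gz] by auto
    have p: "jfac \<gamma> z powr of_real (ka + kb + kc + kd) = jfac \<gamma> z powr of_real (12 * \<Lambda>) * jfac \<gamma> z powi w"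
      unfolding w powi_eq_powr [OF j] using j by (simp only: of_real_add powr_add simp_thms if_False)
    show "(if moeb \<gamma> z \<in> Hp then det4 (A (moeb \<gamma> z)) (B (moeb \<gamma> z)) (C (moeb \<gamma> z)) (D (moeb \<gamma> z)) / Omega (moeb \<gamma> z) else 0)
       = jfac \<gamma> z powi w * (if z \<in> Hp then det4 (A z) (B z) (C z) (D z) / Omega z else 0)"
      using gz z u unfolding det4_vform_slash [OF forms g z] Omega_slash [OF g z] p by simp
  qed simp
qed

text \<open>The values of \<open>H\<close> span an invariant subspace, because the automorphy factor
  is a nonzero scalar. A vanishing component would confine this span to a coordinate
  hyperplane.\<close>

lemma irreducible_components_nonzero:
  assumes irr: "irreducible_rep \<rho>" and H: "form l H" and z1: "z1 \<in> Hp" "H z1 \<noteq> 0"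
  shows "\<exists>z\<in>Hp. H z $ j \<noteq> 0"
proof (rule ccontr)
  assume no: "\<not> ?thesis"
  define W where "W = vec.span (H ` Hp)"
  have "invariant_subspace \<rho> W"
    unfolding invariant_subspace_def
  proof (intro conjI ballI)
    show "vec.subspace W" by (simp add: W_def)
    fix \<gamma> v assume g: "\<gamma> \<in> SL2Z" and "v \<in> W"
    from \<open>v \<in> W\<close> show "\<rho> \<gamma> *v v \<in> W"
      unfolding W_def
    proof (induction rule: vec.span_induct_alt)
      case base
      then show ?case by (simp add: vec.span_zero)
    next
      case (step c x y)
      then obtain z where z: "z \<in> Hp" "x = H z" by blast
      define e where "e = \<upsilon> \<gamma> * jfac \<gamma> z powr of_real l"
      have e0: "e \<noteq> 0" using unit_nonzero [OF g] jfac_nonzero [OF g z(1)] by (simp add: e_def)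
      have "H (moeb \<gamma> z) = e *s (\<rho> \<gamma> *v x)" using H g z by (simp add: vform_def e_def)
      then have "\<rho> \<gamma> *v x = inverse e *s H (moeb \<gamma> z)" using e0 by (simp add: vector_smult_assoc)
      moreover have "inverse e *s H (moeb \<gamma> z) \<in> vec.span (H ` Hp)"
        by (intro vec.span_scale vec.span_base imageI moeb_in_Hp g z)
      ultimately have "c *s (\<rho> \<gamma> *v x) + \<rho> \<gamma> *v y \<in> vec.span (H ` Hp)"
        using step by (intro vec.span_add vec.span_scale) simp_all
      then show ?case by (simp add: matrix_vector_right_distrib vector_scalar_commute)
    qed
  qed
  moreover have "W \<noteq> {0}" using z1 vec.span_base [of "H z1" "H ` Hp"] by (auto simp: W_def)
  ultimately have "W = UNIV" using irr unfolding irreducible_rep_def by blast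
  moreover have "W \<subseteq> {v. v $ j = 0}"
    unfolding W_def by (rule vec.span_minimal) (use no in \<open>auto simp: vec.subspace_def\<close>)
  ultimately have "axis j (1::complex) $ j = 0" by blast
  then show False by (simp add: axis_def)
qed

end

section \<open>The free module\<close>

locale mlde_module = mlde_form +
  fixes k1 :: real and G :: "complex \<Rightarrow> complex^4"
  assumes F_outside: "z \<notin> Hp \<Longrightarrow> F z = 0"
    and irr: "irreducible_rep \<rho>" and k1: "k1 = k - 2"
    and G_in: "G \<in> \<H> k1" and G_nz: "G \<noteq> 0" and lam_i: "lam i \<noteq> k1 / 12"
begin

abbreviation "D1 \<equiv> DopV k1 G"
abbreviation "D2 \<equiv> DopV (k1 + 2) D1"
abbreviation "D3 \<equiv> DopV (k1 + 4) D2"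

lemma F_in: "F \<in> \<H> (k1 + 2)"
proof (rule HspaceI [OF _ F_qexp_lam])
  have "k1 + 2 = k" by (simp add: k1)
  then show "form (k1 + 2) F" using F_form by simp
qed (rule F_outside)

lemma D1_in: "D1 \<in> \<H> (k1 + 2)"
  by (rule Hspace_DopV [OF G_in])

lemma D2_in: "D2 \<in> \<H> (k1 + 4)"
  using Hspace_DopV [OF D1_in] by (simp add: add.commute)

lemma D3_in: "D3 \<in> \<H> (k1 + 6)"
  using Hspace_DopV [OF D2_in] by (simp add: add.commute)

lemma k1_\<Lambda>: "k1 = 3 * \<Lambda> - 2"
  by (simp add: k1 k_\<Lambda>)

lemma wronskian_G: "wronskian Pfun k1 G z = det4 (G z) (D1 z) (D2 z) (D3 z)"
  by (simp add: wronskian_def DopV_eq_DgenV)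

text \<open>If the exponents of \<open>G\<close> are \<open>lam j + n j\<close>, its Wronskian has
  order \<Lambda> plus the sum of the \<open>n j\<close>, and weight 12 \<Lambda> + 4. So that sum
  is at most 1/3, hence 0.\<close>

lemma G_exact:
  obtains h where "\<And>j. qexp (lam j) (h j) (\<lambda>z. G z $ j)" "\<And>j. h j 0 \<noteq> 0"
    "\<exists>z\<in>Hp. det4 (G z) (D1 z) (D2 z) (D3 z) \<noteq> 0"
proof -
  obtain z1 where z1: "z1 \<in> Hp" "G z1 \<noteq> 0"
    using G_nz Hspace_outside [OF G_in] by (metis ext zero_fun_apply)
  obtain h0 where h0: "\<And>j. qexp (lam j) (h0 j) (\<lambda>z. G z $ j)" using Hspace_qexp [OF G_in] by metis
  have "\<exists>n h. qexp (lam j + of_nat n) h (\<lambda>z. G z $ j) \<and> h 0 \<noteq> 0" for j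
  proof -
    obtain z where "z \<in> Hp" "G z $ j \<noteq> 0"
      using irreducible_components_nonzero [OF irr Hspace_vform [OF G_in] z1] by blast
    from qexp_exact [OF h0 this] show ?thesis by blast
  qed
  then obtain n h where h: "\<And>j. qexp (lam j + real (n j)) (h j) (\<lambda>z. G z $ j)" "\<And>j. h j 0 \<noteq> 0" by metis
  define \<nu> where "\<nu> = (\<lambda>j. lam j + real (n j))"
  have h': "qexp (\<nu> j) (h j) (\<lambda>z. G z $ j)" for j using h(1) by (simp add: \<nu>_def)
  obtain u where u: "qexp (\<Sum>j\<in>UNIV. \<nu> j) u (wronskian Pfun k1 G)"
    "(\<And>j. h j 0 \<noteq> 0) \<Longrightarrow> inj \<nu> \<Longrightarrow> u 0 \<noteq> 0"
    using qexp_wronskian [of \<nu> h G k1, OF h'] by blast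
  have u0: "u 0 \<noteq> 0" by (rule u(2) [OF h(2)]) (unfold \<nu>_def, rule inj_add_nat)
  have ex: "\<exists>z\<in>Hp. wronskian Pfun k1 G z \<noteq> 0"
    using qexp_zero_iff [OF u(1)] u0 by blast
  have S: "norm (wronskian Pfun k1 G (- 1 / z)) = norm z powr (k1 + (k1 + 2) + (k1 + 4) + (k1 + 6)) * norm (wronskian Pfun k1 G z)"
    if "z \<in> Hp" for z
    unfolding wronskian_G
    by (rule det4_vform_S [OF Hspace_vform [OF G_in] Hspace_vform [OF D1_in] Hspace_vform [OF D2_in] Hspace_vform [OF D3_in] that])
  have "\<not> (\<Sum>j\<in>UNIV. \<nu> j) > (k1 + (k1 + 2) + (k1 + 4) + (k1 + 6)) / 12"
    using order_gt_imp_zero [OF etaS u(1) S] ex by blast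
  moreover have "(\<Sum>j\<in>UNIV. \<nu> j) = \<Lambda> + real (\<Sum>j\<in>UNIV. n j)" by (simp add: \<nu>_def \<Lambda>_def sum.distrib)
  ultimately have "real (\<Sum>j\<in>UNIV. n j) < 1" by (simp add: k1_\<Lambda>)
  then have "(\<Sum>j\<in>UNIV. n j) = 0" by linarith
  then have "n j = 0" for j by simp
  then show ?thesis using that [of h] h ex unfolding wronskian_G by simp
qed

text \<open>Cramer's rule expands \<open>F\<close> in \<open>G\<close>, \<open>D1\<close>,
  \<open>D2\<close>, \<open>D3\<close>. Divided by \<open>Omega\<close>, the determinant and the
  coefficients of \<open>G\<close> and \<open>D1\<close> have weights 4, 6, 4, hence are multiples
  of \<open>E4\<close>, \<open>E6\<close>, \<open>E4\<close>. The coefficient of \<open>D2\<close>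
  lies in weight 2 and vanishes; that of \<open>D3\<close> is, up to sign, the determinant assumed
  to vanish.\<close>

lemma W_nonzero: "\<exists>z\<in>Hp. det4 (G z) (D1 z) (F z) (D2 z) \<noteq> 0"
proof (rule ccontr)
  assume "\<not> ?thesis"
  then have W0: "det4 (G z) (D1 z) (F z) (D2 z) = 0" if "z \<in> Hp" for z using that by blast
  obtain h where h: "\<And>j. qexp (lam j) (h j) (\<lambda>z. G z $ j)" "\<And>j. h j 0 \<noteq> 0"
    "\<exists>z\<in>Hp. det4 (G z) (D1 z) (D2 z) (D3 z) \<noteq> 0" using G_exact by blast
  obtain h1 where h1: "\<And>j. qexp (lam j) (h1 j) (\<lambda>z. D1 z $ j)"
    "\<And>j. h1 j 0 = (of_real (lam j) - of_real k1 / 12) * h j 0"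
    using vqexp_DopV [OF h(1)] by metis
  obtain a where a: "qexp 0 a E4" "a 0 = 1/144" using E4_qexp by blast
  obtain b where b: "qexp 0 b E6" "b 0 = - 1/432" using E6_qexp by blast
  note g = Hspace_vform [OF G_in] and d1 = Hspace_vform [OF D1_in]
    and d2 = Hspace_vform [OF D2_in] and d3 = Hspace_vform [OF D3_in]
  define quo where "quo = (\<lambda>A B C D z. if z \<in> Hp then det4 (A z) (B z) (C z) (D z) / Omega z else 0)"
  have "quo G D1 D2 D3 \<in> Mk 4"
    unfolding quo_def by (rule det4_quotient_in_Mk [OF G_in D1_in D2_in D3_in]) (simp add: k1_\<Lambda>)
  then obtain \<epsilon> where \<epsilon>: "quo G D1 D2 D3 = (\<lambda>z. \<epsilon> * E4 z)" by (rule Mk_proportional [OF _ E4_in a(1)]) (simp_all add: a(2))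
  have "quo G F D2 D3 \<in> Mk 4"
    unfolding quo_def by (rule det4_quotient_in_Mk [OF G_in F_in D2_in D3_in]) (simp add: k1_\<Lambda>)
  then obtain \<beta> where \<beta>: "quo G F D2 D3 = (\<lambda>z. \<beta> * E4 z)" by (rule Mk_proportional [OF _ E4_in a(1)]) (simp_all add: a(2))
  have "quo F D1 D2 D3 \<in> Mk 6"
    unfolding quo_def by (rule det4_quotient_in_Mk [OF F_in D1_in D2_in D3_in]) (simp add: k1_\<Lambda>)
  then obtain \<alpha> where \<alpha>: "quo F D1 D2 D3 = (\<lambda>z. \<alpha> * E6 z)" by (rule Mk_proportional [OF _ E6_in b(1)]) (simp_all add: b(2))
  have "quo G D1 F D3 \<in> Mk 2"
    unfolding quo_def by (rule det4_quotient_in_Mk [OF G_in D1_in F_in D3_in]) (simp add: k1_\<Lambda>)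
  then have c0: "quo G D1 F D3 = (\<lambda>z. 0)" by (rule Mk_weight_2)
  have det: "det4 (G z) (D1 z) (D2 z) (D3 z) = \<epsilon> * E4 z * Omega z"
    "det4 (G z) (F z) (D2 z) (D3 z) = \<beta> * E4 z * Omega z"
    "det4 (F z) (D1 z) (D2 z) (D3 z) = \<alpha> * E6 z * Omega z"
    "det4 (G z) (D1 z) (F z) (D3 z) = 0" if "z \<in> Hp" for z
    using fun_cong [OF \<epsilon>, of z] fun_cong [OF \<beta>, of z] fun_cong [OF \<alpha>, of z] fun_cong [OF c0, of z] that Omega_nonzero [OF that]
    by (simp_all add: quo_def field_simps)
  have rel: "(\<epsilon> * E4 z) *s F z = (\<alpha> * E6 z) *s G z + (\<beta> * E4 z) *s D1 z" if z: "z \<in> Hp" for z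
  proof -
    have "det4 (G z) (D1 z) (D2 z) (F z) = 0"
      using W0 [OF z] det4_permute(1) [of "G z" "D1 z" "F z" "D2 z"] by simp
    with det4_cramer [of "G z" "D1 z" "D2 z" "D3 z" "F z"]
    have "(\<epsilon> * E4 z * Omega z) *s F z = (\<alpha> * E6 z * Omega z) *s G z + (\<beta> * E4 z * Omega z) *s D1 z"
      using det [OF z] by simp
    then have "Omega z *s ((\<epsilon> * E4 z) *s F z) = Omega z *s ((\<alpha> * E6 z) *s G z + (\<beta> * E4 z) *s D1 z)"
      by (simp add: vector_add_ldistrib vector_smult_assoc mult_ac)
    then show ?thesis using Omega_nonzero [OF z] by (simp only: vec.scale_left_imp_eq)
  qed
  have \<epsilon>0: "\<epsilon> \<noteq> 0" using h(3) det(1) by auto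
  \<comment> \<open>Otherwise the relation at \<open>rho0\<close> gives \<open>G rho0 = 0\<close>.
    Then the Wronskian of \<open>G\<close> and its derivative vanish there, the latter because of a
    repeated column, so \<open>E4\<close> has a double zero and \<open>E6 rho0 = 0\<close>, a
    contradiction.\<close>
  have "\<alpha> = 0"
  proof (rule ccontr)
    assume "\<alpha> \<noteq> 0"
    have E6: "E6 rho0 \<noteq> 0" by (rule E4_E6_no_common_zero [OF rho0_in E4_rho0])
    have "(\<alpha> * E6 rho0) *s G rho0 = 0" using rel [OF rho0_in] by (simp add: E4_rho0)
    then have G0: "G rho0 = 0" using \<open>\<alpha> \<noteq> 0\<close> E6 by simp
    define w where "w = (\<lambda>z. det4 (G z) (D1 z) (D2 z) (D3 z))"
    have "Dop (k1 + (k1 + 2) + (k1 + 4) + (k1 + 6)) w rho0 = 0"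
      unfolding w_def det4_Dop [OF vform_hol [OF g] vform_hol [OF d1] vform_hol [OF d2] vform_hol [OF d3] rho0_in] G0
      by (simp add: det4_repeat)
    moreover have "w rho0 = 0" by (simp add: w_def G0 det4_repeat)
    ultimately have "deriv w rho0 = 0" using rho0_in by (simp add: Dop_def)
    obtain C where C: "\<And>z. z \<in> Hp \<Longrightarrow> Omega z = C * etapow (12 * \<Lambda>) z" using Omega_etapow by auto
    have "(\<lambda>z. C * etapow (12 * \<Lambda>) z) holomorphic_on Hp" by (intro holomorphic_intros etapow_holomorphic)
    then have Oh: "Omega holomorphic_on Hp" by (rule holomorphic_transform) (simp add: C)
    note D = holomorphic_derivI [OF _ open_Hp rho0_in]
    have "((\<lambda>z. \<epsilon> * (E4 z * Omega z)) has_field_derivative \<epsilon> * (deriv E4 rho0 * Omega rho0 + deriv Omega rho0 * E4 rho0)) (at rho0)"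
      by (intro DERIV_cmult DERIV_mult D Mk_hol [OF E4_in] Oh)
    then have "(w has_field_derivative \<epsilon> * (deriv E4 rho0 * Omega rho0 + deriv Omega rho0 * E4 rho0)) (at rho0)"
      by (rule has_field_derivative_transform_Hp [OF _ rho0_in]) (simp add: w_def det(1) mult.assoc)
    then have "deriv w rho0 = \<epsilon> * (deriv E4 rho0 * Omega rho0 + deriv Omega rho0 * E4 rho0)" by (rule DERIV_imp_deriv)
    with \<open>deriv w rho0 = 0\<close> have "deriv E4 rho0 = 0"
      using \<epsilon>0 Omega_nonzero [OF rho0_in] by (simp add: E4_rho0)
    then have "E6 rho0 = 0" using rho0_in by (simp add: E6_def Dop_def E4_rho0)
    with E6 show False ..
  qed
  \<comment> \<open>Compare the terms at exponent \<open>lam i\<close> in component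
    \<open>i\<close>: \<open>F\<close> starts one power later and contributes 0, while
    \<open>D1\<close> contributes a nonzero multiple of \<open>lam i - k1 / 12\<close>.\<close>
  have "\<beta> = 0"
  proof -
    have l: "qexp (0 + lam i) (\<lambda>q. \<epsilon> * (a q * (q ^ (if i = i then 1 else 0) * g i q))) (\<lambda>z. \<epsilon> * (E4 z * F z $ i))"
      by (intro qexp_cmult qexp_mult a(1) F_qexp_lam)
    have r: "qexp (0 + lam i) (\<lambda>q. \<beta> * (a q * h1 i q)) (\<lambda>z. \<beta> * (E4 z * D1 z $ i))"
      by (intro qexp_cmult qexp_mult a(1) h1(1))
    have "\<beta> * (E4 z * D1 z $ i) = \<epsilon> * (E4 z * F z $ i)" if "z \<in> Hp" for z
      using arg_cong [OF rel [OF that], of "\<lambda>v. v $ i"] by (auto simp: \<open>\<alpha> = 0\<close> mult.assoc)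
    from qexp_unique [OF l qexp_cong [OF r this], of 0]
    have "\<beta> * h1 i 0 = 0" by (simp add: a(2))
    moreover have "h1 i 0 \<noteq> 0"
    proof -
      have "complex_of_real (lam i - k1 / 12) \<noteq> 0" using lam_i by (simp only: of_real_eq_0_iff right_minus_eq not_False_eq_True)
      then show ?thesis using h(2) by (simp add: h1(2))
    qed
    ultimately show ?thesis by simp
  qed
  obtain z where z: "z \<in> Hp" "E4 z \<noteq> 0" using E4_not_zero by blast
  have "F z = 0" using rel [OF z(1)] \<open>\<alpha> = 0\<close> \<open>\<beta> = 0\<close> \<epsilon>0 z(2) by simp
  then have "wronskian Pfun k F z = 0" by (simp add: wronskian_def det4_repeat)
  then show False using wronskian_F z(1) by auto
qed

text \<open>The total weight is 4 \<open>k1\<close> + 8 = 12 \<Lambda>, so the quotient by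
  \<open>Omega\<close> has weight 0 and is constant on \<open>Hp\<close>.\<close>

lemma W_Omega: "\<exists>C. C \<noteq> 0 \<and> (\<forall>z\<in>Hp. det4 (G z) (D1 z) (F z) (D2 z) = C * Omega z)"
proof -
  define f where "f = (\<lambda>z. if z \<in> Hp then det4 (G z) (D1 z) (F z) (D2 z) / Omega z else 0)"
  have f: "f \<in> Mk 0"
    unfolding f_def
    by (rule det4_quotient_in_Mk [OF G_in D1_in F_in D2_in]) (simp add: k1_\<Lambda>)
  have one: "qexp 0 (\<lambda>q. 1) (\<lambda>z. if z \<in> Hp then 1 else 0)" by (rule qexp_cong [OF qexp_const]) simp
  obtain c where "f = (\<lambda>z. c * (if z \<in> Hp then 1 else 0))"
    by (rule Mk_proportional [OF f Mk_one one]) simp_all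
  then have eq: "f z = c * (if z \<in> Hp then 1 else 0)" for z by simp
  have "det4 (G z) (D1 z) (F z) (D2 z) = c * Omega z" if "z \<in> Hp" for z
    using eq [of z] that Omega_nonzero [OF that] by (simp add: f_def field_simps)
  then show ?thesis using W_nonzero by (intro exI [of _ c]) auto
qed

lemma basis_unique:
  assumes "a \<in> Mk n1" "b \<in> Mk n2" "c \<in> Mk n3" "d \<in> Mk n4"
    and "\<And>z. a z *s G z + b z *s D1 z + c z *s F z + d z *s D2 z = 0"
  shows "a = 0 \<and> b = 0 \<and> c = 0 \<and> d = 0"
proof -
  have "a z = 0 \<and> b z = 0 \<and> c z = 0 \<and> d z = 0" for z
  proof (cases "z \<in> Hp")
    case True
    then have "det4 (G z) (D1 z) (F z) (D2 z) \<noteq> 0" using W_Omega Omega_nonzero by auto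
    then show ?thesis using assms(5) by (rule det4_combination)
  qed (use assms in \<open>simp add: Mk_outside\<close>)
  then show ?thesis by (simp add: fun_eq_iff)
qed

text \<open>Dividing Cramer's rule by the nowhere vanishing determinant keeps the coefficients
  holomorphic. Substituting \<open>H\<close> for a generator of degree d changes the weight by n -
  d.\<close>

lemma basis_exists:
  assumes H: "H \<in> \<H> (k1 + of_int n)"
  shows "\<exists>a\<in>Mk n. \<exists>b\<in>Mk (n - 2). \<exists>c\<in>Mk (n - 2). \<exists>d\<in>Mk (n - 4).
    H = (\<lambda>z. a z *s G z + b z *s D1 z + c z *s F z + d z *s D2 z)"
proof -
  obtain C where C: "C \<noteq> 0" "\<And>z. z \<in> Hp \<Longrightarrow> det4 (G z) (D1 z) (F z) (D2 z) = C * Omega z"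
    using W_Omega by auto
  define quo where "quo = (\<lambda>A B C D z. if z \<in> Hp then det4 (A z) (B z) (C z) (D z) / Omega z else 0)"
  define co where "co = (\<lambda>(q :: complex \<Rightarrow> complex) z. 1 / C * q z)"
  have 1: "co (quo H D1 F D2) \<in> Mk n"
    unfolding co_def quo_def by (rule Mk_cmult, rule det4_quotient_in_Mk [OF H D1_in F_in D2_in]) (simp add: k1_\<Lambda>)
  have 2: "co (quo G H F D2) \<in> Mk (n - 2)"
    unfolding co_def quo_def by (rule Mk_cmult, rule det4_quotient_in_Mk [OF G_in H F_in D2_in]) (simp add: k1_\<Lambda>)
  have 3: "co (quo G D1 H D2) \<in> Mk (n - 2)"
    unfolding co_def quo_def by (rule Mk_cmult, rule det4_quotient_in_Mk [OF G_in D1_in H D2_in]) (simp add: k1_\<Lambda>)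
  have 4: "co (quo G D1 F H) \<in> Mk (n - 4)"
    unfolding co_def quo_def by (rule Mk_cmult, rule det4_quotient_in_Mk [OF G_in D1_in F_in H]) (simp add: k1_\<Lambda>)
  have "H z = co (quo H D1 F D2) z *s G z + co (quo G H F D2) z *s D1 z + co (quo G D1 H D2) z *s F z + co (quo G D1 F H) z *s D2 z" for z
  proof (cases "z \<in> Hp")
    case True
    have c0: "C * Omega z \<noteq> 0" using C(1) Omega_nonzero [OF True] by simp
    have "(1 / (C * Omega z)) *s ((C * Omega z) *s H z) = (1 / (C * Omega z)) *s (det4 (H z) (D1 z) (F z) (D2 z) *s G z
        + det4 (G z) (H z) (F z) (D2 z) *s D1 z + det4 (G z) (D1 z) (H z) (D2 z) *s F z + det4 (G z) (D1 z) (F z) (H z) *s D2 z)"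
      using det4_cramer [of "G z" "D1 z" "F z" "D2 z" "H z"] unfolding C(2) [OF True] by simp
    then show ?thesis
      using c0 True by (simp add: vector_add_ldistrib vector_smult_assoc co_def quo_def mult.commute)
  qed (simp add: Hspace_outside [OF H] co_def quo_def)
  then show ?thesis using 1 2 3 4 by blast
qed

lemma combination_in:
  assumes "a \<in> Mk n" "b \<in> Mk (n - 2)" "c \<in> Mk (n - 2)" "d \<in> Mk (n - 4)"
  shows "(\<lambda>z. a z *s G z + b z *s D1 z + c z *s F z + d z *s D2 z) \<in> \<H> (k1 + of_int n)"
proof -
  have "k1 + 2 + of_int (n - 2) = k1 + of_int n" "k1 + 4 + of_int (n - 4) = k1 + of_int n" by simp_all
  then show ?thesis
    using Hspace_mult [OF assms(1) G_in] Hspace_mult [OF assms(2) D1_in] Hspace_mult [OF assms(3) F_in]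
      Hspace_mult [OF assms(4) D2_in]
    by (intro Hspace_add) simp_all
qed

section \<open>The graded module and its dimensions\<close>

lemma zero_in_Hspace: "0 \<in> \<H> l"
  using Hspace_add [of 0 l 0] HspaceI [of l "\<lambda>z. 0" "\<lambda>_ _. 0"]
  by (simp add: vform_def qexp_zero zero_fun_def)

lemma homog_in_Hgr:
  assumes "H \<in> \<H> (k1 + of_int d)" shows "homog d H \<in> Hgr k1 \<rho> \<upsilon>"
proof -
  have "{n. homog d H n \<noteq> 0} \<subseteq> {d}" by (auto simp: homog_def)
  then have "finite {n. homog d H n \<noteq> 0}" by (rule finite_subset) simp
  then show ?thesis using assms zero_in_Hspace by (auto simp: Hgr_def homog_def)
qed

lemma gmult_homog:
  assumes "a \<in> Mgr" shows "gmult a (homog d H) n z = a (n - d) z *s H z"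
proof -
  have fin: "finite {j. a j \<noteq> 0}" using assms by (simp add: Mgr_def)
  have "gmult a (homog d H) n z = (\<Sum>j\<in>{j. a j \<noteq> 0}. if j = n - d then a (n - d) z *s H z else 0)"
    unfolding gmult_def by (rule sum.cong) (auto simp: homog_def)
  also have "\<dots> = a (n - d) z *s H z" using fin by (simp add: sum.delta zero_fun_def)
  finally show ?thesis .
qed

abbreviation (input) "gens \<equiv> [homog 0 G, homog 2 D1, homog 2 F, homog 4 D2]"

lemma gmult_gens:
  assumes "\<forall>i<length gens. a i \<in> Mgr"
  shows "(\<Sum>i<length gens. gmult (a i) (gens ! i)) n z =
    a 0 n z *s G z + a 1 (n - 2) z *s D1 z + a 2 (n - 2) z *s F z + a 3 (n - 4) z *s D2 z"
proof -
  have m: "a 0 \<in> Mgr" "a 1 \<in> Mgr" "a 2 \<in> Mgr" "a 3 \<in> Mgr" using assms by simp_all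
  have *: "(\<Sum>i<length gens. gmult (a i) (gens ! i)) =
      gmult (a 0) (homog 0 G) + gmult (a 1) (homog 2 D1) + gmult (a 2) (homog 2 F) + gmult (a 3) (homog 4 D2)"
    by (simp add: eval_nat_numeral)
  show ?thesis unfolding * using m by (simp add: gmult_homog)
qed

lemma M_basis: "is_M_basis k1 \<rho> \<upsilon> gens"
  unfolding is_M_basis_def
proof (intro conjI ballI allI impI)
  fix b assume "b \<in> set gens"
  then consider "b = homog 0 G" | "b = homog 2 D1" | "b = homog 2 F" | "b = homog 4 D2" by auto
  then show "b \<in> Hgr k1 \<rho> \<upsilon>"
    by cases (use G_in D1_in F_in D2_in in \<open>auto intro!: homog_in_Hgr\<close>)
next
  fix h assume h: "h \<in> Hgr k1 \<rho> \<upsilon>"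
  then have fin: "finite {n. h n \<noteq> 0}" and hn: "h n \<in> \<H> (k1 + of_int n)" for n
    by (auto simp: Hgr_def)
  define P where "P = (\<lambda>n (a, b, c, d). a \<in> Mk n \<and> b \<in> Mk (n - 2) \<and> c \<in> Mk (n - 2) \<and> d \<in> Mk (n - 4) \<and>
      h n = (\<lambda>z. a z *s G z + b z *s D1 z + c z *s F z + d z *s D2 z))"
  have "\<forall>n. \<exists>p. P n p"
  proof
    fix n
    obtain a b c d where "a \<in> Mk n" "b \<in> Mk (n - 2)" "c \<in> Mk (n - 2)" "d \<in> Mk (n - 4)"
      "h n = (\<lambda>z. a z *s G z + b z *s D1 z + c z *s F z + d z *s D2 z)" using basis_exists [OF hn] by blast
    then show "\<exists>p. P n p" by (intro exI [of _ "(a, b, c, d)"]) (simp add: P_def)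
  qed
  from choice [OF this] obtain p where p: "\<forall>n. P n (p n)" ..
  define a b c d where "a = (\<lambda>n. fst (p n))" and "b = (\<lambda>n. fst (snd (p n)))"
    and "c = (\<lambda>n. fst (snd (snd (p n))))" and "d = (\<lambda>n. snd (snd (snd (p n))))"
  have abcd: "a n \<in> Mk n" "b n \<in> Mk (n - 2)" "c n \<in> Mk (n - 2)" "d n \<in> Mk (n - 4)"
    "h n = (\<lambda>z. a n z *s G z + b n z *s D1 z + c n z *s F z + d n z *s D2 z)" for n
    using spec [OF p, of n] by (simp_all add: P_def a_def b_def c_def d_def split_beta)
  \<comment> \<open>Uniqueness makes the chosen coefficients vanish wherever \<open>h n = 0\<close>,
    which yields the finite support required by \<open>Mgr\<close>.\<close>
  have zero: "a n = 0 \<and> b n = 0 \<and> c n = 0 \<and> d n = 0" if "h n = 0" for n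
  proof (rule basis_unique [OF abcd(1-4)])
    show "a n z *s G z + b n z *s D1 z + c n z *s F z + d n z *s D2 z = 0" for z
      using fun_cong [OF abcd(5) [of n], of z] that by simp
  qed
  \<comment> \<open>A generator of degree d contributes to degree n through the coefficient of
    degree n - d, hence the shifts by 2 and 4.\<close>
  define A where "A = (\<lambda>i::nat. if i = 0 then a else if i = 1 then (\<lambda>n. b (n + 2))
      else if i = 2 then (\<lambda>n. c (n + 2)) else (\<lambda>n. d (n + 4)))"
  have fin': "finite {n. u (n + t) \<noteq> 0}" if "\<And>n. h n = 0 \<Longrightarrow> u n = 0" for u :: "int \<Rightarrow> complex \<Rightarrow> complex" and t
  proof (rule finite_subset)
    show "{n. u (n + t) \<noteq> 0} \<subseteq> (\<lambda>n. n - t) ` {n. h n \<noteq> 0}"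
    proof
      fix n assume "n \<in> {n. u (n + t) \<noteq> 0}"
      then have "h (n + t) \<noteq> 0" using that by auto
      then show "n \<in> (\<lambda>n. n - t) ` {n. h n \<noteq> 0}" by (intro image_eqI [of _ _ "n + t"]) auto
    qed
  qed (use fin in simp)
  have "a \<in> Mgr" using fin' [of a 0] zero abcd(1) by (simp add: Mgr_def)
  moreover have "(\<lambda>n. b (n + 2)) \<in> Mgr"
    using fin' [of b 2] zero abcd(2) [of "n + 2" for n] by (simp add: Mgr_def)
  moreover have "(\<lambda>n. c (n + 2)) \<in> Mgr"
    using fin' [of c 2] zero abcd(3) [of "n + 2" for n] by (simp add: Mgr_def)
  moreover have "(\<lambda>n. d (n + 4)) \<in> Mgr"
    using fin' [of d 4] zero abcd(4) [of "n + 4" for n] by (simp add: Mgr_def)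
  ultimately have A: "A i \<in> Mgr" for i by (simp add: A_def)
  have hA: "h = (\<Sum>i<length gens. gmult (A i) (gens ! i))"
  proof (intro ext)
    fix n z
    have "(\<Sum>i<length gens. gmult (A i) (gens ! i)) n z =
        A 0 n z *s G z + A 1 (n - 2) z *s D1 z + A 2 (n - 2) z *s F z + A 3 (n - 4) z *s D2 z"
      by (rule gmult_gens) (use A in blast)
    then show "h n z = (\<Sum>i<length gens. gmult (A i) (gens ! i)) n z"
      using fun_cong [OF abcd(5) [of n], of z] by (simp add: A_def)
  qed
  show "\<exists>a. (\<forall>i<length gens. a i \<in> Mgr) \<and> h = (\<Sum>i<length gens. gmult (a i) (gens ! i))"
    by (rule exI [of _ A], intro conjI allI impI A, rule hA)
next
  fix a i assume a: "(\<forall>i<length gens. a i \<in> Mgr) \<and> (\<Sum>i<length gens. gmult (a i) (gens ! i)) = 0"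
    and i: "i < length gens"
  have M: "a j n \<in> Mk n" if "j < 4" for j n using a that by (simp add: Mgr_def)
  have z: "a 0 n = 0 \<and> a 1 (n - 2) = 0 \<and> a 2 (n - 2) = 0 \<and> a 3 (n - 4) = 0" for n
  proof (rule basis_unique [OF M M M M])
    fix z
    show "a 0 n z *s G z + a 1 (n - 2) z *s D1 z + a 2 (n - 2) z *s F z + a 3 (n - 4) z *s D2 z = 0"
      unfolding gmult_gens [OF conjunct1 [OF a], of n z, symmetric] conjunct2 [OF a] by simp
  qed simp_all
  have "a 0 n = 0 \<and> a 1 n = 0 \<and> a 2 n = 0 \<and> a 3 n = 0" for n
    using z [of n] z [of "n + 2"] z [of "n + 4"] by simp
  moreover have "i = 0 \<or> i = 1 \<or> i = 2 \<or> i = 3" using i by auto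
  ultimately show "a i = 0" by (auto simp: fun_eq_iff)
qed

text \<open>The coefficient forms have weights 2n, 2n - 2, 2n - 2, 2n - 4. The fourfold direct sum
  is assembled in pairs.\<close>

lemma dim_Hspace: "cdim (\<H> (k1 + 2 * real n)) = mdim (int n) + mdim (int n - 1) + (mdim (int n - 1) + mdim (int n - 2))"
proof -
  let ?sc = "\<lambda>(c::complex) (H :: complex \<Rightarrow> complex^4) z. c *s H z"
  let ?n = "2 * int n"
  have e: "2 * (int n - 1) = ?n - 2" "2 * (int n - 2) = ?n - 4" by simp_all
  obtain e0 e1 e2 where e0: "coords sscale (Mk ?n) (mdim (int n)) e0"
    and e1: "coords sscale (Mk (?n - 2)) (mdim (int n - 1)) e1" and e2: "coords sscale (Mk (?n - 4)) (mdim (int n - 2)) e2"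
    using Mk_dim [of "int n"] Mk_dim [of "int n - 1"] Mk_dim [of "int n - 2"] unfolding e by blast
  define W1 where "W1 = {(\<lambda>z. a z *s G z) + (\<lambda>z. b z *s D1 z) | a b. a \<in> Mk ?n \<and> b \<in> Mk (?n - 2)}"
  define W2 where "W2 = {(\<lambda>z. a z *s F z) + (\<lambda>z. b z *s D2 z) | a b. a \<in> Mk (?n - 2) \<and> b \<in> Mk (?n - 4)}"
  define W where "W = {x + y | x y. x \<in> W1 \<and> y \<in> W2}"
  have uniq: "a = 0 \<and> b = 0 \<and> c = 0 \<and> d = 0"
    if "a \<in> Mk ?n" "b \<in> Mk (?n - 2)" "c \<in> Mk (?n - 2)" "d \<in> Mk (?n - 4)"
      "((\<lambda>z. a z *s G z) + (\<lambda>z. b z *s D1 z)) + ((\<lambda>z. c z *s F z) + (\<lambda>z. d z *s D2 z)) = 0" for a b c d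
  proof (rule basis_unique [OF that(1-4)])
    show "a z *s G z + b z *s D1 z + c z *s F z + d z *s D2 z = 0" for z
      using fun_cong [OF that(5), of z] by (simp add: add.assoc)
  qed
  have z0: "(\<lambda>z. (0 :: complex \<Rightarrow> complex) z *s H z) = 0" for H :: "complex \<Rightarrow> complex^4"
    by (simp add: fun_eq_iff)
  have lin: "(\<lambda>z. (x + y) z *s H z) = (\<lambda>z. x z *s H z) + (\<lambda>z. y z *s H z)"
    "(\<lambda>z. (sscale c x) z *s H z) = ?sc c (\<lambda>z. x z *s H z)" for x y :: "complex \<Rightarrow> complex" and c and H :: "complex \<Rightarrow> complex^4"
    by (simp_all add: fun_eq_iff vector_sadd_rdistrib vector_smult_assoc)
  have sc: "?sc c (x + y) = ?sc c x + ?sc c y" for c x y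
    by (simp add: fun_eq_iff vector_add_ldistrib)
  have "\<exists>e. coords ?sc W1 (mdim (int n) + mdim (int n - 1)) e"
    by (rule coords_direct_sum [OF e0 e1 z0 [of G] lin(1) lin(2) z0 [of D1] lin(1) lin(2) W1_def sc])
      (use uniq [of _ _ 0 0] Mk_subspace(1) z0 in auto)
  then obtain c1 where c1: "coords ?sc W1 (mdim (int n) + mdim (int n - 1)) c1" ..
  have "\<exists>e. coords ?sc W2 (mdim (int n - 1) + mdim (int n - 2)) e"
    by (rule coords_direct_sum [OF e1 e2 z0 [of F] lin(1) lin(2) z0 [of D2] lin(1) lin(2) W2_def sc])
      (use uniq [of 0 0] Mk_subspace(1) z0 in auto)
  then obtain c2 where c2: "coords ?sc W2 (mdim (int n - 1) + mdim (int n - 2)) c2" ..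
  have "\<exists>e. coords ?sc W (mdim (int n) + mdim (int n - 1) + (mdim (int n - 1) + mdim (int n - 2))) e"
  proof (rule coords_direct_sum [OF c1 c2, where T = "\<lambda>x. x" and U = "\<lambda>x. x"])
    show "W = {x + y | x y. x \<in> W1 \<and> y \<in> W2}" by (rule W_def)
    show "?sc c (x + y) = ?sc c x + ?sc c y" for c x y by (rule sc)
    fix x y assume "x \<in> W1" "y \<in> W2" and 0: "x + y = 0"
    then obtain a b c d where *: "x = (\<lambda>z. a z *s G z) + (\<lambda>z. b z *s D1 z)" "y = (\<lambda>z. c z *s F z) + (\<lambda>z. d z *s D2 z)"
      "a \<in> Mk ?n" "b \<in> Mk (?n - 2)" "c \<in> Mk (?n - 2)" "d \<in> Mk (?n - 4)" unfolding W1_def W2_def by blast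
    have "a = 0 \<and> b = 0 \<and> c = 0 \<and> d = 0" by (rule uniq [OF *(3-6)]) (use 0 * in simp)
    then show "x = 0 \<and> y = 0" unfolding * using z0 by simp
  qed simp_all
  moreover have "W = \<H> (k1 + 2 * real n)"
  proof -
    have k: "k1 + 2 * real n = k1 + of_int ?n" by simp
    show ?thesis unfolding k
    proof (intro equalityI subsetI)
      fix H assume "H \<in> W"
      then obtain a b c d where *: "H = ((\<lambda>z. a z *s G z) + (\<lambda>z. b z *s D1 z)) + ((\<lambda>z. c z *s F z) + (\<lambda>z. d z *s D2 z))"
        "a \<in> Mk ?n" "b \<in> Mk (?n - 2)" "c \<in> Mk (?n - 2)" "d \<in> Mk (?n - 4)" unfolding W_def W1_def W2_def by blast
      have "H = (\<lambda>z. a z *s G z + b z *s D1 z + c z *s F z + d z *s D2 z)"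
        by (simp add: *(1) fun_eq_iff add.assoc)
      then show "H \<in> \<H> (k1 + of_int ?n)" using combination_in [OF *(2-5)] by (simp only:)
    next
      fix H assume "H \<in> \<H> (k1 + of_int ?n)"
      then obtain a b c d where *: "a \<in> Mk ?n" "b \<in> Mk (?n - 2)" "c \<in> Mk (?n - 2)" "d \<in> Mk (?n - 4)"
        "H = (\<lambda>z. a z *s G z + b z *s D1 z + c z *s F z + d z *s D2 z)" using basis_exists by blast
      have "H = ((\<lambda>z. a z *s G z) + (\<lambda>z. b z *s D1 z)) + ((\<lambda>z. c z *s F z) + (\<lambda>z. d z *s D2 z))"
        by (simp add: *(5) fun_eq_iff add.assoc)
      then show "H \<in> W" unfolding W_def W1_def W2_def using *(1-4) by blast
    qed
  qed
  moreover have "vector_space ?sc"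
    by unfold_locales (simp_all add: fun_eq_iff vector_add_ldistrib vector_sadd_rdistrib vector_smult_assoc)
  ultimately show ?thesis unfolding cdim_def using coords_imp_dim by blast
qed

end

text \<open>Both sides grow by 4 when \<open>n\<close> grows by 6, so six initial values
  suffice.\<close>

lemma mdim_sum: "mdim (int n) + mdim (int n - 1) + (mdim (int n - 1) + mdim (int n - 2)) = nat (\<lfloor>(2 * real n + 1) / 3\<rfloor> + 1)"
proof -
  have fl: "\<lfloor>(2 * real n + 1) / 3\<rfloor> = (2 * int n + 1) div 3" for n
    using floor_divide_of_int_eq [of "2 * int n + 1" 3, where 'a = real] by simp
  \<comment> \<open>The arguments -1 and -2 occur for \<open>n < 2\<close> and obey the recursion
    because \<open>mdim\<close> is 1 at 5 and 4.\<close>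
  have step: "mdim (j + 6) = mdim j + 1" if "j \<ge> - 2" for j
  proof (cases "j < 0")
    case True
    then have "j = - 1 \<or> j = - 2" using that by linarith
    then show ?thesis by (auto simp: mdim_def)
  qed (simp add: mdim_def nat_add_distrib)
  show ?thesis unfolding fl
  proof (induction n rule: less_induct)
    case (less n)
    show ?case
    proof (cases "n < 6")
      case True
      then consider "n = 0" | "n = 1" | "n = 2" | "n = 3" | "n = 4" | "n = 5" by linarith
      then show ?thesis by cases (simp_all add: mdim_def)
    next
      case False
      define l where "l = n - 6"
      have n: "int n = int l + 6" using False by (simp add: l_def)
      have "l < n" using False by (simp add: l_def)
      from less.IH [OF this] show ?thesis
        using step [of "int l"] step [of "int l - 1"] step [of "int l - 2"]
        unfolding n by (simp add: algebra_simps nat_add_distrib)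
    qed
  qed
qed

section \<open>The main theorem\<close>

text \<open>Translates the index type \<open>4\<close>, in which the numeral 4 equals 0, into the
  naturals 1 to 4.\<close>

definition idx :: "4 \<Rightarrow> nat" where
  "idx j = (if j = 1 then 1 else if j = 2 then 2 else if j = 3 then 3 else 4)"

lemma idx_simps [simp]: "idx 1 = 1" "idx 2 = 2" "idx 3 = 3" "idx 4 = 4"
  by (simp_all add: idx_def)

lemma idx_inj: "inj idx"
  unfolding inj_def forall_4 by simp

lemma idx_range: "range idx = {1..4}"
  by (auto simp: UNIV_4 eval_nat_numeral atLeastAtMostSuc_conv)

lemma idx_in: "idx j \<in> {1..4}"
  using idx_range by blast

text \<open>The points \<open>qpow 1 z\<close> fill the punctured disc and convergence at 0 is
  trivial, so the power series is holomorphic in the whole disc. The subtracted 1 is its term of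
  index 0.\<close>

lemma qexp_of_sums:
  assumes "\<And>z. z \<in> Hp \<Longrightarrow> (\<lambda>n. b (Suc n) * qpow 1 z ^ Suc n) sums (f z / qpow (of_real s) z - 1)"
  obtains g where "qexp s g f" "g 0 = 1"
proof
  define a where "a = (\<lambda>n. if n = 0 then 1 else b n)"
  define g where "g = (\<lambda>q. \<Sum>n. a n * q ^ n)"
  have s: "(\<lambda>n. a n * qpow 1 z ^ n) sums (f z / qpow (of_real s) z)" if "z \<in> Hp" for z
    using assms [OF that] sums_Suc_iff [of "\<lambda>n. a n * qpow 1 z ^ n" "f z / qpow (of_real s) z - 1"]
    by (simp add: a_def)
  have "(\<lambda>n. a n * (q - 0) ^ n) sums g q" if q: "q \<in> ball 0 1" for q
  proof (cases "q = 0")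
    case True
    have "(\<lambda>n. a n * q ^ n) sums (\<Sum>n\<in>{0}. a n * q ^ n)"
      by (rule sums_finite) (auto simp: True)
    then show ?thesis unfolding g_def by (simp add: sums_iff)
  next
    case False
    then obtain z where "z \<in> Hp" "qpow 1 z = q" by (rule qpow_1_surj [OF q])
    then show ?thesis using s [of z] unfolding g_def by (auto simp: sums_iff)
  qed
  then have "g holomorphic_on ball 0 1" by (rule power_series_holomorphic)
  moreover have "f z = qpow (of_real s) z * g (qpow 1 z)" if "z \<in> Hp" for z
    using s [OF that] by (simp add: g_def sums_iff)
  ultimately show "qexp s g f" by (simp add: qexp_def)
  show "g 0 = 1" by (simp add: g_def a_def)
qed

lemma Dpow_expand:
  "Dpow 4 k f = Dop (k + 6) (Dop (k + 4) (Dop (k + 2) (Dop k f)))"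
  "Dpow 2 k f = Dop (k + 2) (Dop k f)" "Dpow 1 k f = Dop k f"
  by (simp_all add: eval_nat_numeral)

lemma DpowV_expand: "DpowV 2 k F = DopV (k + 2) (DopV k F)" "DpowV 1 k F = DopV k F"
  by (simp_all add: eval_nat_numeral)

theorem theorem4p18:
  fixes \<rho> \<rho>1 :: "sl2 \<Rightarrow> complex^4^4"
    and \<upsilon> :: "sl2 \<Rightarrow> complex"
    and m k0 k1 :: real
    and r lam :: "nat \<Rightarrow> real"
    and i :: nat
    and M4 M6 M8 :: "complex \<Rightarrow> complex"
    and f :: "nat \<Rightarrow> complex \<Rightarrow> complex"
    and b :: "nat \<Rightarrow> nat \<Rightarrow> complex"
    and F1 G :: "complex \<Rightarrow> complex^4"
  assumes rho_rep: "rep \<rho>"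
    and rho_Tdet: "T_determined \<rho>"
    and rho_Tunit: "T_unitarizable \<rho>"
    and r_range: "0 \<le> r 1" "r 1 < r 2" "r 2 < r 3" "r 3 < r 4" "r 4 < 1"
    and eigs: "eigvals (\<rho> Tmat) = ee ` r ` {1..4}"
    and ups: "mult_sys k1 \<upsilon>"
    and cusp: "cusp_param \<upsilon> m"
    and lam: "\<forall>j\<in>{1..4}. 0 \<le> lam j \<and> lam j < 1 \<and> lam j - r j - m / 12 \<in> \<int>"
    and k0_def: "k0 = 3 * (\<Sum>j\<in>{1..4}. lam j) - 3"
    and k1_def: "k1 = k0 + 1"
    and i_range: "i \<in> {1..4}"
    and i_lam: "lam i \<noteq> k1 / 12"
    and M_forms: "M4 \<in> Mk 4" "M6 \<in> Mk 6" "M8 \<in> Mk 8"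
    and indicial: "has_indicial_roots (k0 + 3) M4 M6 M8 (\<lambda>j. lam j + (if j = i then 1 else 0))"
    and f_sol: "\<forall>j\<in>{1..4}. \<forall>z\<in>Hp. L4 (k0 + 3) M4 M6 M8 (f j) z = 0"
    and f_exp: "\<forall>j\<in>{1..4}. \<forall>z\<in>Hp.
                  (\<lambda>n. b j (Suc n) * qpow 1 z ^ Suc n) sums
                  (f j z / qpow (of_real (lam j + (if j = i then 1 else 0))) z - 1)"
    and F1_def: "F1 = (\<lambda>z. if z \<in> Hp then vector [f 1 z, f 2 z, f 3 z, f 4 z] else 0)"
    and rho1_rep: "rep \<rho>1"
    and rho1_F1: "\<forall>\<gamma>\<in>SL2Z. \<forall>z\<in>Hp. slashV (k0 + 3) \<upsilon> \<gamma> F1 z = \<rho>1 \<gamma> *v F1 z"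
    and G_in: "G \<in> Hspace k1 \<rho>1 \<upsilon>"
    and G_nz: "G \<noteq> 0"
  shows "is_M_basis k1 \<rho>1 \<upsilon>
           [homog 0 G, homog 2 (DpowV 1 k1 G), homog 2 F1, homog 4 (DpowV 2 k1 G)]
         \<and> (\<forall>k::nat. cdim (Hspace (k1 + 2 * real k) \<rho>1 \<upsilon>) = nat (\<lfloor>(2 * real k + 1) / 3\<rfloor> + 1))"
proof -
  define k where "k = k0 + 3"
  have k1k: "k1 = k - 2" by (simp add: k1_def k_def)
  define lamc where "lamc = (\<lambda>j. lam (idx j))"
  obtain ic where ic: "idx ic = i" using i_range idx_range by (metis imageE)
  have delta: "lam (idx j) + (if idx j = i then 1 else 0) = lamc j + (if j = ic then 1 else 0)" for j
    using idx_inj ic by (auto simp: lamc_def inj_eq)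
  have F1_nth: "F1 z $ j = f (idx j) z" if "z \<in> Hp" for z j
    using that exhaust_4 [of j] by (auto simp: F1_def)
  have unit: "norm (\<upsilon> \<gamma>) = 1" if "\<gamma> \<in> SL2Z" for \<gamma>
    using ups that by (simp add: mult_sys_def)
  have unz: "\<upsilon> \<gamma> \<noteq> 0" if "\<gamma> \<in> SL2Z" for \<gamma> using unit [OF that] by auto
  have "\<exists>g. qexp (lamc j + (if j = ic then 1 else 0)) g (\<lambda>z. F1 z $ j) \<and> g 0 = 1" for j
  proof -
    have "\<And>z. z \<in> Hp \<Longrightarrow> (\<lambda>n. b (idx j) (Suc n) * qpow 1 z ^ Suc n) sums
        (f (idx j) z / qpow (of_real (lamc j + (if j = ic then 1 else 0))) z - 1)"
      using f_exp idx_in [of j] unfolding delta [symmetric] by blast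
    then obtain g where g: "qexp (lamc j + (if j = ic then 1 else 0)) g (f (idx j))" "g 0 = 1"
      by (rule qexp_of_sums)
    have "qexp (lamc j + (if j = ic then 1 else 0)) g (\<lambda>z. F1 z $ j)"
      by (rule qexp_cong [OF g(1)]) (simp add: F1_nth)
    then show ?thesis using g(2) by blast
  qed
  then obtain g where g: "\<And>j. qexp (lamc j + (if j = ic then 1 else 0)) (g j) (\<lambda>z. F1 z $ j)" "\<And>j. g j 0 = 1"
    by metis
  have r_mono: "r (idx a) < r (idx b) \<or> r (idx b) < r (idx a)" if "a \<noteq> b" for a b
    using that exhaust_4 [of a] exhaust_4 [of b] r_range by auto
  have r_bounds: "0 \<le> r (idx a)" "r (idx a) < 1" for a
    using exhaust_4 [of a] r_range by auto
  have lam': "0 \<le> lamc j" "lamc j < 1" "lamc j - r (idx j) - m / 12 \<in> \<int>" for j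
    using lam idx_in [of j] by (auto simp: lamc_def)
  \<comment> \<open>Modulo the integers the \<open>lamc\<close> are a common shift of the
    \<open>r\<close>, which are distinct in [0,1).\<close>
  have lamc_inj: "inj lamc"
  proof (rule injI, rule ccontr)
    fix a b assume eq: "lamc a = lamc b" and "a \<noteq> b"
    have "(lamc b - r (idx b) - m / 12) - (lamc a - r (idx a) - m / 12) \<in> \<int>" by (intro Ints_diff lam')
    then have "r (idx a) - r (idx b) \<in> \<int>" by (simp add: eq)
    then obtain n where n: "r (idx a) - r (idx b) = of_int n" by (auto elim: Ints_cases)
    have "\<bar>r (idx a) - r (idx b)\<bar> < 1" using r_bounds [of a] r_bounds [of b] by linarith
    then have "n = 0" unfolding n by linarith
    then show False using n r_mono [OF \<open>a \<noteq> b\<close>] by auto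
  qed
  have k_eq: "k = 3 * (\<Sum>j\<in>UNIV. lamc j)"
  proof -
    have "(\<Sum>j\<in>{1..4}. lam j) = (\<Sum>j\<in>UNIV. lamc j)"
      unfolding idx_range [symmetric] lamc_def by (simp add: sum.reindex [OF idx_inj] o_def)
    then show ?thesis by (simp add: k_def k0_def)
  qed
  have form: "vform k \<rho>1 \<upsilon> F1"
    unfolding vform_def
  proof (intro conjI allI ballI)
    show "(\<lambda>z. F1 z $ j) holomorphic_on Hp" for j by (rule qexp_holomorphic [OF g(1)])
    fix \<gamma> z assume gz: "\<gamma> \<in> SL2Z" "z \<in> Hp"
    show "F1 (moeb \<gamma> z) = (\<upsilon> \<gamma> * jfac \<gamma> z powr of_real k) *s (\<rho>1 \<gamma> *v F1 z)"
    proof (rule iffD1 [OF slashV_eq_iff [where \<upsilon> = \<upsilon>, OF gz unz [OF gz(1)]]])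
      show "slashV k \<upsilon> \<gamma> F1 z = \<rho>1 \<gamma> *v F1 z" using rho1_F1 gz unfolding k_def by blast
    qed
  qed
  have Dnth: "Dop l (\<lambda>z. H z $ j) = (\<lambda>z. DopV l H z $ j)" for l j and H :: "complex \<Rightarrow> complex^4"
    by (simp add: DopV_def)
  \<comment> \<open>The MLDE solved for the fourth derivative; the coefficients - M4, - M6, - M8 are
    the same in every component.\<close>
  have ode: "\<exists>x y w. DopV (k + 6) (DopV (k + 4) (DopV (k + 2) (DopV k F1))) z =
       x *s DopV (k + 2) (DopV k F1) z + y *s DopV k F1 z + w *s F1 z" if z: "z \<in> Hp" for z
  proof (intro exI)
    have "DopV (k + 6) (DopV (k + 4) (DopV (k + 2) (DopV k F1))) z $ j =
       - M4 z * DopV (k + 2) (DopV k F1) z $ j + - M6 z * DopV k F1 z $ j + - M8 z * F1 z $ j" for j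
    proof -
      have D: "Dop k (f (idx j)) = (\<lambda>z. DopV k F1 z $ j)"
        unfolding Dnth [symmetric] Dop_eq_Dgen by (rule Dgen_cong) (simp_all add: F1_nth)
      have "L4 k M4 M6 M8 (f (idx j)) z = 0" using f_sol idx_in [of j] z unfolding k_def by blast
      then show ?thesis
        unfolding L4_def Dpow_expand D Dnth F1_nth [OF z] by (simp add: algebra_simps add_eq_0_iff)
    qed
    then show "DopV (k + 6) (DopV (k + 4) (DopV (k + 2) (DopV k F1))) z =
       (- M4 z) *s DopV (k + 2) (DopV k F1) z + (- M6 z) *s DopV k F1 z + (- M8 z) *s F1 z"
      by (simp only: vec_eq_iff vector_add_component vector_smult_component) simp
  qed
  interpret mlde_form \<rho>1 \<upsilon> k lamc ic F1 g
    by (unfold_locales) (use unit lam' lamc_inj k_eq form g ode in auto)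
  \<comment> \<open>The shift m/12 in the exponents cancels against \<open>\<upsilon> Tmat\<close>,
    which makes T-determinacy of \<rho> applicable to \<rho>1.\<close>
  have "eigvals (\<rho>1 Tmat) = eigvals (\<rho> Tmat)"
  proof -
    have "inverse (\<upsilon> Tmat) * ee (lamc j) = ee (r (idx j))" for j
    proof -
      obtain n where n: "lamc j - r (idx j) - m / 12 = of_int n" using lam'(3) [of j] by (auto elim: Ints_cases)
      have "ee (lamc j) = ee (m / 12) * ee (r (idx j)) * ee (of_int n)"
        unfolding n [symmetric] ee_def by (simp add: exp_add [symmetric] algebra_simps)
      also have "ee (of_int n) = 1" by (simp add: ee_def exp_eq_1 Ints_def)
      finally have "ee (lamc j) = \<upsilon> Tmat * ee (r (idx j))" using cusp by (simp add: cusp_param_def)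
      then show ?thesis using unz [OF Tmat_in] by simp
    qed
    then have "eigvals (\<rho>1 Tmat) = (\<lambda>j. ee (r (idx j))) ` UNIV" unfolding eigvals_rho_T by simp
    also have "\<dots> = ee ` r ` range idx" by (simp add: image_image)
    finally show ?thesis unfolding eigs idx_range .
  qed
  then have irr: "irreducible_rep \<rho>1"
    using rho_Tdet rho1_rep indecomposable unfolding T_determined_def by blast
  interpret mlde_module \<rho>1 \<upsilon> k lamc ic F1 g k1 G
    by (unfold_locales) (use irr k1k G_in G_nz i_lam ic in \<open>auto simp: F1_def lamc_def\<close>)
  show ?thesis
    unfolding DpowV_expand using M_basis dim_Hspace mdim_sum by simp
qed

end
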